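(* Let $d\in\mathbb{N}$ and $-2<s<d$. There exist positive constants $b_{s,d}, c_{s,d}$ (depending only on $s$ and $d$) such that the following hold for all $N\in\mathbb{N}$. (1) If $0<s<d$, then $$-b_{s,d}N^{s/d}\le \mathcal{P}_{K_s}(N)-\mathcal{I}_{s,d}N\le -c_{s,d}N^{s/d}.$$ (2) If $-2<s<0$, then $$\mathcal{I}_{s,d}+b_{s,d}N^{s/d}\le \mathcal{P}_{K_s}(N)-\mathcal{I}_{s,d}N\le -c_{s,d}N^{s/d}.$$ (3) If $s=0$, then $$-\frac{\log N}{d}-b_{0,d}\le \mathcal{P}_{K_0}(N)-\mathcal{I}_{0,d}N\le -c_{0,d}.$$
   Context: $\mathbb{S}^d\subset\mathbb{R}^{d+1}$ is the unit sphere with Euclidean norm $\|\cdot\|$, and $\sigma_d$ is the surface measure normalized by $\sigma_d(\mathbb{S}^d)=1$. The Riesz $s$-kernel is $K_s(x,y)=\operatorname{sgn}(s)\|x-y\|^{-s}$ for $s\ne0$ and $K_0(x,y)=-\log\|x-y\|$ (with value $+\infty$ at $x=y$ when $s\ge0$). For $N$ points $x_1,\dots,x_N\in\mathbb{S}^d$ (repetitions allowed), $\omega_{N,d}=\{x_1,\dots,x_N\}$, the polarization is $P_{K}(\omega_{N,d})=\min_{x\in\mathbb{S}^d}\sum_{j=1}^N K(x,x_j)$, and the maximal polarization is $\mathcal{P}_K(N)=\max_{\omega_{N,d}\subset\mathbb{S}^d}P_K(\omega_{N,d})$. For $s<d$, $\mathcal{I}_{s,d}=\int_{\mathbb{S}^d}\int_{\mathbb{S}^d}K_s(x,y)\,d\sigma_d(x)\,d\sigma_d(y)$.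 *)

theory Defs
  imports "HOL-Analysis.Analysis"
begin

text \<open>
  The surface measure on the unit sphere, defined via polar coordinates: the area of a Borel
  set \<open>A\<close> of the sphere is \<open>n\<close> times the Lebesgue measure of the cone
  \<open>{r x | 0 < r \<le> 1, x \<in> A}\<close>, where \<open>n\<close> is the dimension of the
  ambient space (see the lemma \<open>emeasure_sphere_surface\<close> below).
\<close>

definition sphere_surface :: "'a::euclidean_space measure" where
  "sphere_surface =
     scale_measure (of_nat DIM('a))
       (distr (restrict_space lborel (cball 0 1 - {0})) (restrict_space borel (sphere 0 1))
         (\<lambda>x. x /\<^sub>R norm x))"

definition sphere_sigma :: "'a::euclidean_space measure" where
  "sphere_sigma = uniform_measure sphere_surface (sphere 0 1)"

definition riesz_kernel :: "real \<Rightarrow> 'a::euclidean_space \<Rightarrow> 'a \<Rightarrow> ereal" where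
  "riesz_kernel s x y =
     (if s \<ge> 0 \<and> x = y then \<infinity>
      else if s = 0 then ereal (- ln (norm (x - y)))
      else ereal (sgn s * norm (x - y) powr (- s)))"

text \<open>
  Minimum and maximum are written as infimum and supremum in the complete lattice of the
  extended reals. A configuration is an indexed family, so points may be repeated; only its
  values on \<open>{1..N}\<close> matter.
\<close>

definition polarization ::
    "('a::euclidean_space \<Rightarrow> 'a \<Rightarrow> ereal) \<Rightarrow> nat \<Rightarrow> (nat \<Rightarrow> 'a) \<Rightarrow> ereal" where
  "polarization K N \<omega> = (INF x\<in>sphere 0 1. \<Sum>j=1..N. K x (\<omega> j))"

definition max_polarization :: "('a::euclidean_space \<Rightarrow> 'a \<Rightarrow> ereal) \<Rightarrow> nat \<Rightarrow> ereal" where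
  "max_polarization K N = (SUP \<omega> \<in> {1..N} \<rightarrow> sphere 0 1. polarization K N \<omega>)"

text \<open>
  The function \<open>real_of_ereal\<close> replaces the value \<open>\<infinity>\<close> by \<open>0\<close>. For the Riesz
  kernels this happens only on the diagonal, a null set on spheres of dimension at least \<open>1\<close>;
  for \<open>s\<close> less than the dimension of the sphere the kernel is integrable.
\<close>

definition continuous_energy :: "('a::euclidean_space \<Rightarrow> 'a \<Rightarrow> ereal) \<Rightarrow> real" where
  "continuous_energy K =
     (\<integral>y. (\<integral>x. real_of_ereal (K x y) \<partial>sphere_sigma) \<partial>sphere_sigma)"

lemma space_sphere_surface [simp]: "space sphere_surface = sphere 0 1"
  by (simp add: sphere_surface_def space_restrict_space space_scale_measure)

lemma sets_sphere_surface [simp]: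
  "sets sphere_surface = sets (restrict_space borel (sphere 0 1))"
  by (simp add: sphere_surface_def)

lemma measurable_radial_projection:
  "(\<lambda>x::'a::euclidean_space. x /\<^sub>R norm x) \<in>
     measurable (restrict_space lborel (cball 0 1 - {0})) (restrict_space borel (sphere 0 1))"
proof (rule measurable_restrict_space2)
  show "(\<lambda>x::'a. x /\<^sub>R norm x) \<in> space (restrict_space lborel (cball 0 1 - {0})) \<rightarrow> sphere 0 1"
    by (auto simp: space_restrict_space)
  show "(\<lambda>x::'a. x /\<^sub>R norm x) \<in> borel_measurable (restrict_space lborel (cball 0 1 - {0}))"
    by (intro measurable_restrict_space1) measurable
qed

lemma emeasure_sphere_surface:
  fixes A :: "'a::euclidean_space set"
  assumes A: "A \<in> sets borel" "A \<subseteq> sphere 0 1"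
  shows "emeasure sphere_surface A =
    of_nat DIM('a) * emeasure lborel {r *\<^sub>R x | r x. 0 < r \<and> r \<le> 1 \<and> x \<in> A}"
proof -
  let ?C = "cball 0 1 - {0::'a}"
  have A': "A \<in> sets (restrict_space borel (sphere 0 1))"
    using A by (auto simp: sets_restrict_space)
  have eq: "(\<lambda>x. x /\<^sub>R norm x) -` A \<inter> ?C = {r *\<^sub>R x | r x. 0 < r \<and> r \<le> 1 \<and> x \<in> A}"
    (is "?L = ?R")
  proof (intro equalityI subsetI)
    fix x assume "x \<in> ?L"
    then show "x \<in> ?R"
      by (intro CollectI exI[of _ "norm x"] exI[of _ "x /\<^sub>R norm x"]) auto
  next
    fix z assume "z \<in> ?R"
    then obtain r x where z: "z = r *\<^sub>R x" "0 < r" "r \<le> 1" "x \<in> A" by auto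
    with A(2) have "norm x = 1" by auto
    with z show "z \<in> ?L" by auto
  qed
  have "emeasure (distr (restrict_space lborel ?C) (restrict_space borel (sphere 0 1))
          (\<lambda>x. x /\<^sub>R norm x)) A = emeasure lborel ((\<lambda>x. x /\<^sub>R norm x) -` A \<inter> ?C)"
    by (subst emeasure_distr[OF measurable_radial_projection A'])
       (auto simp: space_restrict_space intro!: emeasure_restrict_space)
  then show ?thesis
    by (simp add: sphere_surface_def eq)
qed

end

theory Submission
  imports Defs
begin

text \<open>
  Lower bounds: in a nearly energy-minimizing configuration of \<open>N + 1\<close> points every point nearly
  minimizes the potential of the others, so the polarization is at least the minimal energy divided
  by \<open>N + 1\<close>. For all \<open>- 2 < s < d\<close> the kernel is, up to a constant, a positive mixture over \<open>w\<close> of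
  Gaussians \<open>exp (- w * r\<^sup>2)\<close>. An \<open>n\<close>-point Gaussian energy, diagonal included, is at least \<open>n\<close>, and it is at
  least \<open>n\<^sup>2 J(w)\<close> by positive definiteness, where the energy integral \<open>J(w)\<close> of the uniform measure is \<open>O(w powr (- d / 2))\<close>.
  Splitting the mixture at \<open>w\<close> of order \<open>n powr (2 / d)\<close> gives the energy bounds.

  Upper bounds: let \<open>f\<close> be the potential of a configuration minus its mean. If \<open>f \<ge> - m\<close>, then the
  integral of \<open>f g\<close> is at least \<open>- 2 m C\<close> whenever \<open>\<bar>g\<bar> \<le> C\<close>. Conformal covariance provides zonal functions
  with explicit Riesz potential \<open>(\<tau> + norm (x - p)\<^sup>2) powr (- s / 2)\<close>; finite differences in \<open>\<tau>\<close> at scale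
  \<open>\<tau> = \<delta>\<^sup>2\<close>, \<open>\<delta> = \<epsilon> N powr (- 1 / d)\<close>, yield test functions whose potential has positive mean but is
  nonpositive at distance \<open>\<ge> R \<delta>\<close> from the center. For \<open>g\<close> one superposes them over all centers far from
  the configuration, which fill at least half of the sphere.

  The conformal maps come from Lorentz boosts acting on the light cone, which move each
  point along a fixed direction, so that their Jacobian is a one-dimensional computation.
\<close>

section \<open>Lebesgue measure along lines and Lorentz boosts\<close>

text \<open>All three ranges of \<open>s\<close> share one analysis because minus the derivative of
  the kernel, taken in the squared distance \<open>v\<close>, is a positive multiple of
  \<open>v powr (- s / 2 - 1)\<close>, which for \<open>s > - 2\<close> is a Gaussian mixture with
  weight \<open>w powr (s / 2)\<close>. Integrating from \<open>v\<close> to 4, the largest squared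
  distance on the sphere, represents the kernel minus its antipodal value. Without this subtraction
  the mixture diverges at \<open>w = 0\<close> for \<open>s \<le> 0\<close>.

  In the upper bound the points may lie anywhere, so a test function must work for every
  configuration. Its norm has to stay bounded as \<open>\<delta>\<close> tends to 0, while the mean
  of its potential is of order \<open>\<delta> powr (d - s)\<close>: then \<open>N\<close> points at
  scale \<open>N powr (- 1 / d)\<close> yield \<open>N powr (s / d)\<close>. The explicit potentials
  themselves have tails too heavy to be concentrated at scale \<open>\<delta>\<close>. Taking
  \<open>d + 1\<close> differences makes the decay faster than the volume grows for every admissible
  \<open>s\<close>, and subtracting a small multiple of a wider copy turns the remaining tail
  negative without losing the mean.\<close>

lemma nn_integral_lborel_translate:
  fixes c :: "'a::euclidean_space"
  assumes [measurable]: "F \<in> borel_measurable borel"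
  shows "(\<integral>\<^sup>+x. F (x + c) \<partial>lborel) = (\<integral>\<^sup>+x. F x \<partial>lborel)"
proof -
  have "(\<integral>\<^sup>+x. F x \<partial>lborel) = (\<integral>\<^sup>+x. F x \<partial>distr lborel borel ((+) c))"
    by (simp add: lborel_distr_plus)
  also have "\<dots> = (\<integral>\<^sup>+x. F (x + c) \<partial>lborel)"
    by (subst nn_integral_distr) (auto simp: add.commute)
  finally show ?thesis ..
qed

lemma nn_integral_lborel_scale:
  fixes F :: "'a::euclidean_space \<Rightarrow> ennreal"
  assumes [measurable]: "F \<in> borel_measurable borel" and c: "c > 0"
  shows "(\<integral>\<^sup>+x. F x \<partial>lborel) = ennreal (c ^ DIM('a)) * (\<integral>\<^sup>+x. F (c *\<^sub>R x) \<partial>lborel)"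
  using c by (subst lborel_affine[of c 0])
     (auto simp: nn_integral_density nn_integral_distr nn_integral_cmult)

text \<open>Fubini in an arbitrary unit direction, without rotating coordinates: write 1 as the
  integral over \<open>t\<close> of the indicator of
  \<open>0 \<le> x \<bullet> u - t \<le> 1\<close>, swap the integrals and translate
  \<open>x\<close> by \<open>t *\<^sub>R u\<close>. The slab meets each line in a segment of length
  one, so every line has weight one.\<close>

lemma nn_integral_lborel_lines:
  fixes u :: "'a::euclidean_space"
  assumes [measurable]: "F \<in> borel_measurable borel" and u: "norm u = 1"
  shows "(\<integral>\<^sup>+x. F x \<partial>lborel) =
    (\<integral>\<^sup>+x. indicator {0..1} (x \<bullet> u) * (\<integral>\<^sup>+t. F (x + t *\<^sub>R u) \<partial>lborel) \<partial>lborel)"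
proof -
  have uu: "u \<bullet> u = 1" using u by (simp add: norm_eq_1)
  have one: "(\<integral>\<^sup>+t. indicator {0..1} (y - t) \<partial>lborel) = (1::ennreal)" for y :: real
  proof -
    have "(\<integral>\<^sup>+t. indicator {0..1} (y - t) \<partial>lborel) = (\<integral>\<^sup>+t. indicator {y-1..y} t \<partial>lborel)"
      by (intro nn_integral_cong) (auto split: split_indicator)
    then show ?thesis by simp
  qed
  have "(\<integral>\<^sup>+x. F x \<partial>lborel) = (\<integral>\<^sup>+x. (\<integral>\<^sup>+t. F x * indicator {0..1} (x \<bullet> u - t) \<partial>lborel) \<partial>lborel)"
    by (subst nn_integral_cmult) (auto simp: one)
  also have "\<dots> = (\<integral>\<^sup>+t. (\<integral>\<^sup>+x. F x * indicator {0..1} (x \<bullet> u - t) \<partial>lborel) \<partial>lborel)"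
    by (rule lborel_pair.Fubini') simp
  also have "\<dots> = (\<integral>\<^sup>+t. (\<integral>\<^sup>+x. F (x + t *\<^sub>R u) * indicator {0..1} (x \<bullet> u) \<partial>lborel) \<partial>lborel)"
  proof (rule nn_integral_cong)
    fix t :: real
    show "(\<integral>\<^sup>+x. F x * indicator {0..1} (x \<bullet> u - t) \<partial>lborel) =
      (\<integral>\<^sup>+x. F (x + t *\<^sub>R u) * indicator {0..1} (x \<bullet> u) \<partial>lborel)"
      by (subst nn_integral_lborel_translate[of _ "t *\<^sub>R u", symmetric]) (simp_all add: inner_simps uu)
  qed
  also have "\<dots> = (\<integral>\<^sup>+x. (\<integral>\<^sup>+t. F (x + t *\<^sub>R u) * indicator {0..1} (x \<bullet> u) \<partial>lborel) \<partial>lborel)"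
    by (rule lborel_pair.Fubini') simp
  also have "\<dots> = (\<integral>\<^sup>+x. indicator {0..1} (x \<bullet> u) * (\<integral>\<^sup>+t. F (x + t *\<^sub>R u) \<partial>lborel) \<partial>lborel)"
    by (intro nn_integral_cong) (subst nn_integral_multc, auto simp: mult.commute)
  finally show ?thesis .
qed

text \<open>On each line parallel to \<open>u\<close> the reflection sends \<open>t\<close> to
  \<open>- t - 2 * (x \<bullet> u)\<close>, an isometry of the real line.\<close>

lemma nn_integral_lborel_reflect:
  fixes u :: "'a::euclidean_space"
  assumes [measurable]: "F \<in> borel_measurable borel" and u: "norm u = 1"
  shows "(\<integral>\<^sup>+x. F (x - (2 * (x \<bullet> u)) *\<^sub>R u) \<partial>lborel) = (\<integral>\<^sup>+x. F x \<partial>lborel)"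
proof -
  have uu: "u \<bullet> u = 1" using u by (simp add: norm_eq_1)
  have "(\<integral>\<^sup>+t. F (x + t *\<^sub>R u - (2 * ((x + t *\<^sub>R u) \<bullet> u)) *\<^sub>R u) \<partial>lborel)
      = (\<integral>\<^sup>+t. F (x + t *\<^sub>R u) \<partial>lborel)" for x
  proof -
    have "(\<integral>\<^sup>+t. F (x + t *\<^sub>R u) \<partial>lborel)
        = (\<integral>\<^sup>+t. F (x + (- 2 * (x \<bullet> u) + (-1) * t) *\<^sub>R u) \<partial>lborel)"
      by (subst nn_integral_real_affine[where c="-1" and t="-2 * (x \<bullet> u)"]) auto
    moreover have "x + t *\<^sub>R u - (2 * ((x + t *\<^sub>R u) \<bullet> u)) *\<^sub>R u = x + (- 2 * (x \<bullet> u) + (-1) * t) *\<^sub>R u" for t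
      unfolding add_diff_eq[symmetric] scaleR_left_diff_distrib[symmetric] by (simp add: inner_simps uu)
    ultimately show ?thesis by (simp only:)
  qed
  then show ?thesis
    by (subst (1 2) nn_integral_lborel_lines[OF _ u]) simp_all
qed

text \<open>Substitution on the intervals from \<open>- (n + 1)\<close> to \<open>n + 1\<close>
  followed by monotone convergence; the two limits of \<open>g\<close> make the image intervals
  exhaust the line.\<close>

lemma nn_integral_substitution_real_line:
  fixes F :: "real \<Rightarrow> ennreal"
  assumes [measurable]: "F \<in> borel_measurable borel"
    and deriv: "\<And>x. (g has_real_derivative g' x) (at x)"
    and cont: "continuous_on UNIV g'" and nonneg: "\<And>x. g' x \<ge> 0"
    and top: "filterlim g at_top at_top" and bot: "filterlim g at_bot at_bot"
  shows "(\<integral>\<^sup>+x. F (g x) * ennreal (g' x) \<partial>lborel) = (\<integral>\<^sup>+x. F x \<partial>lborel)"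
proof -
  have mono: "mono g"
    by (intro monoI DERIV_nonneg_imp_nondecreasing[of _ _ g]) (use deriv nonneg in blast)+
  have cg: "continuous_on UNIV g"
    by (intro continuous_at_imp_continuous_on ballI DERIV_isCont[OF deriv])
  have [measurable]: "g \<in> borel_measurable borel" "g' \<in> borel_measurable borel"
    using cg cont by (auto intro: borel_measurable_continuous_onI)
  let ?a = "\<lambda>n::nat. - (real n + 1)" and ?b = "\<lambda>n::nat. real n + 1"
  have b: "filterlim ?b at_top sequentially"
    by (rule filterlim_at_top_mono[OF filterlim_real_sequentially]) simp
  then have a: "filterlim ?a at_bot sequentially"
    by (simp only: filterlim_uminus_at_top)
  have tt: "filterlim (\<lambda>n. g (?b n)) at_top sequentially"
    by (rule filterlim_compose[OF top b])
  have tb: "filterlim (\<lambda>n. g (?a n)) at_bot sequentially"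
    by (rule filterlim_compose[OF bot a])
  have "(\<integral>\<^sup>+x. F x \<partial>lborel) = (\<integral>\<^sup>+x. (SUP n. F x * indicator {g (?a n)..g (?b n)} x) \<partial>lborel)"
  proof (intro nn_integral_cong)
    fix x
    obtain n where n: "g (?b n) \<ge> x" "g (?a n) \<le> x"
      using eventually_conj[OF tt[unfolded filterlim_at_top, rule_format, of x]
          tb[unfolded filterlim_at_bot, rule_format, of x]]
      by (metis (mono_tags, lifting) eventually_sequentially order_refl)
    show "F x = (SUP n. F x * indicator {g (?a n)..g (?b n)} x)"
    proof (rule antisym)
      show "F x \<le> (SUP n. F x * indicator {g (?a n)..g (?b n)} x)"
        using n by (intro SUP_upper2[of n]) auto
      show "(SUP n. F x * indicator {g (?a n)..g (?b n)} x) \<le> F x"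
        by (intro SUP_least) (auto split: split_indicator)
    qed
  qed
  also have "\<dots> = (SUP n. \<integral>\<^sup>+x. F x * indicator {g (?a n)..g (?b n)} x \<partial>lborel)"
  proof (intro nn_integral_monotone_convergence_SUP)
    show "incseq (\<lambda>n x. F x * indicator {g (?a n)..g (?b n)} x)"
    proof (intro incseq_SucI le_funI)
      fix n x
      have "g (?a (Suc n)) \<le> g (?a n)" "g (?b n) \<le> g (?b (Suc n))"
        by (auto intro!: monoD[OF mono])
      then show "F x * indicator {g (?a n)..g (?b n)} x
          \<le> F x * indicator {g (?a (Suc n))..g (?b (Suc n))} x"
        by (auto split: split_indicator)
    qed
  qed simp
  also have "\<dots> = (SUP n. \<integral>\<^sup>+x. F (g x) * ennreal (g' x) * indicator {?a n..?b n} x \<partial>lborel)"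
    using cont deriv nonneg
    by (subst nn_integral_substitution_aux) (auto intro: continuous_on_subset)
  also have "\<dots> = (\<integral>\<^sup>+x. (SUP n. F (g x) * ennreal (g' x) * indicator {?a n..?b n} x) \<partial>lborel)"
    by (intro nn_integral_monotone_convergence_SUP[symmetric] incseq_SucI le_funI)
      (auto split: split_indicator)
  also have "\<dots> = (\<integral>\<^sup>+x. F (g x) * ennreal (g' x) \<partial>lborel)"
  proof (intro nn_integral_cong)
    fix x :: real
    obtain n where n: "real n \<ge> \<bar>x\<bar>" using real_arch_simple by blast
    show "(SUP n. F (g x) * ennreal (g' x) * indicator {?a n..?b n} x) = F (g x) * ennreal (g' x)"
    proof (rule antisym)
      show "F (g x) * ennreal (g' x) \<le> (SUP n. F (g x) * ennreal (g' x) * indicator {?a n..?b n} x)"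
        using n by (intro SUP_upper2[of n]) (auto split: split_indicator)
      show "(SUP n. F (g x) * ennreal (g' x) * indicator {?a n..?b n} x) \<le> F (g x) * ennreal (g' x)"
        by (intro SUP_least) (auto split: split_indicator)
    qed
  qed
  finally show ?thesis ..
qed

text \<open>The space component of the Lorentz boost with velocity \<open>\<beta>\<close> along
  \<open>p\<close>, applied to the light-like vector with time component \<open>norm x\<close> and
  space component \<open>x\<close>. The term in \<open>norm x\<close> makes it nonlinear;
  \<open>boost_factor\<close> is the time component of the image.\<close>

definition boost :: "real \<Rightarrow> 'a::euclidean_space \<Rightarrow> 'a \<Rightarrow> 'a" where
  "boost \<beta> p x = x + ((1 / sqrt (1 - \<beta>\<^sup>2) - 1) * (x \<bullet> p) + \<beta> / sqrt (1 - \<beta>\<^sup>2) * norm x) *\<^sub>R p"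

definition boost_factor :: "real \<Rightarrow> 'a::euclidean_space \<Rightarrow> 'a \<Rightarrow> real" where
  "boost_factor \<beta> p x = (norm x + \<beta> * (x \<bullet> p)) / sqrt (1 - \<beta>\<^sup>2)"

context
  fixes \<beta> :: real and p :: "'a::euclidean_space"
  assumes \<beta>: "0 \<le> \<beta>" "\<beta> < 1" and p: "norm p = 1"
begin

lemma inner_pole: "p \<bullet> p = 1" using p by (simp add: norm_eq_1)

lemma one_minus_beta_sq: "0 < 1 - \<beta>\<^sup>2"
  using \<beta> by (simp add: abs_square_less_1)

lemma boost_factor_nonneg: "boost_factor \<beta> p x \<ge> 0"
proof -
  have "\<bar>x \<bullet> p\<bar> \<le> norm x" using Cauchy_Schwarz_ineq2[of x p] p by simp
  then have "\<beta> * \<bar>x \<bullet> p\<bar> \<le> 1 * norm x" using \<beta> by (intro mult_mono) auto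
  moreover have "\<beta> * (x \<bullet> p) \<ge> - (\<beta> * \<bar>x \<bullet> p\<bar>)" using \<beta> by (smt (verit) mult_minus_right mult_left_mono)
  ultimately have "norm x + \<beta> * (x \<bullet> p) \<ge> 0" by linarith
  then show ?thesis using one_minus_beta_sq by (simp add: boost_factor_def)
qed

lemma boost_factor_pos: assumes "x \<noteq> 0" shows "boost_factor \<beta> p x > 0"
proof -
  have "\<bar>x \<bullet> p\<bar> \<le> norm x" using Cauchy_Schwarz_ineq2[of x p] p by simp
  then have "\<beta> * \<bar>x \<bullet> p\<bar> \<le> \<beta> * norm x" using \<beta> by (intro mult_mono) auto
  moreover have "\<beta> * norm x < norm x" using \<beta> assms by simp
  moreover have "\<beta> * (x \<bullet> p) \<ge> - (\<beta> * \<bar>x \<bullet> p\<bar>)" using \<beta> by (smt (verit) mult_minus_right mult_left_mono)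
  ultimately have "norm x + \<beta> * (x \<bullet> p) > 0" by linarith
  then show ?thesis using one_minus_beta_sq by (simp add: boost_factor_def)
qed

text \<open>A boost is the restriction of a Lorentz transformation to the light cone
  \<open>{(norm x, x)}\<close>, so it preserves the Lorentz product.\<close>

lemma boost_lorentz:
  "boost_factor \<beta> p x * boost_factor \<beta> p y - boost \<beta> p x \<bullet> boost \<beta> p y = norm x * norm y - x \<bullet> y"
proof -
  define g where "g = 1 / sqrt (1 - \<beta>\<^sup>2)"
  have g: "g * g * (1 - \<beta>\<^sup>2) = 1"
    using one_minus_beta_sq by (simp add: g_def)
  have 1: "boost_factor \<beta> p x = g * (norm x + \<beta> * (x \<bullet> p))" for x
    by (simp add: boost_factor_def g_def)
  have 2: "boost \<beta> p x = x + ((g - 1) * (x \<bullet> p) + \<beta> * g * norm x) *\<^sub>R p" for x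
    by (simp add: boost_def g_def)
  have "boost \<beta> p x \<bullet> boost \<beta> p y =
    x \<bullet> y + ((g - 1) * (x \<bullet> p) + \<beta> * g * norm x) * (y \<bullet> p)
      + ((g - 1) * (y \<bullet> p) + \<beta> * g * norm y) * (x \<bullet> p)
      + ((g - 1) * (x \<bullet> p) + \<beta> * g * norm x) * ((g - 1) * (y \<bullet> p) + \<beta> * g * norm y)"
    unfolding 2 by (simp add: inner_simps inner_pole inner_commute algebra_simps)
  then show ?thesis using g unfolding 1 by algebra
qed

lemma norm_boost: "norm (boost \<beta> p x) = boost_factor \<beta> p x"
proof -
  have "(boost_factor \<beta> p x)\<^sup>2 = boost \<beta> p x \<bullet> boost \<beta> p x"
    using boost_lorentz[of x x] by (simp add: power2_eq_square norm_eq_sqrt_inner)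
  then show ?thesis using boost_factor_nonneg[of x]
    by (metis norm_eq_sqrt_inner real_sqrt_abs abs_of_nonneg)
qed

lemma boost_measurable [measurable]: "boost \<beta> p \<in> borel_measurable borel"
  unfolding boost_def[abs_def] by measurable

lemma boost_factor_measurable [measurable]: "boost_factor \<beta> p \<in> borel_measurable borel"
  unfolding boost_factor_def[abs_def] by measurable

lemma boost_scaleR: "r \<ge> 0 \<Longrightarrow> boost \<beta> p (r *\<^sub>R x) = r *\<^sub>R boost \<beta> p x"
  by (simp add: boost_def algebra_simps)

lemma boost_factor_scaleR: "r \<ge> 0 \<Longrightarrow> boost_factor \<beta> p (r *\<^sub>R x) = r * boost_factor \<beta> p x"
  by (simp add: boost_factor_def algebra_simps)

text \<open>In the rapidity coordinate given by \<open>s = a * sinh \<theta>\<close> the measure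
  with density \<open>1 / sqrt (a\<^sup>2 + s\<^sup>2)\<close> is Lebesgue measure in
  \<open>\<theta>\<close>, and the boost is a translation of \<open>\<theta>\<close>. Concretely,
  with \<open>r s = sqrt (a\<^sup>2 + s\<^sup>2)\<close>, the map \<open>g\<close> satisfies
  \<open>g' s = r (g s) / r s\<close>.\<close>

lemma nn_integral_hyperbola:
  fixes F :: "real \<Rightarrow> ennreal"
  assumes [measurable]: "F \<in> borel_measurable borel" and a: "a > 0"
  shows "(\<integral>\<^sup>+s. F ((s + \<beta> * sqrt (a\<^sup>2 + s\<^sup>2)) / sqrt (1 - \<beta>\<^sup>2)) * ennreal (1 / sqrt (a\<^sup>2 + s\<^sup>2)) \<partial>lborel) =
    (\<integral>\<^sup>+s. F s * ennreal (1 / sqrt (a\<^sup>2 + s\<^sup>2)) \<partial>lborel)"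
proof -
  define c where "c = sqrt (1 - \<beta>\<^sup>2)"
  have c: "c > 0" "c\<^sup>2 = 1 - \<beta>\<^sup>2" using one_minus_beta_sq by (auto simp: c_def)
  define r where "r s = sqrt (a\<^sup>2 + s\<^sup>2)" for s
  define g where "g s = (s + \<beta> * r s) / c" for s
  define g' where "g' s = (1 + \<beta> * (s / r s)) / c" for s
  have pos: "a\<^sup>2 + s\<^sup>2 > 0" for s using a by (simp add: add_pos_nonneg)
  have r: "r s > 0" "(r s)\<^sup>2 = a\<^sup>2 + s\<^sup>2" for s using pos[of s] by (auto simp: r_def)
  have rs: "\<bar>s\<bar> \<le> r s" for s by (simp add: r_def real_le_rsqrt)
  have bs: "\<bar>\<beta> * s\<bar> \<le> \<beta> * r s" for s using rs[of s] \<beta> by (simp add: abs_mult mult_left_mono)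
  have pos': "r s + \<beta> * s > 0" for s
  proof -
    have "\<beta> * r s < 1 * r s" using \<beta> r(1)[of s] by (intro mult_strict_right_mono) auto
    then show ?thesis using bs[of s] by linarith
  qed
  have dr: "(r has_real_derivative s / r s) (at s)" for s
    unfolding r_def using pos[of s]
    by (auto intro!: derivative_eq_intros simp: field_simps)
  have deriv: "(g has_real_derivative g' s) (at s)" for s
    unfolding g_def g'_def by (rule derivative_eq_intros dr refl | use c in simp)+
  have cont: "continuous_on UNIV g'"
    unfolding g'_def r_def using c pos by (intro continuous_intros) (auto simp: less_imp_neq[symmetric])
  have g'_eq: "g' s = (r s + \<beta> * s) / c / r s" for s
    using r(1)[of s] c by (simp add: g'_def field_simps)
  have rg: "r (g s) = (r s + \<beta> * s) / c" for s
  proof -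
    have "a\<^sup>2 + (g s)\<^sup>2 = ((r s + \<beta> * s) / c)\<^sup>2"
    proof -
      have "a\<^sup>2 * c\<^sup>2 + (s + \<beta> * r s)\<^sup>2 = (r s + \<beta> * s)\<^sup>2"
        using r(2)[of s] c(2) by algebra
      then show ?thesis using c(1) by (simp add: g_def power_divide field_simps)
    qed
    then show ?thesis using pos'[of s] c(1) by (simp add: r_def)
  qed
  have lin1: "g s \<ge> (1 - \<beta>) * s / c" if "s \<ge> 0" for s
  proof -
    have "0 \<le> \<beta> * r s" using \<beta> r(1)[of s] by simp
    moreover have "0 \<le> \<beta> * s" using \<beta> that by simp
    ultimately show ?thesis using c unfolding g_def by (intro divide_right_mono) (auto simp: algebra_simps)
  qed
  have lin2: "g s \<le> ((1 - \<beta>) * s + a) / c" if "s \<le> 0" for s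
  proof -
    have "r s \<le> a + \<bar>s\<bar>" unfolding r_def using a sqrt_add_le_add_sqrt[of "a\<^sup>2" "s\<^sup>2"] by simp
    then have "\<beta> * r s \<le> \<beta> * a + \<beta> * (- s)" using \<beta> that
      by (metis abs_of_nonpos distrib_left mult_left_mono)
    moreover have "\<beta> * a \<le> 1 * a" using \<beta> a by (intro mult_right_mono) auto
    ultimately show ?thesis using c unfolding g_def by (intro divide_right_mono) (auto simp: algebra_simps)
  qed
  have [measurable]: "r \<in> borel_measurable borel" unfolding r_def[abs_def] by measurable
  have top: "filterlim g at_top at_top"
  proof (rule filterlim_at_top_mono)
    have "filterlim (\<lambda>s. ((1 - \<beta>) / c) * s) at_top at_top" using \<beta> c
      by (intro filterlim_tendsto_pos_mult_at_top[OF tendsto_const] filterlim_ident) auto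
    then show "filterlim (\<lambda>s. (1 - \<beta>) * s / c) at_top at_top" by simp
    show "\<forall>\<^sub>F s in at_top. (1 - \<beta>) * s / c \<le> g s"
      using eventually_ge_at_top[of 0] by eventually_elim (rule lin1)
  qed
  have bot: "filterlim g at_bot at_bot"
    unfolding filterlim_at_bot
  proof
    fix Z
    show "\<forall>\<^sub>F s in at_bot. g s \<le> Z"
      using eventually_le_at_bot[of "min 0 ((Z * c - a) / (1 - \<beta>))"]
    proof eventually_elim
      case (elim s)
      then have "(1 - \<beta>) * s + a \<le> Z * c" using \<beta> by (simp add: field_simps)
      then have "((1 - \<beta>) * s + a) / c \<le> Z" using c by (simp add: field_simps)
      with lin2[of s] elim show ?case by simp
    qed
  qed
  have "(\<integral>\<^sup>+s. F (g s) * ennreal (1 / r s) \<partial>lborel) =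
    (\<integral>\<^sup>+s. F (g s) * ennreal (1 / r (g s)) * ennreal (g' s) \<partial>lborel)"
  proof (intro nn_integral_cong)
    fix s
    have "ennreal (1 / r s) = ennreal (1 / r (g s)) * ennreal (g' s)"
      unfolding rg g'_eq using pos'[of s] c r(1)[of s]
      by (subst ennreal_mult[symmetric]) (auto intro!: divide_nonneg_nonneg simp: less_imp_le)
    then show "F (g s) * ennreal (1 / r s) = F (g s) * ennreal (1 / r (g s)) * ennreal (g' s)"
      by (simp add: mult.assoc)
  qed
  also have "\<dots> = (\<integral>\<^sup>+s. F s * ennreal (1 / r s) \<partial>lborel)"
    by (rule nn_integral_substitution_real_line[OF _ deriv cont _ top bot])
       (use pos' c r in \<open>auto simp: g'_eq less_imp_le\<close>)
  finally show ?thesis by (simp add: g_def r_def c_def)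
qed

text \<open>Density \<open>1 / norm x\<close> is the Lorentz invariant measure on the light cone. A
  boost only moves points along \<open>p\<close>, so on each line parallel to \<open>p\<close>, at
  distance \<open>a\<close> from the origin, the claim is the one-dimensional invariance just
  shown.\<close>

lemma nn_integral_boost:
  fixes F :: "'a \<Rightarrow> ennreal"
  assumes [measurable]: "F \<in> borel_measurable borel" and dim: "2 \<le> DIM('a)"
  shows "(\<integral>\<^sup>+x. F (boost \<beta> p x) * ennreal (1 / norm x) \<partial>lborel)
    = (\<integral>\<^sup>+x. F x * ennreal (1 / norm x) \<partial>lborel)"
proof -
  \<comment> \<open>The axis of the boost, where the line passes through the origin and
    \<open>a = 0\<close>. It is a null set because the dimension is at least 2.\<close>
  let ?S = "{x. x - (x \<bullet> p) *\<^sub>R p = 0}"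
  have "?S \<subseteq> span {p}"
  proof
    fix x assume "x \<in> ?S"
    then have "x = (x \<bullet> p) *\<^sub>R p" by simp
    then show "x \<in> span {p}" by (metis span_base span_scale singletonI)
  qed
  then have "dim ?S \<le> 1"
    by (metis dim_le_card card.empty card_insert_disjoint empty_iff finite.emptyI finite.insertI One_nat_def)
  then have "negligible ?S" using dim by (intro negligible_lowdim) simp
  moreover have "?S \<in> sets lborel" by measurable
  ultimately have "?S \<in> null_sets lborel"
    by (simp add: negligible_iff_null_sets null_sets_completion_iff)
  then have AE: "AE x in lborel. x - (x \<bullet> p) *\<^sub>R p \<noteq> 0"
    by (simp add: AE_iff_null_sets)
  have line: "(\<integral>\<^sup>+t. F (boost \<beta> p (x + t *\<^sub>R p)) * ennreal (1 / norm (x + t *\<^sub>R p)) \<partial>lborel)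
      = (\<integral>\<^sup>+t. F (x + t *\<^sub>R p) * ennreal (1 / norm (x + t *\<^sub>R p)) \<partial>lborel)"
    if x: "x - (x \<bullet> p) *\<^sub>R p \<noteq> 0" for x
  proof -
    define z where "z = x - (x \<bullet> p) *\<^sub>R p"
    define a where "a = norm z"
    have a: "a > 0" using x by (simp add: a_def z_def)
    have zp: "z \<bullet> p = 0" by (simp add: z_def inner_simps inner_pole)
    have shift: "(\<integral>\<^sup>+t. G (x + t *\<^sub>R p) \<partial>lborel) = (\<integral>\<^sup>+s. G (z + s *\<^sub>R p) \<partial>lborel)"
      if [measurable]: "G \<in> borel_measurable borel" for G :: "'a \<Rightarrow> ennreal"
      by (subst nn_integral_real_affine[where c=1 and t="- (x \<bullet> p)"]) (simp_all add: z_def algebra_simps)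
    have nz: "norm (z + s *\<^sub>R p) = sqrt (a\<^sup>2 + s\<^sup>2)" for s
      by (simp add: norm_eq_sqrt_inner[of "z + s *\<^sub>R p"] inner_simps inner_commute[of p z] zp inner_pole a_def
          power2_norm_eq_inner power2_eq_square[of s])
    have bz: "boost \<beta> p (z + s *\<^sub>R p) = z + ((s + \<beta> * sqrt (a\<^sup>2 + s\<^sup>2)) / sqrt (1 - \<beta>\<^sup>2)) *\<^sub>R p" for s
      unfolding boost_def nz add.assoc scaleR_left_distrib[symmetric]
      by (simp add: inner_simps zp inner_pole algebra_simps add_divide_distrib)
    have "(\<integral>\<^sup>+t. F (boost \<beta> p (x + t *\<^sub>R p)) * ennreal (1 / norm (x + t *\<^sub>R p)) \<partial>lborel)
      = (\<integral>\<^sup>+s. F (boost \<beta> p (z + s *\<^sub>R p)) * ennreal (1 / norm (z + s *\<^sub>R p)) \<partial>lborel)"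
      by (rule shift) simp
    also have "\<dots> = (\<integral>\<^sup>+s. F (z + s *\<^sub>R p) * ennreal (1 / norm (z + s *\<^sub>R p)) \<partial>lborel)"
      unfolding nz bz using a by (intro nn_integral_hyperbola) simp_all
    also have "\<dots> = (\<integral>\<^sup>+t. F (x + t *\<^sub>R p) * ennreal (1 / norm (x + t *\<^sub>R p)) \<partial>lborel)"
      by (rule shift[symmetric]) simp
    finally show ?thesis .
  qed
  have "(\<integral>\<^sup>+x. F (boost \<beta> p x) * ennreal (1 / norm x) \<partial>lborel)
    = (\<integral>\<^sup>+x. indicator {0..1} (x \<bullet> p) *
        (\<integral>\<^sup>+t. F (boost \<beta> p (x + t *\<^sub>R p)) * ennreal (1 / norm (x + t *\<^sub>R p)) \<partial>lborel) \<partial>lborel)"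
    by (rule nn_integral_lborel_lines[OF _ p]) simp
  also have "\<dots> = (\<integral>\<^sup>+x. indicator {0..1} (x \<bullet> p) *
        (\<integral>\<^sup>+t. F (x + t *\<^sub>R p) * ennreal (1 / norm (x + t *\<^sub>R p)) \<partial>lborel) \<partial>lborel)"
    using AE by (intro nn_integral_cong_AE) (auto elim!: eventually_mono simp: line)
  also have "\<dots> = (\<integral>\<^sup>+x. F x * ennreal (1 / norm x) \<partial>lborel)"
    by (rule nn_integral_lborel_lines[OF _ p, symmetric]) simp
  finally show ?thesis .
qed

end

text \<open>In polar coordinates both sides are the same integral of \<open>A / M ^ n\<close> over
  directions. The proof evaluates the double integral of \<open>?W\<close> in two ways: integrating
  over \<open>\<rho>\<close> first gives the right-hand side divided by \<open>n\<close>, while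
  substituting \<open>x / \<rho>\<close> for \<open>x\<close> first moves the cutoff by
  \<open>M\<close> onto \<open>x\<close> and gives the left-hand side divided by
  \<open>n\<close>.\<close>

lemma nn_integral_radial_rescale:
  fixes A :: "'a::euclidean_space \<Rightarrow> ennreal" and M :: "'a \<Rightarrow> real"
  assumes [measurable]: "A \<in> borel_measurable borel" "M \<in> borel_measurable borel"
    and A: "\<And>r x. r > 0 \<Longrightarrow> A (r *\<^sub>R x) = A x" and M: "\<And>r x. r > 0 \<Longrightarrow> M (r *\<^sub>R x) = M x"
    and Mpos: "\<And>x. x \<noteq> 0 \<Longrightarrow> M x > 0"
  shows "(\<integral>\<^sup>+x. A x * indicator {x. norm x * M x \<le> 1} x \<partial>lborel) =
    (\<integral>\<^sup>+x. A x * ennreal (1 / M x ^ DIM('a)) * indicator (cball 0 1) x \<partial>lborel)"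
proof -
  define n where "n = DIM('a)"
  have n: "n > 0" by (simp add: n_def)
  have [measurable]: "cball (0::'a) 1 \<in> sets borel" by (simp add: borel_closed)
  let ?W = "\<lambda>x \<rho>. A x * indicator (cball 0 1) x * indicator {0<..} \<rho> *
    indicator {..1} (\<rho> * norm x * M x) * ennreal (norm x ^ n * \<rho> ^ (n - 1))"
  have AE0: "AE x in lborel. x \<noteq> (0::'a)" by (rule AE_lborel_singleton)
  have I1: "(\<integral>\<^sup>+\<rho>. ?W x \<rho> \<partial>lborel) =
    ennreal (1 / real n) * (A x * ennreal (1 / M x ^ n) * indicator (cball 0 1) x)" if x: "x \<noteq> 0" for x
  proof -
    define c where "c = 1 / (norm x * M x)"
    have c: "c > 0" using x Mpos[OF x] by (simp add: c_def)
    have "?W x \<rho> = A x * indicator (cball 0 1) x * ennreal (norm x ^ n) *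
        (ennreal (\<rho> ^ (n - 1)) * indicator {0..c} \<rho>)" if "\<rho> \<noteq> 0" for \<rho>
      using x Mpos[OF x] that
      by (auto simp: c_def indicator_def field_simps ennreal_mult')
    then have "(\<integral>\<^sup>+\<rho>. ?W x \<rho> \<partial>lborel) = (\<integral>\<^sup>+\<rho>. A x * indicator (cball 0 1) x * ennreal (norm x ^ n) *
        (ennreal (\<rho> ^ (n - 1)) * indicator {0..c} \<rho>) \<partial>lborel)"
      using AE_lborel_singleton[of 0] by (intro nn_integral_cong_AE) (auto elim!: eventually_mono)
    also have "\<dots> = A x * indicator (cball 0 1) x * ennreal (norm x ^ n) *
        (\<integral>\<^sup>+\<rho>. ennreal (\<rho> ^ (n - 1)) * indicator {0..c} \<rho> \<partial>lborel)"
      by (subst nn_integral_cmult) simp_all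
    also have "(\<integral>\<^sup>+\<rho>. ennreal (\<rho> ^ (n - 1)) * indicator {0..c} \<rho> \<partial>lborel) = ennreal (c ^ n / n - 0 ^ n / n)"
      using n c by (intro nn_integral_FTC_Icc) (auto intro!: derivative_eq_intros)
    also have "A x * indicator (cball 0 1) x * ennreal (norm x ^ n) * ennreal (c ^ n / n - 0 ^ n / n) =
       A x * indicator (cball 0 1) x * ennreal (norm x ^ n * (c ^ n / n))"
      using n c by (simp add: mult.assoc power_0_left flip: ennreal_mult)
    also have "norm x ^ n * (c ^ n / n) = 1 / real n * (1 / M x ^ n)"
      using x n by (simp add: c_def field_simps)
    also have "ennreal (1 / real n * (1 / M x ^ n)) = ennreal (1 / real n) * ennreal (1 / M x ^ n)"
      using Mpos[OF x] by (intro ennreal_mult) auto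
    finally show ?thesis by (simp add: mult_ac)
  qed
  have scale: "(\<integral>\<^sup>+x. ?W x \<rho> \<partial>lborel) = (\<integral>\<^sup>+x. A x * indicator {x. norm x * M x \<le> 1} x * ennreal (norm x ^ n) *
      (ennreal (1 / \<rho> ^ (n + 1)) * indicator {norm x..} \<rho>) * indicator {0<..} \<rho> \<partial>lborel)" for \<rho>
  proof (cases "\<rho> > 0")
    case True
    have meas1: "(\<lambda>x. ?W x \<rho>) \<in> borel_measurable borel" by measurable
    have e: "ennreal ((1 / \<rho>) ^ n) * ?W ((1 / \<rho>) *\<^sub>R x) \<rho> =
        A x * indicator {x. norm x * M x \<le> 1} x * ennreal (norm x ^ n) *
        (ennreal (1 / \<rho> ^ (n + 1)) * indicator {norm x..} \<rho>) * indicator {0<..} \<rho>" for x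
    proof -
      have "(1 / \<rho>) ^ n * (norm ((1 / \<rho>) *\<^sub>R x) ^ n * \<rho> ^ (n - 1)) = norm x ^ n * (1 / \<rho> ^ (n + 1))"
        using True n by (simp add: field_simps power_eq_if[of \<rho> n])
      then have "ennreal ((1 / \<rho>) ^ n) * ennreal (norm ((1 / \<rho>) *\<^sub>R x) ^ n * \<rho> ^ (n - 1))
          = ennreal (norm x ^ n) * ennreal (1 / \<rho> ^ (n + 1))"
        using True by (subst (1 2) ennreal_mult[symmetric]) auto
      moreover have "(1 / \<rho>) *\<^sub>R x \<in> cball 0 1 \<longleftrightarrow> \<rho> \<in> {norm x..}"
        using True by (simp add: field_simps)
      moreover have "\<rho> * norm ((1 / \<rho>) *\<^sub>R x) * M ((1 / \<rho>) *\<^sub>R x) \<in> {..1} \<longleftrightarrow> x \<in> {x. norm x * M x \<le> 1}"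
        using True M[of "1 / \<rho>" x] by simp
      ultimately show ?thesis using True A[of "1 / \<rho>" x]
        by (auto simp: indicator_def mult_ac)
    qed
    have "(\<integral>\<^sup>+x. ?W x \<rho> \<partial>lborel) =
        ennreal ((1 / \<rho>) ^ n) * (\<integral>\<^sup>+x. ?W ((1 / \<rho>) *\<^sub>R x) \<rho> \<partial>lborel)"
      using True by (intro nn_integral_lborel_scale[of "\<lambda>x. ?W x \<rho>" "1 / \<rho>", folded n_def] meas1) simp
    also have "\<dots> = (\<integral>\<^sup>+x. ennreal ((1 / \<rho>) ^ n) * ?W ((1 / \<rho>) *\<^sub>R x) \<rho> \<partial>lborel)"
      by (rule nn_integral_cmult[symmetric]) (use measurable_compose[OF _ meas1, of "\<lambda>x. (1 / \<rho>) *\<^sub>R x" borel] in simp)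
    finally show ?thesis unfolding e .
  qed simp
  have I2: "(\<integral>\<^sup>+\<rho>. A x * indicator {x. norm x * M x \<le> 1} x * ennreal (norm x ^ n) *
      (ennreal (1 / \<rho> ^ (n + 1)) * indicator {norm x..} \<rho>) * indicator {0<..} \<rho> \<partial>lborel) =
      ennreal (1 / real n) * (A x * indicator {x. norm x * M x \<le> 1} x)" if x: "x \<noteq> 0" for x
  proof -
    have "(\<integral>\<^sup>+\<rho>. A x * indicator {x. norm x * M x \<le> 1} x * ennreal (norm x ^ n) *
      (ennreal (1 / \<rho> ^ (n + 1)) * indicator {norm x..} \<rho>) * indicator {0<..} \<rho> \<partial>lborel) =
      (\<integral>\<^sup>+\<rho>. A x * indicator {x. norm x * M x \<le> 1} x * ennreal (norm x ^ n) *
      (ennreal (1 / \<rho> ^ (n + 1)) * indicator {norm x..} \<rho>) \<partial>lborel)"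
    proof (rule nn_integral_cong)
      fix \<rho> :: real
      have "norm x \<le> \<rho> \<Longrightarrow> 0 < \<rho>" using x by (meson less_le_trans zero_less_norm_iff)
      then show "A x * indicator {x. norm x * M x \<le> 1} x * ennreal (norm x ^ n) *
          (ennreal (1 / \<rho> ^ (n + 1)) * indicator {norm x..} \<rho>) * indicator {0<..} \<rho> =
          A x * indicator {x. norm x * M x \<le> 1} x * ennreal (norm x ^ n) *
          (ennreal (1 / \<rho> ^ (n + 1)) * indicator {norm x..} \<rho>)"
        by (cases "norm x \<le> \<rho>") simp_all
    qed
    also have "\<dots> = A x * indicator {x. norm x * M x \<le> 1} x * ennreal (norm x ^ n) *
      (\<integral>\<^sup>+\<rho>. ennreal (1 / \<rho> ^ (n + 1)) * indicator {norm x..} \<rho> \<partial>lborel)"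
      by (subst nn_integral_cmult) simp_all
    also have "(\<integral>\<^sup>+\<rho>. ennreal (1 / \<rho> ^ (n + 1)) * indicator {norm x..} \<rho> \<partial>lborel) =
        ennreal (0 - (- (1 / (n * norm x ^ n))))"
    proof (intro nn_integral_FTC_atLeast)
      fix \<rho> :: real assume r: "norm x \<le> \<rho>"
      then have r0: "\<rho> > 0" using x by (meson less_le_trans zero_less_norm_iff)
      show "((\<lambda>\<rho>. - (1 / (n * \<rho> ^ n))) has_real_derivative 1 / \<rho> ^ (n + 1)) (at \<rho>)"
        using n r0 by (auto intro!: derivative_eq_intros simp: field_simps power_eq_if[of \<rho> n])
      show "0 \<le> 1 / \<rho> ^ (n + 1)" using r0 by simp
    next
      have "((\<lambda>\<rho>::real. inverse (real n * \<rho> ^ n)) \<longlongrightarrow> 0) at_top"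
        using n by (intro tendsto_inverse_0_at_top filterlim_tendsto_pos_mult_at_top[OF tendsto_const]
             filterlim_pow_at_top filterlim_ident) auto
      then show "((\<lambda>\<rho>::real. - (1 / (n * \<rho> ^ n))) \<longlongrightarrow> 0) at_top"
        using tendsto_minus by (fastforce simp: divide_inverse)
    qed simp
    also have "A x * indicator {x. norm x * M x \<le> 1} x * ennreal (norm x ^ n) * ennreal (0 - (- (1 / (n * norm x ^ n))))
        = A x * indicator {x. norm x * M x \<le> 1} x * ennreal (norm x ^ n * (1 / (n * norm x ^ n)))"
      by (subst ennreal_mult[of "norm x ^ n"]) (simp_all add: mult.assoc)
    also have "norm x ^ n * (1 / (n * norm x ^ n)) = 1 / n" using x by simp
    finally show ?thesis by (simp add: mult_ac)
  qed
  have "ennreal (1 / real n) * (\<integral>\<^sup>+x. A x * indicator {x. norm x * M x \<le> 1} x \<partial>lborel)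
    = (\<integral>\<^sup>+x. (\<integral>\<^sup>+\<rho>. A x * indicator {x. norm x * M x \<le> 1} x * ennreal (norm x ^ n) *
      (ennreal (1 / \<rho> ^ (n + 1)) * indicator {norm x..} \<rho>) * indicator {0<..} \<rho> \<partial>lborel) \<partial>lborel)"
    by (subst nn_integral_cmult[symmetric], measurable)
       (rule nn_integral_cong_AE, rule eventually_mono[OF AE0], erule I2[symmetric])
  also have "\<dots> = (\<integral>\<^sup>+\<rho>. (\<integral>\<^sup>+x. ?W x \<rho> \<partial>lborel) \<partial>lborel)"
    unfolding scale by (rule lborel_pair.Fubini') (simp add: indicator_def)
  also have "\<dots> = (\<integral>\<^sup>+x. (\<integral>\<^sup>+\<rho>. ?W x \<rho> \<partial>lborel) \<partial>lborel)"
    by (rule lborel_pair.Fubini'[symmetric]) simp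
  also have "\<dots> = ennreal (1 / real n) * (\<integral>\<^sup>+x. A x * ennreal (1 / M x ^ n) * indicator (cball 0 1) x \<partial>lborel)"
    by (subst nn_integral_cmult[symmetric], measurable)
       (rule nn_integral_cong_AE, rule eventually_mono[OF AE0], erule I1)
  finally show ?thesis
    using n by (simp add: n_def[symmetric] ennreal_mult_cancel_left)
qed

section \<open>The uniform measure on the sphere\<close>

text \<open>The uniform measure transported to the Borel sets of the whole space. Functions of
  ambient points can then be used without restricting their domain, and \<open>norm x = 1\<close> is
  recovered almost everywhere.\<close>

definition sphere_prob :: "'a::euclidean_space measure" where
  "sphere_prob = distr sphere_sigma borel (\<lambda>x. x)"

lemma sets_sphere_sigma: "sets sphere_sigma = sets (restrict_space borel (sphere 0 1))"
  by (simp add: sphere_sigma_def)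

lemma space_sphere_sigma: "space sphere_sigma = sphere 0 1"
  by (simp add: sphere_sigma_def)

lemma measurable_sphere_sigma_id: "(\<lambda>x. x) \<in> measurable sphere_sigma borel"
  by (subst measurable_cong_sets[OF sets_sphere_sigma refl]) (rule measurable_restrict_space1, simp)

lemma sets_sphere_prob [simp, measurable_cong]: "sets sphere_prob = sets borel"
  by (simp add: sphere_prob_def)

lemma space_sphere_prob [simp]: "space sphere_prob = UNIV"
  by (simp add: sphere_prob_def)

lemma integral_sphere_sigma:
  fixes f :: "'a::euclidean_space \<Rightarrow> real"
  assumes "f \<in> borel_measurable borel"
  shows "(\<integral>x. f x \<partial>sphere_sigma) = (\<integral>x. f x \<partial>sphere_prob)"
  unfolding sphere_prob_def using assms by (subst integral_distr[OF measurable_sphere_sigma_id]) auto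

lemma nn_integral_sphere_surface:
  fixes h :: "'a::euclidean_space \<Rightarrow> ennreal"
  assumes [measurable]: "h \<in> borel_measurable borel"
  shows "(\<integral>\<^sup>+x. h x \<partial>sphere_surface) =
    of_nat DIM('a) * (\<integral>\<^sup>+x. h (x /\<^sub>R norm x) * indicator (cball 0 1) x \<partial>lborel)"
proof -
  have h: "h \<in> borel_measurable (restrict_space borel (sphere 0 1))"
    by (rule measurable_restrict_space1) simp
  have c: "cball 0 1 - {0::'a} \<in> sets lborel" by simp
  have "(\<integral>\<^sup>+x. h x \<partial>sphere_surface) = of_nat DIM('a) *
     (\<integral>\<^sup>+x. h (x /\<^sub>R norm x) * indicator (cball 0 1 - {0}) x \<partial>lborel)"
    unfolding sphere_surface_def using c
    by (simp add: nn_integral_scale_measure h nn_integral_distr measurable_radial_projection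
        nn_integral_restrict_space)
  also have "(\<integral>\<^sup>+x. h (x /\<^sub>R norm x) * indicator (cball 0 1 - {0}) x \<partial>lborel)
     = (\<integral>\<^sup>+x. h (x /\<^sub>R norm x) * indicator (cball 0 1) x \<partial>lborel)"
    by (rule nn_integral_cong_AE, rule eventually_mono[OF AE_lborel_singleton[of 0]])
       (auto simp: indicator_def)
  finally show ?thesis .
qed

text \<open>The dimension factor of \<open>sphere_surface\<close> cancels in the normalization, so
  the uniform measure is the radial projection of the normalized volume of the unit ball. Symmetries
  of Lebesgue measure thereby pass to the sphere.\<close>

lemma nn_integral_sphere_prob:
  fixes h :: "'a::euclidean_space \<Rightarrow> ennreal"
  assumes [measurable]: "h \<in> borel_measurable borel"
  shows "(\<integral>\<^sup>+x. h x \<partial>sphere_prob) =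
    (\<integral>\<^sup>+x. h (x /\<^sub>R norm x) * indicator (cball 0 1) x \<partial>lborel) / ennreal (unit_ball_vol (DIM('a)))"
proof -
  have S: "sphere 0 1 \<in> sets (sphere_surface :: 'a measure)"
    by (metis sets.top space_sphere_surface)
  have meas: "h \<in> borel_measurable sphere_surface" if "h \<in> borel_measurable borel" for h :: "'a \<Rightarrow> ennreal"
    using that by (subst measurable_cong_sets[OF sets_sphere_surface refl]) (rule measurable_restrict_space1)
  have "emeasure (sphere_surface :: 'a measure) (sphere 0 1) = (\<integral>\<^sup>+x. 1 \<partial>(sphere_surface :: 'a measure))"
    by simp
  also have "\<dots> = of_nat DIM('a) * ennreal (unit_ball_vol (DIM('a)))"
    by (subst nn_integral_sphere_surface) (simp_all add: emeasure_cball)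
  finally have e: "emeasure (sphere_surface :: 'a measure) (sphere 0 1)
      = ennreal (real DIM('a) * unit_ball_vol (DIM('a)))"
    by (simp add: ennreal_mult ennreal_of_nat_eq_real_of_nat)
  have "(\<integral>\<^sup>+x. h x \<partial>sphere_prob) = (\<integral>\<^sup>+x. h x \<partial>sphere_sigma)"
    unfolding sphere_prob_def by (subst nn_integral_distr[OF measurable_sphere_sigma_id]) simp_all
  also have "\<dots> = (\<integral>\<^sup>+x. h x * indicator (sphere 0 1) x \<partial>sphere_surface) / emeasure (sphere_surface :: 'a measure) (sphere 0 1)"
    unfolding sphere_sigma_def by (rule nn_integral_uniform_measure[OF meas S]) simp
  also have "(\<integral>\<^sup>+x. h x * indicator (sphere 0 1) x \<partial>sphere_surface) = (\<integral>\<^sup>+x. h x \<partial>sphere_surface)"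
    by (intro nn_integral_cong) simp
  also have "\<dots> / emeasure (sphere_surface :: 'a measure) (sphere 0 1) =
    (\<integral>\<^sup>+x. h (x /\<^sub>R norm x) * indicator (cball 0 1) x \<partial>lborel) / ennreal (unit_ball_vol (DIM('a)))"
  proof -
    have "ennreal (real DIM('a)) * X / ennreal (real DIM('a) * V) = X / ennreal V" if "V > 0" for X V
    proof -
      have "1 / ennreal V = ennreal (real DIM('a)) / ennreal (real DIM('a) * V)"
        using that by (subst divide_ennreal) (simp_all flip: divide_ennreal add: divide_ennreal)
      then show ?thesis
        by (metis (no_types, lifting) ennreal_times_divide mult.commute mult.right_neutral)
    qed
    then show ?thesis unfolding e
      by (subst nn_integral_sphere_surface) (simp_all add: ennreal_of_nat_eq_real_of_nat)
  qed
  finally show ?thesis .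
qed

lemma emeasure_sphere_prob_UNIV [simp]: "emeasure (sphere_prob :: 'a::euclidean_space measure) UNIV = 1"
proof -
  have "emeasure (sphere_prob :: 'a measure) UNIV = (\<integral>\<^sup>+x. 1 \<partial>(sphere_prob :: 'a measure))"
    by simp
  also have "\<dots> = ennreal (unit_ball_vol (DIM('a))) / ennreal (unit_ball_vol (DIM('a)))"
    by (subst nn_integral_sphere_prob) (simp_all add: emeasure_cball)
  also have "\<dots> = 1" by (simp add: divide_ennreal less_imp_neq[OF unit_ball_vol_pos, symmetric])
  finally show ?thesis .
qed

interpretation sphere_prob: finite_measure "sphere_prob :: 'a::euclidean_space measure"
  by standard simp

lemma measure_sphere_prob_UNIV [simp]: "measure (sphere_prob :: 'a::euclidean_space measure) UNIV = 1"
  by (simp add: measure_def)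

lemma AE_sphere_prob: "AE x in sphere_prob. norm (x::'a::euclidean_space) = 1"
  unfolding sphere_prob_def
  by (subst AE_distr_iff[OF measurable_sphere_sigma_id]) (auto simp: space_sphere_sigma intro!: AE_I2)

lemma nn_integral_sphere_prob_cong:
  "(\<And>x. norm x = 1 \<Longrightarrow> f x = g x) \<Longrightarrow> (\<integral>\<^sup>+x. f x \<partial>sphere_prob) = (\<integral>\<^sup>+x. g x \<partial>sphere_prob)"
  by (rule nn_integral_cong_AE, rule eventually_mono[OF AE_sphere_prob])

lemma nn_integral_sphere_prob_reflect:
  fixes u :: "'a::euclidean_space"
  assumes [measurable]: "h \<in> borel_measurable borel" and u: "norm u = 1"
  shows "(\<integral>\<^sup>+x. h (x - (2 * (x \<bullet> u)) *\<^sub>R u) \<partial>sphere_prob) = (\<integral>\<^sup>+x. h x \<partial>sphere_prob)"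
proof -
  let ?R = "\<lambda>x::'a. x - (2 * (x \<bullet> u)) *\<^sub>R u"
  have uu: "u \<bullet> u = 1" using u by (simp add: norm_eq_1)
  have [measurable]: "cball (0::'a) 1 \<in> sets borel" by (simp add: borel_closed)
  have n: "norm (?R x) = norm x" for x
    by (simp add: norm_eq_sqrt_inner inner_simps uu inner_commute[of u x] algebra_simps)
  have "(\<integral>\<^sup>+x. h (?R (x /\<^sub>R norm x)) * indicator (cball 0 1) x \<partial>lborel)
     = (\<integral>\<^sup>+x. h (?R x /\<^sub>R norm (?R x)) * indicator (cball 0 1) (?R x) \<partial>lborel)"
  proof (rule nn_integral_cong)
    fix x
    have "?R (x /\<^sub>R norm x) = ?R x /\<^sub>R norm x" by (simp add: scaleR_diff_right mult.left_commute)
    moreover have "indicator (cball 0 1) (?R x) = (indicator (cball 0 1) x :: ennreal)"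
      unfolding indicator_def mem_cball_0 n ..
    ultimately show "h (?R (x /\<^sub>R norm x)) * indicator (cball 0 1) x
        = h (?R x /\<^sub>R norm (?R x)) * indicator (cball 0 1) (?R x)"
      by (simp only: n)
  qed
  also have "\<dots> = (\<integral>\<^sup>+x. h (x /\<^sub>R norm x) * indicator (cball 0 1) x \<partial>lborel)"
    by (rule nn_integral_lborel_reflect[OF _ u, of "\<lambda>x. h (x /\<^sub>R norm x) * indicator (cball 0 1) x"]) simp
  finally show ?thesis
    by (subst (1 2) nn_integral_sphere_prob) simp_all
qed

text \<open>The reflection in the bisector of \<open>a\<close> and \<open>b\<close> swaps them.\<close>

lemma nn_integral_sphere_prob_zonal:
  fixes a b :: "'a::euclidean_space"
  assumes [measurable]: "h \<in> borel_measurable borel" and ab: "norm a = 1" "norm b = 1"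
  shows "(\<integral>\<^sup>+x. h (norm (x - a)) \<partial>sphere_prob) = (\<integral>\<^sup>+x. h (norm (x - b)) \<partial>sphere_prob)"
proof (cases "a = b")
  case False
  define u where "u = (a - b) /\<^sub>R norm (a - b)"
  have u: "norm u = 1" using False by (simp add: u_def)
  let ?R = "\<lambda>x::'a. x - (2 * (x \<bullet> u)) *\<^sub>R u"
  have uu: "u \<bullet> u = 1" using u by (simp add: norm_eq_1)
  have n: "norm (?R x) = norm x" for x
    by (simp add: norm_eq_sqrt_inner inner_simps uu inner_commute[of u x] algebra_simps)
  have lin: "?R x - ?R y = ?R (x - y)" for x y by (simp add: inner_simps algebra_simps)
  have "(a - b) \<bullet> (a - b) = 2 * (a \<bullet> (a - b))"
    using ab by (simp add: inner_simps norm_eq_1 inner_commute)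
  moreover have "a \<bullet> u = (a \<bullet> (a - b)) / norm (a - b)" by (simp add: u_def divide_inverse)
  ultimately have "2 * (a \<bullet> u) = (norm (a - b))\<^sup>2 / norm (a - b)" by (simp add: power2_norm_eq_inner)
  then have "2 * (a \<bullet> u) = norm (a - b)" by (simp add: power2_eq_square)
  then have "?R a = b" using False by (simp add: u_def)
  then have "norm (x - a) = norm (?R x - b)" for x by (metis n lin)
  then have "(\<integral>\<^sup>+x. h (norm (x - a)) \<partial>sphere_prob) = (\<integral>\<^sup>+x. h (norm (?R x - b)) \<partial>sphere_prob)"
    by simp
  also have "\<dots> = (\<integral>\<^sup>+x. h (norm (x - b)) \<partial>sphere_prob)"
    by (rule nn_integral_sphere_prob_reflect[OF _ u, of "\<lambda>x. h (norm (x - b))"]) simp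
  finally show ?thesis .
qed simp

text \<open>The induced map of the sphere has Jacobian \<open>boost_factor\<close> to the power
  \<open>- d\<close>. The exponent arises as \<open>1 - (d + 1)\<close>: the norm in the invariant
  measure contributes one factor \<open>M\<close>, and the region
  \<open>norm x * M x \<le> 1\<close>, rescaled to the unit ball, contributes \<open>M\<close> to
  the power \<open>- (d + 1)\<close>.\<close>

lemma nn_integral_sphere_prob_boost:
  fixes p :: "'a::euclidean_space"
  assumes [measurable]: "h \<in> borel_measurable borel" and dim: "DIM('a) = d + 1" "d \<ge> 1"
    and \<beta>: "0 \<le> \<beta>" "\<beta> < 1" and p: "norm p = 1"
  shows "(\<integral>\<^sup>+x. h (boost \<beta> p x /\<^sub>R boost_factor \<beta> p x) * ennreal (1 / boost_factor \<beta> p x ^ d) \<partial>sphere_prob)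
    = (\<integral>\<^sup>+x. h x \<partial>sphere_prob)"
proof -
  note [measurable] = boost_measurable[OF \<beta> p] boost_factor_measurable[OF \<beta> p]
  have [measurable]: "cball (0::'a) 1 \<in> sets borel" by (simp add: borel_closed)
  let ?n = "DIM('a)"
  define H where "H = (\<lambda>x::'a. h (x /\<^sub>R norm x))"
  define M where "M = (\<lambda>x::'a. boost_factor \<beta> p (x /\<^sub>R norm x))"
  have [measurable]: "H \<in> borel_measurable borel" "M \<in> borel_measurable borel"
    unfolding H_def M_def by measurable
  have Mx: "M x = boost_factor \<beta> p x / norm x" for x
    by (simp add: M_def boost_factor_scaleR[OF \<beta> p] divide_inverse mult.commute)
  have Mpos: "M x > 0" if "x \<noteq> 0" for x
    using boost_factor_pos[OF \<beta> p that] that by (simp add: Mx)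
  have nb: "norm (boost \<beta> p x) = norm x * M x" if "x \<noteq> 0" for x
    using that by (simp add: Mx norm_boost[OF \<beta> p])
  have Hs: "H (r *\<^sub>R x) = H x" if "r > 0" for r x
    using that by (simp add: H_def mult.commute[of _ r] mult.assoc[symmetric])
  have "(\<integral>\<^sup>+x. H x * indicator (cball 0 1) x \<partial>lborel) =
     (\<integral>\<^sup>+x. H x * ennreal (norm x) * indicator (cball 0 1) x * ennreal (1 / norm x) \<partial>lborel)"
  proof (rule nn_integral_cong_AE, rule eventually_mono[OF AE_lborel_singleton[of 0]])
    fix x :: 'a assume "x \<noteq> 0"
    then have "ennreal (norm x) * ennreal (1 / norm x) = 1" by (simp flip: ennreal_mult)
    then show "H x * indicator (cball 0 1) x = H x * ennreal (norm x) * indicator (cball 0 1) x * ennreal (1 / norm x)"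
      by (metis (no_types, lifting) mult.assoc mult.commute mult.right_neutral)
  qed
  also have "\<dots> = (\<integral>\<^sup>+x. H (boost \<beta> p x) * ennreal (norm (boost \<beta> p x)) * indicator (cball 0 1) (boost \<beta> p x)
      * ennreal (1 / norm x) \<partial>lborel)"
    using dim by (intro nn_integral_boost[OF \<beta> p, symmetric]) auto
  also have "\<dots> = (\<integral>\<^sup>+x. (H (boost \<beta> p x) * ennreal (M x)) * indicator {x. norm x * M x \<le> 1} x \<partial>lborel)"
  proof (rule nn_integral_cong_AE, rule eventually_mono[OF AE_lborel_singleton[of 0]])
    fix x :: 'a assume x: "x \<noteq> 0"
    have "ennreal (norm x * M x) * ennreal (1 / norm x) = ennreal (M x)"
      using x Mpos[OF x] by (simp flip: ennreal_mult)
    then show "H (boost \<beta> p x) * ennreal (norm (boost \<beta> p x)) * indicator (cball 0 1) (boost \<beta> p x)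
      * ennreal (1 / norm x) = (H (boost \<beta> p x) * ennreal (M x)) * indicator {x. norm x * M x \<le> 1} x"
      using x by (auto simp: nb indicator_def mult.assoc)
  qed
  also have "\<dots> = (\<integral>\<^sup>+x. (H (boost \<beta> p x) * ennreal (M x)) * ennreal (1 / M x ^ ?n) * indicator (cball 0 1) x \<partial>lborel)"
    using Mpos by (intro nn_integral_radial_rescale) (auto simp: boost_scaleR[OF \<beta> p] Hs Mx boost_factor_scaleR[OF \<beta> p])
  also have "\<dots> = (\<integral>\<^sup>+x. h (boost \<beta> p (x /\<^sub>R norm x) /\<^sub>R boost_factor \<beta> p (x /\<^sub>R norm x))
      * ennreal (1 / boost_factor \<beta> p (x /\<^sub>R norm x) ^ d) * indicator (cball 0 1) x \<partial>lborel)"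
  proof (rule nn_integral_cong_AE, rule eventually_mono[OF AE_lborel_singleton[of 0]])
    fix x :: 'a assume x: "x \<noteq> 0"
    have "ennreal (M x) * ennreal (1 / M x ^ ?n) = ennreal (1 / M x ^ d)"
      using Mpos[OF x] by (simp add: dim flip: ennreal_mult)
    moreover have eq: "norm x * inverse (boost_factor \<beta> p x) * inverse (norm x) = inverse (boost_factor \<beta> p x)"
      using x by (simp add: field_simps)
    have "h (boost \<beta> p (x /\<^sub>R norm x) /\<^sub>R boost_factor \<beta> p (x /\<^sub>R norm x)) = H (boost \<beta> p x)"
      using x by (simp add: H_def boost_scaleR[OF \<beta> p] boost_factor_scaleR[OF \<beta> p] norm_boost[OF \<beta> p] eq)
    ultimately show "(H (boost \<beta> p x) * ennreal (M x)) * ennreal (1 / M x ^ ?n) * indicator (cball 0 1) x =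
       h (boost \<beta> p (x /\<^sub>R norm x) /\<^sub>R boost_factor \<beta> p (x /\<^sub>R norm x))
      * ennreal (1 / boost_factor \<beta> p (x /\<^sub>R norm x) ^ d) * indicator (cball 0 1) x"
      by (simp add: mult.assoc M_def)
  qed
  finally show ?thesis
    by (subst (1 2) nn_integral_sphere_prob) (simp_all add: H_def)
qed

section \<open>Conformal maps and spherical caps\<close>

text \<open>Since \<open>(norm (x - p))\<^sup>2 = 2 - 2 * (x \<bullet> p)\<close> on the sphere, the
  velocity \<open>2 / (\<tau> + 2)\<close> is the one for which the boost factor is proportional to
  \<open>\<tau> + (norm (x - p))\<^sup>2\<close>. Small \<open>\<tau>\<close> corresponds to strong
  concentration of the Jacobian at \<open>p\<close>, at scale \<open>sqrt \<tau>\<close>.\<close>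

lemma boost_factor_sphere:
  fixes p x :: "'a::euclidean_space"
  assumes \<tau>: "\<tau> > 0" and p: "norm p = 1" and x: "norm x = 1"
  shows "boost_factor (2 / (\<tau> + 2)) (- p) x = (\<tau> + (norm (x - p))\<^sup>2) / sqrt (\<tau> * (\<tau> + 4))"
proof -
  have "1 - (2 / (\<tau> + 2))\<^sup>2 = ((\<tau> + 2)\<^sup>2 - 4) / (\<tau> + 2)\<^sup>2"
    using \<tau> by (simp add: power_divide diff_divide_distrib)
  also have "(\<tau> + 2)\<^sup>2 - 4 = \<tau> * (\<tau> + 4)" by (simp add: power2_eq_square algebra_simps)
  finally have "1 - (2 / (\<tau> + 2))\<^sup>2 = \<tau> * (\<tau> + 4) / (\<tau> + 2)\<^sup>2" .
  then have 1: "sqrt (1 - (2 / (\<tau> + 2))\<^sup>2) = sqrt (\<tau> * (\<tau> + 4)) / (\<tau> + 2)"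
    using \<tau> by (simp add: real_sqrt_divide)
  have "(norm (x - p))\<^sup>2 = 2 - 2 * (x \<bullet> p)"
    using p x by (simp add: power2_norm_eq_inner inner_simps norm_eq_1 inner_commute)
  then have 2: "norm x + 2 / (\<tau> + 2) * (x \<bullet> - p) = (\<tau> + (norm (x - p))\<^sup>2) / (\<tau> + 2)"
    using \<tau> x by (simp add: field_simps)
  show ?thesis
    unfolding boost_factor_def 1 2 using \<tau> by simp
qed

text \<open>The map \<open>T\<close> is the conformal automorphism of the sphere induced by a boost;
  \<open>sqrt (\<tau> * (\<tau> + 4)) / (\<tau> + (norm (x - p))\<^sup>2)\<close> is its conformal factor.\<close>

lemma sphere_conformal_map:
  fixes p :: "'a::euclidean_space"
  assumes dim: "DIM('a) = d + 1" "d \<ge> 1" and \<tau>: "\<tau> > 0" and p: "norm p = 1"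
  obtains T :: "'a \<Rightarrow> 'a" where "T \<in> borel_measurable borel"
    and "\<And>x. norm x = 1 \<Longrightarrow> norm (T x) = 1"
    and "\<And>x y. norm x = 1 \<Longrightarrow> norm y = 1 \<Longrightarrow> (norm (T x - T y))\<^sup>2 = (norm (x - y))\<^sup>2 * (\<tau> * (\<tau> + 4)) /
        ((\<tau> + (norm (x - p))\<^sup>2) * (\<tau> + (norm (y - p))\<^sup>2))"
    and "distr (density sphere_prob (\<lambda>x. ennreal ((sqrt (\<tau> * (\<tau> + 4)) / (\<tau> + (norm (x - p))\<^sup>2)) ^ d))) borel T
        = sphere_prob"
proof -
  define \<beta> where "\<beta> = 2 / (\<tau> + 2)"
  have \<beta>: "0 \<le> \<beta>" "\<beta> < 1" using \<tau> by (simp_all add: \<beta>_def)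
  have mp: "norm (- p) = 1" using p by simp
  let ?m = "boost_factor \<beta> (- p)"
  define T where "T = (\<lambda>x. boost \<beta> (- p) x /\<^sub>R ?m x)"
  note [measurable] = boost_measurable[OF \<beta> mp] boost_factor_measurable[OF \<beta> mp]
  have mpos: "?m x > 0" if "norm x = 1" for x
    using boost_factor_pos[OF \<beta> mp, of x] that by fastforce
  have T1: "norm (T x) = 1" if "norm x = 1" for x
    using mpos[OF that] by (simp add: T_def norm_boost[OF \<beta> mp])
  have m: "?m x = (\<tau> + (norm (x - p))\<^sup>2) / sqrt (\<tau> * (\<tau> + 4))" if "norm x = 1" for x
    unfolding \<beta>_def by (rule boost_factor_sphere[OF \<tau> p that])
  show thesis
  proof
    show [measurable]: "T \<in> borel_measurable borel" unfolding T_def by measurable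
    show "\<And>x. norm x = 1 \<Longrightarrow> norm (T x) = 1" by (fact T1)
    fix x y :: 'a assume x: "norm x = 1" and y: "norm y = 1"
    have "(norm (T x - T y))\<^sup>2 = 2 - 2 * (T x \<bullet> T y)"
      using T1[OF x] T1[OF y] by (simp add: power2_norm_eq_inner inner_simps norm_eq_1 inner_commute)
    also have "T x \<bullet> T y = (boost \<beta> (- p) x \<bullet> boost \<beta> (- p) y) / (?m x * ?m y)"
      by (simp add: T_def divide_inverse)
    also have "2 - 2 * \<dots> = 2 * (?m x * ?m y - boost \<beta> (- p) x \<bullet> boost \<beta> (- p) y) / (?m x * ?m y)"
      using mpos[OF x] mpos[OF y] by (simp add: field_simps)
    \<comment> \<open>For unit vectors the Lorentz product
      \<open>norm x * norm y - x \<bullet> y\<close> is half the squared distance, so its invariance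
      becomes conformality.\<close>
    also have "\<dots> = (norm (x - y))\<^sup>2 / (?m x * ?m y)"
      unfolding boost_lorentz[OF \<beta> mp] x y
      by (simp add: power2_norm_eq_inner inner_simps x[unfolded norm_eq_1] y[unfolded norm_eq_1] inner_commute)
    also have "\<dots> = (norm (x - y))\<^sup>2 * (sqrt (\<tau> * (\<tau> + 4)) * sqrt (\<tau> * (\<tau> + 4))) /
        ((\<tau> + (norm (x - p))\<^sup>2) * (\<tau> + (norm (y - p))\<^sup>2))"
      unfolding m[OF x] m[OF y] using \<tau> by simp
    finally show "(norm (T x - T y))\<^sup>2 = (norm (x - y))\<^sup>2 * (\<tau> * (\<tau> + 4)) /
        ((\<tau> + (norm (x - p))\<^sup>2) * (\<tau> + (norm (y - p))\<^sup>2))" using \<tau> by simp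
  next
    have [measurable]: "T \<in> borel_measurable borel" unfolding T_def by measurable
    show "distr (density sphere_prob (\<lambda>x. ennreal ((sqrt (\<tau> * (\<tau> + 4)) / (\<tau> + (norm (x - p))\<^sup>2)) ^ d))) borel T
        = sphere_prob" (is "?L = _")
    proof (rule measure_eqI)
      fix A assume "A \<in> sets ?L"
      then have [measurable]: "A \<in> sets borel" by simp
      have "emeasure ?L A = (\<integral>\<^sup>+x. indicator A x \<partial>?L)" by simp
      also have "\<dots> = (\<integral>\<^sup>+x. ennreal ((sqrt (\<tau> * (\<tau> + 4)) / (\<tau> + (norm (x - p))\<^sup>2)) ^ d) * indicator A (T x) \<partial>sphere_prob)"
        by (subst nn_integral_distr; (subst nn_integral_density)?) measurable
      also have "\<dots> = (\<integral>\<^sup>+x. indicator A (boost \<beta> (- p) x /\<^sub>R ?m x) * ennreal (1 / ?m x ^ d) \<partial>sphere_prob)"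
        by (rule nn_integral_sphere_prob_cong) (simp add: m T_def mult.commute power_divide)
      also have "\<dots> = (\<integral>\<^sup>+x. indicator A x \<partial>sphere_prob)"
        by (rule nn_integral_sphere_prob_boost[OF _ dim \<beta> mp]) simp
      finally show "emeasure ?L A = emeasure sphere_prob A" by simp
    qed simp
  qed
qed

text \<open>The Jacobian of the conformal map is the density of a probability measure; this is its
  normalization.\<close>

lemma nn_integral_sphere_prob_inverse_power:
  fixes p :: "'a::euclidean_space"
  assumes dim: "DIM('a) = d + 1" "d \<ge> 1" and \<tau>: "\<tau> > 0" and p: "norm p = 1"
  shows "(\<integral>\<^sup>+x. ennreal (1 / (\<tau> + (norm (x - p))\<^sup>2) ^ d) \<partial>sphere_prob) = ennreal (1 / sqrt (\<tau> * (\<tau> + 4)) ^ d)"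
proof -
  let ?D = "sqrt (\<tau> * (\<tau> + 4))"
  have D: "?D > 0" using \<tau> by simp
  obtain T :: "'a \<Rightarrow> 'a" where T[measurable]: "T \<in> borel_measurable borel"
    and eq: "distr (density sphere_prob (\<lambda>x. ennreal ((?D / (\<tau> + (norm (x - p))\<^sup>2)) ^ d))) borel T = sphere_prob"
    using sphere_conformal_map[OF dim \<tau> p] by metis
  have "1 = emeasure (distr (density sphere_prob (\<lambda>x. ennreal ((?D / (\<tau> + (norm (x - p))\<^sup>2)) ^ d))) borel T) UNIV"
    unfolding eq by simp
  also have "\<dots> = (\<integral>\<^sup>+x. ennreal ((?D / (\<tau> + (norm (x - p))\<^sup>2)) ^ d) \<partial>sphere_prob)"
    by (subst emeasure_distr) (simp_all add: emeasure_density)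
  finally have 1: "(\<integral>\<^sup>+x. ennreal ((?D / (\<tau> + (norm (x - p))\<^sup>2)) ^ d) \<partial>sphere_prob) = 1" ..
  have "(\<integral>\<^sup>+x. ennreal (1 / (\<tau> + (norm (x - p))\<^sup>2) ^ d) \<partial>sphere_prob)
    = (\<integral>\<^sup>+x. ennreal (1 / ?D ^ d) * ennreal ((?D / (\<tau> + (norm (x - p))\<^sup>2)) ^ d) \<partial>sphere_prob)"
    using D \<tau> by (intro nn_integral_cong) (simp add: power_divide add_nonneg_nonneg flip: ennreal_mult)
  also have "\<dots> = ennreal (1 / ?D ^ d)" by (subst nn_integral_cmult) (simp_all add: 1)
  finally show ?thesis .
qed

corollary nn_integral_sphere_prob_inverse_power_le:
  fixes p :: "'a::euclidean_space"
  assumes dim: "DIM('a) = d + 1" "d \<ge> 1" and \<delta>: "\<delta> > 0" and p: "norm p = 1"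
  shows "(\<integral>\<^sup>+x. ennreal (1 / (\<delta>\<^sup>2 + (norm (x - p))\<^sup>2) ^ d) \<partial>sphere_prob) \<le> ennreal (1 / (2 * \<delta>) ^ d)"
proof -
  have "2 * \<delta> = sqrt (\<delta>\<^sup>2 * 4)" using \<delta> by (simp add: real_sqrt_mult)
  also have "\<dots> \<le> sqrt (\<delta>\<^sup>2 * (\<delta>\<^sup>2 + 4))" by (simp add: mult_left_mono)
  finally have "2 * \<delta> \<le> sqrt (\<delta>\<^sup>2 * (\<delta>\<^sup>2 + 4))" .
  moreover have "0 < sqrt (\<delta>\<^sup>2 * (\<delta>\<^sup>2 + 4))"
    using \<delta> by (intro real_sqrt_gt_zero mult_pos_pos add_pos_pos) auto
  ultimately have "1 / sqrt (\<delta>\<^sup>2 * (\<delta>\<^sup>2 + 4)) ^ d \<le> 1 / (2 * \<delta>) ^ d"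
    using \<delta> by (intro divide_left_mono power_mono mult_pos_pos zero_less_power) auto
  then show ?thesis
    using \<delta> by (subst nn_integral_sphere_prob_inverse_power[OF dim _ p]) (auto intro: ennreal_leI)
qed

text \<open>Markov's inequality for the inverse power with \<open>\<tau> = r\<^sup>2\<close>: on the
  cap the integrand is at least \<open>1 / (2 * r\<^sup>2) ^ d\<close>, while its integral is at
  most \<open>1 / (2 * r) ^ d\<close>.\<close>

lemma measure_sphere_prob_cap_le:
  fixes p :: "'a::euclidean_space"
  assumes dim: "DIM('a) = d + 1" "d \<ge> 1" and r: "r > 0" and p: "norm p = 1"
  shows "measure sphere_prob {x. norm (x - p) \<le> r} \<le> r ^ d"
proof -
  let ?C = "{x. norm (x - p) \<le> r}"
  have "ennreal (1 / (2 * r\<^sup>2) ^ d) * emeasure sphere_prob ?C =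
      (\<integral>\<^sup>+x. ennreal (1 / (2 * r\<^sup>2) ^ d) * indicator ?C x \<partial>sphere_prob)"
    by (subst nn_integral_cmult_indicator) simp_all
  also have "\<dots> \<le> (\<integral>\<^sup>+x. ennreal (1 / (r\<^sup>2 + (norm (x - p))\<^sup>2) ^ d) \<partial>sphere_prob)"
  proof (rule nn_integral_mono)
    fix x
    show "ennreal (1 / (2 * r\<^sup>2) ^ d) * indicator ?C x \<le> ennreal (1 / (r\<^sup>2 + (norm (x - p))\<^sup>2) ^ d)"
    proof (cases "norm (x - p) \<le> r")
      case True
      then have "r\<^sup>2 + (norm (x - p))\<^sup>2 \<le> 2 * r\<^sup>2" by (simp add: power_mono)
      then have "1 / (2 * r\<^sup>2) ^ d \<le> 1 / (r\<^sup>2 + (norm (x - p))\<^sup>2) ^ d"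
        using r by (intro divide_left_mono power_mono mult_pos_pos zero_less_power) (auto simp: add_pos_nonneg)
      then show ?thesis by (auto simp: indicator_def intro: ennreal_leI)
    qed simp
  qed
  also have "\<dots> \<le> ennreal (1 / (2 * r) ^ d)"
    by (rule nn_integral_sphere_prob_inverse_power_le[OF dim r p])
  finally have "1 / (2 * r\<^sup>2) ^ d * measure sphere_prob ?C \<le> 1 / (2 * r) ^ d"
    using r by (simp add: sphere_prob.emeasure_eq_measure flip: ennreal_mult)
  then have "measure sphere_prob ?C \<le> (2 * r\<^sup>2) ^ d / (2 * r) ^ d"
    using r by (simp add: field_simps)
  also have "\<dots> = r ^ d" using r by (simp add: power_divide[symmetric] power2_eq_square)
  finally show ?thesis .
qed

lemma measure_sphere_prob_singleton:
  fixes p :: "'a::euclidean_space"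
  assumes dim: "DIM('a) = d + 1" "d \<ge> 1" and p: "norm p = 1"
  shows "measure sphere_prob {p} = 0"
proof -
  have "measure sphere_prob {p} \<le> e" if e: "e > 0" for e
  proof -
    define r where "r = min 1 e"
    have r: "r > 0" "r \<le> 1" "r \<le> e" using e by (auto simp: r_def)
    have "measure sphere_prob {p} \<le> measure sphere_prob {x. norm (x - p) \<le> r}"
      using r by (intro sphere_prob.finite_measure_mono) auto
    also have "\<dots> \<le> r ^ d" by (rule measure_sphere_prob_cap_le[OF dim r(1) p])
    also have "\<dots> \<le> r ^ 1" using r dim by (intro power_decreasing) auto
    finally show ?thesis using r by simp
  qed
  then have "measure sphere_prob {p} \<le> 0" by (rule field_le_epsilon) simp
  then show ?thesis by (simp add: measure_le_0_iff)
qed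

text \<open>The inverse power at scale \<open>\<delta>\<close> has integral at least
  \<open>1 / (sqrt 5 * \<delta>) ^ d\<close>, where 5 bounds \<open>\<delta>\<^sup>2 + 4\<close>.
  Outside the cap it is at most \<open>2 ^ d\<close> times the inverse power at scale
  \<open>R\<close>. The choice \<open>R = 2 * sqrt 5 * \<delta>\<close> makes that part at most half
  of the total, so the cap carries the other half, where the integrand is at most
  \<open>1 / \<delta> ^ (2 * d)\<close>.\<close>

lemma measure_sphere_prob_cap_ge:
  fixes p :: "'a::euclidean_space"
  assumes dim: "DIM('a) = d + 1" "d \<ge> 1" and \<delta>: "0 < \<delta>" "\<delta> \<le> 1" and p: "norm p = 1"
  shows "(\<delta> / sqrt 5) ^ d / 2 \<le> measure sphere_prob {x. norm (x - p) \<le> sqrt 20 * \<delta>}"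
proof -
  define R where "R = sqrt 20 * \<delta>"
  have R: "R > 0" "R\<^sup>2 = 20 * \<delta>\<^sup>2" using \<delta> by (simp_all add: R_def power_mult_distrib)
  have half: "(a + b) / 2 \<le> c + b" if "a \<le> b" "0 \<le> c" for a b c :: real
  proof -
    have "(a + b) / 2 \<le> b" using that(1) by simp
    with that(2) show ?thesis by simp
  qed
  let ?C = "{x. norm (x - p) \<le> R}"
  let ?f = "\<lambda>\<delta> x. ennreal (1 / (\<delta>\<^sup>2 + (norm (x - p))\<^sup>2) ^ d)"
  have D: "sqrt (\<delta>\<^sup>2 * (\<delta>\<^sup>2 + 4)) \<le> sqrt 5 * \<delta>"
  proof (rule real_le_lsqrt)
    have "\<delta>\<^sup>2 \<le> 1" using \<delta> by (simp add: power_le_one)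
    then show "\<delta>\<^sup>2 * (\<delta>\<^sup>2 + 4) \<le> (sqrt 5 * \<delta>)\<^sup>2"
      by (simp add: power_mult_distrib mult.commute[of 5] mult_left_mono)
  qed (use \<delta> in auto)
  have "0 < sqrt (\<delta>\<^sup>2 * (\<delta>\<^sup>2 + 4))"
    using \<delta> by (intro real_sqrt_gt_zero mult_pos_pos add_pos_pos) auto
  then have "ennreal (1 / (sqrt 5 * \<delta>) ^ d) \<le> ennreal (1 / sqrt (\<delta>\<^sup>2 * (\<delta>\<^sup>2 + 4)) ^ d)"
    using D \<delta> by (intro ennreal_leI divide_left_mono power_mono mult_pos_pos zero_less_power) auto
  also have "\<dots> = (\<integral>\<^sup>+x. ?f \<delta> x \<partial>sphere_prob)"
    using \<delta> by (intro nn_integral_sphere_prob_inverse_power[OF dim _ p, symmetric]) simp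
  also have "\<dots> \<le> (\<integral>\<^sup>+x. ennreal (1 / \<delta> ^ (2 * d)) * indicator ?C x + ennreal (2 ^ d) * ?f R x \<partial>sphere_prob)"
  proof (rule nn_integral_mono)
    fix x
    show "?f \<delta> x \<le> ennreal (1 / \<delta> ^ (2 * d)) * indicator ?C x + ennreal (2 ^ d) * ?f R x"
    proof (cases "norm (x - p) \<le> R")
      case True
      have "1 / (\<delta>\<^sup>2 + (norm (x - p))\<^sup>2) ^ d \<le> 1 / (\<delta>\<^sup>2) ^ d"
        using \<delta> by (intro divide_left_mono power_mono mult_pos_pos zero_less_power) (auto simp: add_pos_nonneg)
      then show ?thesis using True by (auto simp: power_mult intro!: add_increasing2 ennreal_leI)
    next
      case False
      then have "R\<^sup>2 \<le> (norm (x - p))\<^sup>2" using R by (intro power_mono) auto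
      then have "(R\<^sup>2 + (norm (x - p))\<^sup>2) / 2 \<le> \<delta>\<^sup>2 + (norm (x - p))\<^sup>2"
        by (intro half) auto
      then have "1 / (\<delta>\<^sup>2 + (norm (x - p))\<^sup>2) ^ d \<le> 1 / ((R\<^sup>2 + (norm (x - p))\<^sup>2) / 2) ^ d"
        using \<delta> R by (intro divide_left_mono power_mono mult_pos_pos zero_less_power) (auto simp: add_pos_nonneg)
      also have "\<dots> = 2 ^ d * (1 / (R\<^sup>2 + (norm (x - p))\<^sup>2) ^ d)" by (simp add: power_divide)
      finally show ?thesis using False by (simp add: ennreal_leI flip: ennreal_mult)
    qed
  qed
  also have "\<dots> = ennreal (1 / \<delta> ^ (2 * d)) * emeasure sphere_prob ?C + ennreal (2 ^ d) * (\<integral>\<^sup>+x. ?f R x \<partial>sphere_prob)"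
    by (subst nn_integral_add) (simp_all add: nn_integral_cmult nn_integral_cmult_indicator)
  also have "\<dots> \<le> ennreal (1 / \<delta> ^ (2 * d)) * emeasure sphere_prob ?C + ennreal (2 ^ d) * ennreal (1 / (2 * R) ^ d)"
    by (intro add_left_mono mult_left_mono nn_integral_sphere_prob_inverse_power_le[OF dim R(1) p]) auto
  finally have "1 / (sqrt 5 * \<delta>) ^ d \<le> 1 / \<delta> ^ (2 * d) * measure sphere_prob ?C + 2 ^ d * (1 / (2 * R) ^ d)"
    using \<delta> R by (simp add: sphere_prob.emeasure_eq_measure del: ennreal_plus flip: ennreal_mult ennreal_plus)
  also have "2 ^ d * (1 / (2 * R) ^ d) = 1 / (sqrt 20 * \<delta>) ^ d"
    by (simp add: R_def power_mult_distrib)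
  also have "\<dots> \<le> (1 / (sqrt 5 * \<delta>) ^ d) / 2"
  proof -
    have "sqrt 20 = 2 * sqrt 5" using real_sqrt_mult[of 4 5] by simp
    moreover have "(2::real) \<le> 2 ^ d" using dim by (simp add: self_le_power)
    ultimately show ?thesis using \<delta> by (simp add: power_mult_distrib frac_le)
  qed
  finally have "(1 / (sqrt 5 * \<delta>) ^ d) / 2 \<le> 1 / \<delta> ^ (2 * d) * measure sphere_prob ?C" by simp
  then have "\<delta> ^ (2 * d) * ((1 / (sqrt 5 * \<delta>) ^ d) / 2) \<le> measure sphere_prob ?C"
    using \<delta> by (simp add: field_simps)
  also have "\<delta> ^ (2 * d) * ((1 / (sqrt 5 * \<delta>) ^ d) / 2) = (\<delta> / sqrt 5) ^ d / 2"
    using \<delta> by (simp add: mult_2[of d] power_add power_mult_distrib power_divide)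
  finally show ?thesis by (simp add: R_def)
qed

text \<open>With \<open>t = 1 + w * (norm (x - p))\<^sup>2\<close> the Gaussian equals
  \<open>exp 1 / exp t\<close>, and \<open>exp t \<ge> t ^ d / fact d\<close> bounds it by an
  inverse power at scale \<open>\<delta> = 1 / sqrt w\<close>.\<close>

lemma nn_integral_sphere_prob_gauss_le:
  fixes p :: "'a::euclidean_space"
  assumes dim: "DIM('a) = d + 1" "d \<ge> 1" and w: "w > 0" and p: "norm p = 1"
  shows "(\<integral>\<^sup>+x. ennreal (exp (- w * (norm (x - p))\<^sup>2)) \<partial>sphere_prob) \<le> ennreal (fact d * exp 1 * w powr (- real d / 2))"
proof -
  define \<delta> where "\<delta> = 1 / sqrt w"
  have \<delta>: "\<delta> > 0" "w = 1 / \<delta>\<^sup>2" using w by (simp_all add: \<delta>_def power_divide)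
  let ?c = "fact d * exp 1 * \<delta> ^ (2 * d)"
  have "(\<integral>\<^sup>+x. ennreal (exp (- w * (norm (x - p))\<^sup>2)) \<partial>sphere_prob) \<le>
    (\<integral>\<^sup>+x. ennreal ?c * ennreal (1 / (\<delta>\<^sup>2 + (norm (x - p))\<^sup>2) ^ d) \<partial>sphere_prob)"
  proof (rule nn_integral_mono)
    fix x
    define t where "t = 1 + w * (norm (x - p))\<^sup>2"
    have t: "t > 0" using w by (simp add: t_def add_pos_nonneg)
    have "t ^ d / fact d \<le> exp t"
    proof -
      have "sum (\<lambda>n. t ^ n /\<^sub>R fact n) {d} \<le> (\<Sum>n. t ^ n /\<^sub>R fact n)"
        using t by (intro sum_le_suminf summable_exp_generic) auto
      then show ?thesis by (simp add: exp_def divide_inverse mult.commute)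
    qed
    have "exp (- w * (norm (x - p))\<^sup>2) = exp 1 / exp t" by (simp add: t_def exp_add exp_minus field_simps)
    also have "\<dots> \<le> exp 1 / (t ^ d / fact d)"
      using t \<open>t ^ d / fact d \<le> exp t\<close> by (intro divide_left_mono) auto
    also have "t = (\<delta>\<^sup>2 + (norm (x - p))\<^sup>2) / \<delta>\<^sup>2" using \<delta> by (simp add: t_def field_simps)
    also have "exp 1 / (((\<delta>\<^sup>2 + (norm (x - p))\<^sup>2) / \<delta>\<^sup>2) ^ d / fact d) = ?c * (1 / (\<delta>\<^sup>2 + (norm (x - p))\<^sup>2) ^ d)"
      by (simp add: power_divide power_mult)
    finally show "ennreal (exp (- w * (norm (x - p))\<^sup>2)) \<le> ennreal ?c * ennreal (1 / (\<delta>\<^sup>2 + (norm (x - p))\<^sup>2) ^ d)"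
      using \<delta> by (subst ennreal_mult[symmetric]) (auto intro: ennreal_leI)
  qed
  also have "\<dots> = ennreal ?c * (\<integral>\<^sup>+x. ennreal (1 / (\<delta>\<^sup>2 + (norm (x - p))\<^sup>2) ^ d) \<partial>sphere_prob)"
    by (rule nn_integral_cmult) simp
  also have "\<dots> \<le> ennreal ?c * ennreal (1 / (2 * \<delta>) ^ d)"
    by (intro mult_left_mono nn_integral_sphere_prob_inverse_power_le[OF dim \<delta>(1) p]) simp
  also have "\<dots> = ennreal (?c * (1 / (2 * \<delta>) ^ d))"
    using \<delta>(1) by (intro ennreal_mult[symmetric]) auto
  also have "?c * (1 / (2 * \<delta>) ^ d) = fact d * exp 1 * \<delta> ^ d / 2 ^ d"
    using \<delta>(1) by (simp add: mult_2[of d] power_add power_mult_distrib)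
  also have "\<dots> \<le> ennreal (fact d * exp 1 * \<delta> ^ d)"
    using \<delta>(1) mult_left_mono[of 1 "2 ^ d" "fact d * exp 1 * \<delta> ^ d"]
    by (intro ennreal_leI) (simp add: divide_le_eq)
  also have "\<delta> ^ d = w powr (- real d / 2)"
  proof -
    have "\<delta> = w powr (- 1 / 2)" using w by (simp add: \<delta>_def powr_half_sqrt powr_minus_divide)
    then show ?thesis using w by (simp add: powr_power)
  qed
  finally show ?thesis .
qed

section \<open>Gaussian energies\<close>

lemma nn_integral_exp_minus_abs_finite:
  fixes c :: real
  assumes c: "c > 0"
  shows "(\<integral>\<^sup>+t. ennreal (exp (- c * \<bar>t\<bar>)) \<partial>lborel) < \<infinity>"
proof -
  let ?f = "\<lambda>t. ennreal (exp (- c * t)) * indicator {0..} t"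
  have f: "(\<integral>\<^sup>+t. ?f t \<partial>lborel) = ennreal (0 - (- exp (- c * 0) / c))"
  proof (intro nn_integral_FTC_atLeast)
    show "((\<lambda>t. - exp (- c * t) / c) has_real_derivative exp (- c * t)) (at t)" for t
      using c by (auto intro!: derivative_eq_intros)
    have "((\<lambda>t. exp (- (c * t))) \<longlongrightarrow> 0) at_top"
      using c by (intro filterlim_compose[OF exp_at_bot]
          filterlim_compose[OF filterlim_uminus_at_bot_at_top] filterlim_tendsto_pos_mult_at_top[OF tendsto_const]
          filterlim_ident)
    then have "((\<lambda>t. - exp (- (c * t)) / c) \<longlongrightarrow> - 0 / c) at_top"
      using c by (intro tendsto_intros) auto
    then show "((\<lambda>t. - exp (- c * t) / c) \<longlongrightarrow> 0) at_top" by simp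
  qed (use c in auto)
  have f': "(\<integral>\<^sup>+t. ?f (- t) \<partial>lborel) = (\<integral>\<^sup>+t. ?f t \<partial>lborel)"
    using nn_integral_real_affine[of ?f "-1" 0] by simp
  have "(\<integral>\<^sup>+t. ennreal (exp (- c * \<bar>t\<bar>)) \<partial>lborel) \<le> (\<integral>\<^sup>+t. ?f t + ?f (- t) \<partial>lborel)"
    by (intro nn_integral_mono) (auto simp: indicator_def abs_if)
  also have "\<dots> = (\<integral>\<^sup>+t. ?f t \<partial>lborel) + (\<integral>\<^sup>+t. ?f (- t) \<partial>lborel)"
    by (rule nn_integral_add) measurable
  also have "\<dots> < \<infinity>" unfolding f' f by (simp flip: ennreal_plus)
  finally show ?thesis .
qed

lemma nn_integral_gauss_finite:
  fixes c :: real
  assumes c: "c > 0"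
  shows "(\<integral>\<^sup>+z. ennreal (exp (- c * (norm (z::'a::euclidean_space))\<^sup>2)) \<partial>lborel) < \<infinity>"
proof -
  have "(\<integral>\<^sup>+z. ennreal (exp (- c * (norm (z::'a))\<^sup>2)) \<partial>lborel) =
    (\<integral>\<^sup>+z. (\<Prod>b\<in>Basis. ennreal (exp (- c * ((z::'a) \<bullet> b)\<^sup>2))) \<partial>lborel)"
  proof (rule nn_integral_cong)
    fix z :: 'a
    have "(norm z)\<^sup>2 = (\<Sum>b\<in>Basis. (z \<bullet> b)\<^sup>2)"
      unfolding power2_norm_eq_inner by (subst euclidean_inner) (simp add: power2_eq_square)
    then show "ennreal (exp (- c * (norm z)\<^sup>2)) = (\<Prod>b\<in>Basis. ennreal (exp (- c * (z \<bullet> b)\<^sup>2)))"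
      by (simp add: prod_ennreal exp_sum sum_distrib_left flip: sum_negf)
  qed
  also have "\<dots> = (\<Prod>b\<in>(Basis::'a set). \<integral>\<^sup>+t. ennreal (exp (- c * t\<^sup>2)) \<partial>lborel)"
    by (rule nn_integral_lborel_prod) simp_all
  also have "\<dots> < \<infinity>"
  proof -
    have "(\<integral>\<^sup>+t. ennreal (exp (- c * t\<^sup>2)) \<partial>lborel) \<le> (\<integral>\<^sup>+t. ennreal (exp c) * ennreal (exp (- c * \<bar>t\<bar>)) \<partial>lborel)"
    proof (rule nn_integral_mono)
      fix t :: real
      have "0 \<le> (\<bar>t\<bar> - 1)\<^sup>2 + \<bar>t\<bar>" by simp
      then have "\<bar>t\<bar> - 1 \<le> t\<^sup>2" by (simp add: power2_eq_square algebra_simps)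
      then have "c * (\<bar>t\<bar> - 1) \<le> c * t\<^sup>2" using c by (intro mult_left_mono) auto
      then show "ennreal (exp (- c * t\<^sup>2)) \<le> ennreal (exp c) * ennreal (exp (- c * \<bar>t\<bar>))"
        by (simp add: ennreal_leI algebra_simps flip: ennreal_mult exp_add)
    qed
    also have "\<dots> = ennreal (exp c) * (\<integral>\<^sup>+t. ennreal (exp (- c * \<bar>t\<bar>)) \<partial>lborel)"
      by (rule nn_integral_cmult) measurable
    also have "\<dots> < \<infinity>" using nn_integral_exp_minus_abs_finite[OF c] by (simp add: ennreal_mult_less_top)
    finally have "(\<integral>\<^sup>+t. ennreal (exp (- c * t\<^sup>2)) \<partial>lborel) < \<infinity>" .
    then show ?thesis by (simp add: power_less_top_ennreal)
  qed
  finally show ?thesis .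
qed

text \<open>The parallelogram law around the midpoint of \<open>x\<close> and \<open>y\<close>
  separates the exponent into a part depending on \<open>x - y\<close> only and a Gaussian in
  \<open>z\<close> centered at the midpoint.\<close>

lemma nn_integral_gauss_convolution:
  fixes x y :: "'a::euclidean_space"
  shows "(\<integral>\<^sup>+z. ennreal (exp (- 2 * w * (norm (x - z))\<^sup>2)) * ennreal (exp (- 2 * w * (norm (y - z))\<^sup>2)) \<partial>lborel)
    = ennreal (exp (- w * (norm (x - y))\<^sup>2)) * (\<integral>\<^sup>+z. ennreal (exp (- (4 * w) * (norm (z::'a))\<^sup>2)) \<partial>lborel)"
proof -
  let ?c = "- ((x + y) /\<^sub>R 2)"
  have id: "2 * (norm (x - z))\<^sup>2 + 2 * (norm (y - z))\<^sup>2 = (norm (x - y))\<^sup>2 + 4 * (norm (z + ?c))\<^sup>2" for z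
    by (simp add: power2_norm_eq_inner inner_simps inner_commute algebra_simps)
  have "ennreal (exp (- 2 * w * (norm (x - z))\<^sup>2)) * ennreal (exp (- 2 * w * (norm (y - z))\<^sup>2)) =
    ennreal (exp (- w * (norm (x - y))\<^sup>2)) * ennreal (exp (- (4 * w) * (norm (z + ?c))\<^sup>2))" for z
  proof -
    have "- 2 * w * (norm (x - z))\<^sup>2 + - 2 * w * (norm (y - z))\<^sup>2 = - w * (2 * (norm (x - z))\<^sup>2 + 2 * (norm (y - z))\<^sup>2)"
      by (simp add: algebra_simps)
    also have "\<dots> = - w * (norm (x - y))\<^sup>2 + - (4 * w) * (norm (z + ?c))\<^sup>2"
      unfolding id by (simp add: algebra_simps)
    finally show ?thesis by (simp only: exp_ge_zero ennreal_mult[symmetric] exp_add[symmetric])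
  qed
  then show ?thesis
    using nn_integral_lborel_translate[of "\<lambda>z. ennreal (exp (- (4 * w) * (norm z)\<^sup>2))" ?c]
    by (simp add: nn_integral_cmult)
qed

section \<open>Zonal means and positive definiteness of the Gaussian\<close>

locale sphere_dim =
  fixes d :: nat and e :: "'a::euclidean_space"
  assumes d: "d \<ge> 1" and dim: "DIM('a) = d + 1" and e: "norm e = 1"
begin

text \<open>The pole \<open>e\<close> is arbitrary: by reflection invariance every pole gives the
  same mean. The argument is the squared distance, in which the Gaussians, the conformal factors and
  the Riesz kernels all have simple form.\<close>

definition zonal_mean :: "(real \<Rightarrow> real) \<Rightarrow> real" where
  "zonal_mean h = (\<integral>x. h ((norm (x - e))\<^sup>2) \<partial>sphere_prob)"

lemma zonal_distr:
  assumes p: "norm (p::'a) = 1"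
  shows "distr sphere_prob borel (\<lambda>x. (norm (x - p))\<^sup>2) = distr sphere_prob borel (\<lambda>x. (norm (x - e))\<^sup>2)"
    (is "?L = ?R")
proof (rule measure_eqI)
  fix A assume "A \<in> sets ?L"
  then have [measurable]: "A \<in> sets borel" by simp
  have "emeasure (distr sphere_prob borel (\<lambda>x. (norm (x - q))\<^sup>2)) A
      = (\<integral>\<^sup>+x. indicator A ((norm (x - q))\<^sup>2) \<partial>sphere_prob)" for q :: 'a
  proof -
    have "emeasure (distr sphere_prob borel (\<lambda>x. (norm (x - q))\<^sup>2)) A
      = (\<integral>\<^sup>+t. indicator A t \<partial>distr sphere_prob borel (\<lambda>x. (norm (x - q))\<^sup>2))" by simp
    then show ?thesis by (subst (asm) nn_integral_distr) simp_all
  qed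
  then show "emeasure ?L A = emeasure ?R A"
    using nn_integral_sphere_prob_zonal[of "\<lambda>t. indicator A (t\<^sup>2)", OF _ p e] by simp
qed simp

lemma integral_zonal:
  assumes "h \<in> borel_measurable borel" and p: "norm (p::'a) = 1"
  shows "(\<integral>x. h ((norm (x - p))\<^sup>2) \<partial>sphere_prob) = zonal_mean h"
proof -
  have "(\<integral>x. h ((norm (x - q))\<^sup>2) \<partial>sphere_prob) = (\<integral>t. h t \<partial>distr sphere_prob borel (\<lambda>x. (norm (x - q))\<^sup>2))"
    for q :: 'a
    using assms(1) by (subst integral_distr) simp_all
  then show ?thesis by (simp add: zonal_distr[OF p] zonal_mean_def)
qed

lemma integrable_zonal_iff:
  fixes h :: "real \<Rightarrow> real"
  assumes "h \<in> borel_measurable borel" and p: "norm (p::'a) = 1"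
  shows "integrable sphere_prob (\<lambda>x. h ((norm (x - p))\<^sup>2)) \<longleftrightarrow> integrable sphere_prob (\<lambda>x. h ((norm (x - e))\<^sup>2))"
proof -
  have "integrable sphere_prob (\<lambda>x. h ((norm (x - q))\<^sup>2)) \<longleftrightarrow> integrable (distr sphere_prob borel (\<lambda>x. (norm (x - q))\<^sup>2)) h"
    for q :: 'a
    using assms(1) by (subst integrable_distr_eq) simp_all
  then show ?thesis by (simp add: zonal_distr[OF p])
qed

lemma AE_sphere_prob_neq: "norm (p::'a) = 1 \<Longrightarrow> AE x in sphere_prob. x \<noteq> p"
  using measure_sphere_prob_singleton[OF dim d, of p]
  by (intro AE_I[of _ _ "{p}"]) (auto simp: sphere_prob.emeasure_eq_measure)

text \<open>The quantity \<open>J(w)\<close>. The Gaussian potential of the uniform measure is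
  constant on the sphere, so its value at the pole is also the energy integral.\<close>

definition gauss_mean :: "real \<Rightarrow> real" where
  "gauss_mean w = zonal_mean (\<lambda>v. exp (- w * v))"

lemma integrable_gauss: "w \<ge> 0 \<Longrightarrow> integrable sphere_prob (\<lambda>x::'a. exp (- w * (norm (x - p))\<^sup>2))"
  by (rule sphere_prob.integrable_const_bound[where B=1]) auto

lemma gauss_mean_eq: "norm (p::'a) = 1 \<Longrightarrow> (\<integral>x. exp (- w * (norm (x - p))\<^sup>2) \<partial>sphere_prob) = gauss_mean w"
  unfolding gauss_mean_def by (rule integral_zonal) auto

lemma nn_gauss_mean_eq:
  assumes "w \<ge> 0" "norm (p::'a) = 1"
  shows "(\<integral>\<^sup>+x. ennreal (exp (- w * (norm (x - p))\<^sup>2)) \<partial>sphere_prob) = ennreal (gauss_mean w)"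
  using nn_integral_eq_integral[OF integrable_gauss[OF assms(1), of p]] gauss_mean_eq[OF assms(2), of w] by simp

lemma gauss_mean_nonneg: "gauss_mean w \<ge> 0"
  unfolding gauss_mean_def zonal_mean_def by (intro integral_nonneg_AE) simp

lemma gauss_mean_le: "w > 0 \<Longrightarrow> gauss_mean w \<le> fact d * exp 1 * w powr (- real d / 2)"
  using nn_integral_sphere_prob_gauss_le[OF dim d _ e, of w] nn_gauss_mean_eq[OF _ e, of w] by simp

lemma norm_diff_sphere_le:
  assumes "norm (x::'a) = 1" "norm y = 1"
  shows "(norm (x - y))\<^sup>2 \<le> 4"
proof -
  have "norm (x - y) \<le> 2" using norm_triangle_ineq4[of x y] assms by simp
  then have "(norm (x - y))\<^sup>2 \<le> 2\<^sup>2" by (intro power_mono) auto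
  then show ?thesis by simp
qed

lemma gauss_mean_ge: "w \<ge> 0 \<Longrightarrow> exp (- 4 * w) \<le> gauss_mean w"
proof -
  assume w: "w \<ge> 0"
  have "exp (- 4 * w) = (\<integral>x. exp (- 4 * w) \<partial>(sphere_prob :: 'a measure))" by simp
  also have "\<dots> \<le> (\<integral>x. exp (- w * (norm (x - e))\<^sup>2) \<partial>sphere_prob)"
  proof (rule integral_mono_AE[OF _ integrable_gauss[OF w]])
    show "AE x in sphere_prob. exp (- 4 * w) \<le> exp (- w * (norm (x - e))\<^sup>2)"
    proof (rule eventually_mono[OF AE_sphere_prob])
      fix x :: 'a assume "norm x = 1"
      then show "exp (- 4 * w) \<le> exp (- w * (norm (x - e))\<^sup>2)"
        using mult_left_mono[OF norm_diff_sphere_le[OF _ e, of x] w] by (simp add: mult.commute)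
    qed
  qed simp
  finally show ?thesis using gauss_mean_eq[OF e, of w] by simp
qed

lemma gauss_mean_le_1: "w \<ge> 0 \<Longrightarrow> gauss_mean w \<le> 1"
  using integral_mono[OF integrable_gauss[of w e], of "\<lambda>_. 1"] gauss_mean_eq[OF e, of w] by simp

lemma gauss_mean_measurable [measurable]: "gauss_mean \<in> borel_measurable borel"
  unfolding gauss_mean_def zonal_mean_def by measurable

text \<open>Positive definiteness of the Gaussian, a convolution square: with \<open>u\<close> and \<open>V\<close> the half-width Gaussian
  potentials of the configuration and of the uniform measure, integrate \<open>u\<^sup>2 + n\<^sup>2 V\<^sup>2 \<ge> 2 n u V\<close>.
  Only nonnegative functions occur.\<close>

lemma gauss_energy_ge:
  fixes x :: "'i \<Rightarrow> 'a"
  assumes A: "finite A" and x: "\<And>i. i \<in> A \<Longrightarrow> norm (x i) = 1" and w: "w > 0"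
  shows "(real (card A))\<^sup>2 * gauss_mean w \<le> (\<Sum>i\<in>A. \<Sum>j\<in>A. exp (- w * (norm (x i - x j))\<^sup>2))"
proof -
  define n where "n = real (card A)"
  define \<phi> where "\<phi> y z = exp (- 2 * w * (norm (y - z))\<^sup>2)" for y z :: 'a
  have \<phi>0: "\<phi> y z \<ge> 0" for y z by (simp add: \<phi>_def)
  have \<phi>m [measurable]: "case_prod \<phi> \<in> borel_measurable (borel \<Otimes>\<^sub>M borel)"
    unfolding \<phi>_def[abs_def] by simp
  define Z where "Z = (\<integral>\<^sup>+z. ennreal (exp (- (4 * w) * (norm (z::'a))\<^sup>2)) \<partial>lborel)"
  define u where "u z = (\<Sum>i\<in>A. \<phi> (x i) z)" for z
  define V where "V z = (\<integral>y. \<phi> y z \<partial>sphere_prob)" for z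
  have int\<phi>: "integrable sphere_prob (\<lambda>y. \<phi> y z)" for z
    unfolding \<phi>_def using integrable_gauss[of "2 * w" z] w by simp
  have V0: "V z \<ge> 0" for z unfolding V_def by (intro integral_nonneg_AE) (simp add: \<phi>0)
  have u0: "u z \<ge> 0" for z unfolding u_def by (intro sum_nonneg) (simp add: \<phi>0)
  have eV: "ennreal (V z) = (\<integral>\<^sup>+y. ennreal (\<phi> y z) \<partial>sphere_prob)" for z
    unfolding V_def by (rule nn_integral_eq_integral[symmetric]) (use int\<phi> \<phi>0 in auto)
  have eu: "ennreal (u z) = (\<Sum>i\<in>A. ennreal (\<phi> (x i) z))" for z
    unfolding u_def by (rule sum_ennreal[symmetric]) (simp add: \<phi>0)
  have [measurable]: "u \<in> borel_measurable borel" "V \<in> borel_measurable borel"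
    unfolding u_def V_def by measurable
  have conv: "(\<integral>\<^sup>+z. ennreal (\<phi> a z) * ennreal (\<phi> b z) \<partial>lborel) = ennreal (exp (- w * (norm (a - b))\<^sup>2)) * Z" for a b
    unfolding \<phi>_def Z_def by (rule nn_integral_gauss_convolution)
  have aV: "(\<integral>\<^sup>+z. ennreal (\<phi> a z) * ennreal (V z) \<partial>lborel) = ennreal (gauss_mean w) * Z" if a: "norm a = 1" for a
  proof -
    have "(\<integral>\<^sup>+z. ennreal (\<phi> a z) * ennreal (V z) \<partial>lborel) =
      (\<integral>\<^sup>+z. (\<integral>\<^sup>+y. ennreal (\<phi> a z) * ennreal (\<phi> y z) \<partial>sphere_prob) \<partial>lborel)"
      unfolding eV by (intro nn_integral_cong nn_integral_cmult[symmetric]) simp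
    also have "\<dots> = (\<integral>\<^sup>+y. (\<integral>\<^sup>+z. ennreal (\<phi> a z) * ennreal (\<phi> y z) \<partial>lborel) \<partial>sphere_prob)"
      by (rule pair_sigma_finite.Fubini') (simp_all add: pair_sigma_finite_def lborel.sigma_finite_measure_axioms
          sphere_prob.sigma_finite_measure_axioms)
    also have "\<dots> = (\<integral>\<^sup>+y. ennreal (exp (- w * (norm (y - a))\<^sup>2)) * Z \<partial>sphere_prob)"
      unfolding conv by (simp add: norm_minus_commute)
    also have "\<dots> = ennreal (gauss_mean w) * Z"
      using w by (subst nn_integral_multc) (simp_all add: nn_gauss_mean_eq[OF _ a, simplified])
    finally show ?thesis .
  qed
  have uu: "(\<integral>\<^sup>+z. ennreal (u z) * ennreal (u z) \<partial>lborel) = ennreal (\<Sum>i\<in>A. \<Sum>j\<in>A. exp (- w * (norm (x i - x j))\<^sup>2)) * Z"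
  proof -
    have "(\<integral>\<^sup>+z. ennreal (u z) * ennreal (u z) \<partial>lborel) =
      (\<integral>\<^sup>+z. (\<Sum>i\<in>A. \<Sum>j\<in>A. ennreal (\<phi> (x i) z) * ennreal (\<phi> (x j) z)) \<partial>lborel)"
      unfolding eu by (simp add: sum_product)
    also have "\<dots> = (\<Sum>i\<in>A. \<Sum>j\<in>A. ennreal (exp (- w * (norm (x i - x j))\<^sup>2)) * Z)"
      by (simp add: nn_integral_sum conv)
    also have "\<dots> = (\<Sum>i\<in>A. \<Sum>j\<in>A. ennreal (exp (- w * (norm (x i - x j))\<^sup>2))) * Z"
      by (simp only: sum_distrib_right)
    also have "(\<Sum>i\<in>A. \<Sum>j\<in>A. ennreal (exp (- w * (norm (x i - x j))\<^sup>2))) = ennreal (\<Sum>i\<in>A. \<Sum>j\<in>A. exp (- w * (norm (x i - x j))\<^sup>2))"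
      by (simp add: sum_nonneg)
    finally show ?thesis .
  qed
  have uV: "(\<integral>\<^sup>+z. ennreal (u z) * ennreal (V z) \<partial>lborel) = ennreal (n * gauss_mean w) * Z"
  proof -
    have "(\<integral>\<^sup>+z. ennreal (u z) * ennreal (V z) \<partial>lborel) = (\<integral>\<^sup>+z. (\<Sum>i\<in>A. ennreal (\<phi> (x i) z) * ennreal (V z)) \<partial>lborel)"
      unfolding eu by (simp only: sum_distrib_right)
    also have "\<dots> = (\<Sum>i\<in>A. ennreal (gauss_mean w) * Z)"
      by (simp add: nn_integral_sum aV x)
    finally show ?thesis by (simp add: n_def ennreal_mult gauss_mean_nonneg ennreal_of_nat_eq_real_of_nat mult.assoc)
  qed
  have VV: "(\<integral>\<^sup>+z. ennreal (V z) * ennreal (V z) \<partial>lborel) = ennreal (gauss_mean w) * Z"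
  proof -
    have "(\<integral>\<^sup>+z. ennreal (V z) * ennreal (V z) \<partial>lborel) =
      (\<integral>\<^sup>+z. (\<integral>\<^sup>+y. ennreal (\<phi> y z) * ennreal (V z) \<partial>sphere_prob) \<partial>lborel)"
      by (subst (1) eV, intro nn_integral_cong nn_integral_multc[symmetric]) simp
    also have "\<dots> = (\<integral>\<^sup>+y. (\<integral>\<^sup>+z. ennreal (\<phi> y z) * ennreal (V z) \<partial>lborel) \<partial>sphere_prob)"
      by (rule pair_sigma_finite.Fubini') (simp_all add: pair_sigma_finite_def lborel.sigma_finite_measure_axioms
          sphere_prob.sigma_finite_measure_axioms)
    also have "\<dots> = (\<integral>\<^sup>+y. ennreal (gauss_mean w) * Z \<partial>(sphere_prob :: 'a measure))"
      by (rule nn_integral_sphere_prob_cong) (rule aV)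
    finally show ?thesis by simp
  qed
  have n0: "n \<ge> 0" by (simp add: n_def)
  have "ennreal (2 * n) * (ennreal (n * gauss_mean w) * Z) = (\<integral>\<^sup>+z. ennreal (2 * n) * (ennreal (u z) * ennreal (V z)) \<partial>lborel)"
    unfolding uV[symmetric] by (rule nn_integral_cmult[symmetric]) measurable
  also have "\<dots> \<le> (\<integral>\<^sup>+z. ennreal (u z) * ennreal (u z) + ennreal (n\<^sup>2) * (ennreal (V z) * ennreal (V z)) \<partial>lborel)"
  proof (rule nn_integral_mono)
    fix z
    have "0 \<le> (u z - n * V z)\<^sup>2" by simp
    then have "2 * n * (u z * V z) \<le> u z * u z + n\<^sup>2 * (V z * V z)"
      by (simp add: power2_eq_square algebra_simps)
    then show "ennreal (2 * n) * (ennreal (u z) * ennreal (V z)) \<le>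
        ennreal (u z) * ennreal (u z) + ennreal (n\<^sup>2) * (ennreal (V z) * ennreal (V z))"
      using u0[of z] V0[of z] n0 by (simp add: ennreal_leI del: ennreal_plus flip: ennreal_mult ennreal_plus)
  qed
  also have "\<dots> = ennreal (\<Sum>i\<in>A. \<Sum>j\<in>A. exp (- w * (norm (x i - x j))\<^sup>2)) * Z + ennreal (n\<^sup>2) * (ennreal (gauss_mean w) * Z)"
    by (simp add: nn_integral_add nn_integral_cmult uu VV)
  finally have main: "ennreal (2 * n) * (ennreal (n * gauss_mean w) * Z) \<le>
      ennreal (\<Sum>i\<in>A. \<Sum>j\<in>A. exp (- w * (norm (x i - x j))\<^sup>2)) * Z + ennreal (n\<^sup>2) * (ennreal (gauss_mean w) * Z)" .
  have Zfin: "Z < \<infinity>" unfolding Z_def using w by (intro nn_integral_gauss_finite) simp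
  have "Z \<noteq> 0"
  proof
    assume "Z = 0"
    then have "AE z::'a in lborel. ennreal (exp (- (4 * w) * (norm z)\<^sup>2)) = 0"
      unfolding Z_def by (subst (asm) nn_integral_0_iff_AE) auto
    then have "AE z::'a in lborel. False" by simp
    then have "emeasure (lborel::'a measure) UNIV = 0" 
      by (subst (asm) AE_iff_measurable[of UNIV]) auto
    then show False by simp
  qed
  with Zfin obtain r where r: "Z = ennreal r" "r > 0"
    by (metis ennreal_cases ennreal_0 infinity_ennreal_def less_irrefl order_le_less)
  have S0: "0 \<le> (\<Sum>i\<in>A. \<Sum>j\<in>A. exp (- w * (norm (x i - x j))\<^sup>2))" by (intro sum_nonneg) simp
  have "2 * n * (n * gauss_mean w * r) \<le> (\<Sum>i\<in>A. \<Sum>j\<in>A. exp (- w * (norm (x i - x j))\<^sup>2)) * r + n\<^sup>2 * (gauss_mean w * r)"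
  proof -
    have "2 * n * (n * g * r) \<le> S * r + n\<^sup>2 * (g * r)"
      if "ennreal (2 * n) * (ennreal (n * g) * ennreal r) \<le> ennreal S * ennreal r + ennreal (n\<^sup>2) * (ennreal g * ennreal r)"
        "0 \<le> S" "0 \<le> g" for S g
      using that r n0 by (simp del: ennreal_plus flip: ennreal_mult ennreal_plus)
    then show ?thesis using main[unfolded r(1)] S0 gauss_mean_nonneg by blast
  qed
  then have "n\<^sup>2 * gauss_mean w * r \<le> (\<Sum>i\<in>A. \<Sum>j\<in>A. exp (- w * (norm (x i - x j))\<^sup>2)) * r"
    by (simp add: power2_eq_square algebra_simps)
  then show ?thesis using r by (simp add: n_def)
qed

end

section \<open>Riesz kernels as Gaussian mixtures\<close>

text \<open>At \<open>v = 0\<close> the value is 0 for every \<open>s\<close>. It is the true value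
  for \<open>s < 0\<close>; for \<open>s \<ge> 0\<close> it is a default value and agrees with
  \<open>real_of_ereal\<close> of infinity, so the integrands in \<open>continuous_energy\<close>
  match everywhere.\<close>

definition riesz_profile :: "real \<Rightarrow> real \<Rightarrow> real" where
  "riesz_profile s v = (if s = 0 then - ln v / 2 else sgn s * v powr (- s / 2))"

text \<open>The coefficient in the derivative of the profile. With it, power and logarithmic kernels
  obey the same derivative formula, and most later arguments need no case distinction in
  \<open>s\<close>.\<close>

definition riesz_slope :: "real \<Rightarrow> real" where
  "riesz_slope s = (if s = 0 then 1 / 2 else \<bar>s\<bar> / 2)"

lemma riesz_slope_pos: "riesz_slope s > 0"
  by (simp add: riesz_slope_def)

lemma riesz_profile_measurable [measurable]: "riesz_profile s \<in> borel_measurable borel"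
  unfolding riesz_profile_def[abs_def] by measurable

lemma DERIV_riesz_profile:
  assumes "v > 0"
  shows "(riesz_profile s has_real_derivative - (riesz_slope s * v powr (- s / 2 - 1))) (at v)"
proof (cases "s = 0")
  case True
  then have "riesz_profile s = (\<lambda>v. - ln v / 2)" by (simp add: riesz_profile_def fun_eq_iff)
  with True assms show ?thesis
    by (auto intro!: derivative_eq_intros simp: riesz_slope_def powr_minus field_simps)
next
  case False
  then have "riesz_profile s = (\<lambda>v. sgn s * v powr (- s / 2))" by (simp add: riesz_profile_def fun_eq_iff)
  with False assms show ?thesis
    by (auto intro!: derivative_eq_intros simp: riesz_slope_def sgn_if)
qed

lemma riesz_kernel_eq:
  "riesz_kernel s x y = (if s \<ge> 0 \<and> x = y then \<infinity> else ereal (riesz_profile s ((norm (x - y))\<^sup>2)))"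
proof -
  have "norm (x - y) powr (- s) = ((norm (x - y))\<^sup>2) powr (- s / 2)"
    by (cases "x = y") (simp_all add: powr_powr flip: powr_numeral)
  moreover have "ln ((norm (x - y))\<^sup>2) = 2 * ln (norm (x - y))" if "x \<noteq> y"
    using that by (simp add: ln_realpow)
  ultimately show ?thesis
    by (auto simp: riesz_kernel_def riesz_profile_def)
qed

lemma real_of_ereal_riesz_kernel:
  "real_of_ereal (riesz_kernel s x y) = riesz_profile s ((norm (x - y))\<^sup>2)"
  by (auto simp: riesz_kernel_eq riesz_profile_def)

lemma nn_integral_powr_to_0:
  assumes "a > -1" "c \<ge> 0"
  shows "(\<integral>\<^sup>+x. ennreal (indicator {0..c} x * x powr a) \<partial>lborel) = ennreal (c powr (a + 1) / (a + 1))"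
  by (rule nn_integral_has_integral_lebesgue[OF _ has_integral_powr_from_0[OF assms]]) auto

lemma nn_integral_powr_to_infinity:
  assumes "a < -1" "c > 0"
  shows "(\<integral>\<^sup>+x. ennreal (indicator {c..} x * x powr a) \<partial>lborel) = ennreal (- (c powr (a + 1)) / (a + 1))"
  by (rule nn_integral_has_integral_lebesgue[OF _ has_integral_powr_to_inf[OF assms]]) auto

lemma nn_integral_Gamma_powr:
  assumes u: "u > 0" and b: "b > 0"
  shows "(\<integral>\<^sup>+w. ennreal (indicator {0<..} w * (w powr (b - 1) * exp (- u * w))) \<partial>lborel)
    = ennreal (Gamma b * u powr (- b))"
proof -
  have "ennreal (Gamma b) = (\<integral>\<^sup>+t. ennreal (indicator {0..} t * (t powr (b - 1) / exp t)) \<partial>lborel)"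
    using Gamma_conv_nn_integral_real[OF b] by simp
  also have "\<dots> = (\<integral>\<^sup>+t. ennreal (indicator {0<..} t * (t powr (b - 1) * exp (- t))) \<partial>lborel)"
    using AE_lborel_singleton[of 0]
    by (intro nn_integral_cong_AE) (auto elim!: eventually_mono simp: indicator_def exp_minus divide_inverse)
  also have "\<dots> = ennreal u * (\<integral>\<^sup>+w. ennreal (indicator {0<..} (u * w) * ((u * w) powr (b - 1) * exp (- (u * w)))) \<partial>lborel)"
    using u by (subst nn_integral_real_affine[where c=u and t=0]) auto
  also have "\<dots> = ennreal u * (\<integral>\<^sup>+w. ennreal (u powr (b - 1)) * ennreal (indicator {0<..} w * (w powr (b - 1) * exp (- u * w))) \<partial>lborel)"
    using u by (intro arg_cong2[where f="(*)"] nn_integral_cong refl)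
      (auto simp: indicator_def zero_less_mult_iff powr_mult mult.assoc simp flip: ennreal_mult)
  also have "\<dots> = ennreal (u powr b) * (\<integral>\<^sup>+w. ennreal (indicator {0<..} w * (w powr (b - 1) * exp (- u * w))) \<partial>lborel)"
    using u by (subst nn_integral_cmult) (auto simp: mult.assoc[symmetric] powr_diff simp flip: ennreal_mult)
  finally have 1: "ennreal (Gamma b) = ennreal (u powr b) * (\<integral>\<^sup>+w. ennreal (indicator {0<..} w * (w powr (b - 1) * exp (- u * w))) \<partial>lborel)"
    (is "_ = _ * ?I") .
  have "?I = ennreal (u powr (- b)) * (ennreal (u powr b) * ?I)"
    using u by (simp add: mult.assoc[symmetric] flip: ennreal_mult powr_add)
  also have "\<dots> = ennreal (u powr (- b)) * ennreal (Gamma b)" unfolding 1 ..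
  finally show ?thesis using b Gamma_real_pos[OF b] by (simp add: mult.commute flip: ennreal_mult)
qed

locale sphere_riesz = sphere_dim d e for d :: nat and e :: "'a::euclidean_space" +
  fixes s :: real
  assumes s: "- 2 < s" "s < real d"
begin

abbreviation \<kappa> :: "real \<Rightarrow> real" where "\<kappa> \<equiv> riesz_profile s"

text \<open>Normalizes the Gamma integral that expresses minus the derivative of the profile as a
  mixture of exponentials; \<open>s > - 2\<close> makes the argument of \<open>Gamma\<close>
  positive.\<close>

definition gauss_const :: real where "gauss_const = riesz_slope s / Gamma (s / 2 + 1)"

lemma gauss_const_pos: "gauss_const > 0"
  using s Gamma_real_pos[of "s / 2 + 1"] by (simp add: gauss_const_def riesz_slope_pos)

definition gauss_weight :: "real \<Rightarrow> real" where
  "gauss_weight w = indicator {0<..} w * (gauss_const * w powr (s / 2 - 1))"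

lemma gauss_weight_nonneg: "gauss_weight w \<ge> 0"
  using gauss_const_pos by (simp add: gauss_weight_def)

lemma gauss_weight_measurable [measurable]: "gauss_weight \<in> borel_measurable borel"
  unfolding gauss_weight_def[abs_def] by measurable

lemma riesz_profile_antimono:
  assumes v: "0 < v" "v \<le> v'"
  shows "\<kappa> v' \<le> \<kappa> v"
proof (rule DERIV_nonpos_imp_nonincreasing[OF v(2)])
  fix x assume "v \<le> x" "x \<le> v'"
  then show "\<exists>y. (\<kappa> has_real_derivative y) (at x) \<and> y \<le> 0"
    using v DERIV_riesz_profile[of x s] riesz_slope_pos[of s] by (intro exI conjI) auto
qed

text \<open>The fundamental theorem of calculus for the profile. At \<open>v = 0\<close> the
  integral is improper; it converges when \<open>s < 0\<close>, the only case in which a zero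
  distance has a finite kernel value.\<close>

lemma nn_integral_riesz_slope:
  assumes v: "0 \<le> v" "v \<le> 4" "v = 0 \<Longrightarrow> s < 0"
  shows "(\<integral>\<^sup>+u. ennreal (riesz_slope s * u powr (- s / 2 - 1)) * indicator {v..4} u \<partial>lborel) = ennreal (\<kappa> v - \<kappa> 4)"
proof (cases "v = 0")
  case False
  have "(\<integral>\<^sup>+u. ennreal (riesz_slope s * u powr (- s / 2 - 1)) * indicator {v..4} u \<partial>lborel) = ennreal (- \<kappa> 4 - (- \<kappa> v))"
    using False v riesz_slope_pos[of s]
    by (intro nn_integral_FTC_Icc) (auto intro!: derivative_eq_intros DERIV_riesz_profile)
  then show ?thesis by simp
next
  case True
  then have s0: "s < 0" by (rule v(3))
  have "(\<integral>\<^sup>+u. ennreal (riesz_slope s * u powr (- s / 2 - 1)) * indicator {v..4} u \<partial>lborel)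
     = (\<integral>\<^sup>+u. ennreal (riesz_slope s) * ennreal (indicator {0..4} u * u powr (- s / 2 - 1)) \<partial>lborel)"
    using riesz_slope_pos[of s] True
    by (intro nn_integral_cong) (auto simp: indicator_def ennreal_mult)
  also have "\<dots> = ennreal (riesz_slope s) * ennreal (4 powr (- s / 2 - 1 + 1) / (- s / 2 - 1 + 1))"
    using s0 nn_integral_powr_to_0[of "- s / 2 - 1" 4] by (simp add: nn_integral_cmult)
  also have "\<dots> = ennreal (riesz_slope s * (4 powr (- s / 2 - 1 + 1) / (- s / 2 - 1 + 1)))"
    using riesz_slope_pos[of s] s0 by (intro ennreal_mult[symmetric] divide_nonneg_pos) auto
  also have "riesz_slope s * (4 powr (- s / 2 - 1 + 1) / (- s / 2 - 1 + 1)) = \<kappa> v - \<kappa> 4"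
  proof -
    have "- s / 2 - 1 + 1 = - s / 2" by simp
    then show ?thesis using s0 True by (simp only: riesz_slope_def riesz_profile_def) simp
  qed
  finally show ?thesis .
qed

text \<open>Minus the derivative of the profile at \<open>u\<close> is the integral of
  \<open>gauss_const * w powr (s / 2) * exp (- u * w)\<close> over \<open>w > 0\<close>. Integrating
  over \<open>u\<close> from \<open>v\<close> to 4 and swapping gives the claim; the inner integral
  over \<open>u\<close> lowers the power of \<open>w\<close> by one. Near \<open>w = 0\<close> the
  difference of exponentials is of order \<open>w\<close>, which compensates the singularity of the
  weight.\<close>

lemma nn_integral_gauss_weight:
  assumes v: "0 \<le> v" "v \<le> 4" "v = 0 \<Longrightarrow> s < 0"
  shows "(\<integral>\<^sup>+w. ennreal (gauss_weight w * (exp (- v * w) - exp (- 4 * w))) \<partial>lborel) = ennreal (\<kappa> v - \<kappa> 4)"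
proof -
  let ?f = "\<lambda>u w. ennreal (indicator {0<..} w * (gauss_const * w powr (s / 2) * exp (- u * w)) * indicator {v..4} u)"
  have 1: "(\<integral>\<^sup>+w. ?f u w \<partial>lborel) = ennreal (riesz_slope s * u powr (- s / 2 - 1)) * indicator {v..4} u" if "u > 0" for u
  proof -
    have "(\<integral>\<^sup>+w. ?f u w \<partial>lborel) = (\<integral>\<^sup>+w. ennreal (gauss_const * indicator {v..4} u) *
        ennreal (indicator {0<..} w * (w powr (s / 2 + 1 - 1) * exp (- u * w))) \<partial>lborel)"
      using gauss_const_pos by (intro nn_integral_cong) (simp add: mult_ac flip: ennreal_mult)
    also have "\<dots> = ennreal (gauss_const * indicator {v..4} u) * ennreal (Gamma (s / 2 + 1) * u powr (- (s / 2 + 1)))"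
      using s that nn_integral_Gamma_powr[of u "s / 2 + 1"] by (simp add: nn_integral_cmult)
    also have "\<dots> = ennreal (riesz_slope s * u powr (- s / 2 - 1)) * indicator {v..4} u"
    proof -
      have "Gamma (s / 2 + 1) > 0" using s by (intro Gamma_real_pos) simp
      then have e: "gauss_const * (Gamma (s / 2 + 1) * u powr (- (s / 2 + 1))) = riesz_slope s * u powr (- s / 2 - 1)"
        by (simp add: gauss_const_def)
      show ?thesis
      proof (cases "u \<in> {v..4}")
        case True
        have "ennreal (gauss_const * indicator {v..4} u) * ennreal X = ennreal (gauss_const * X)" for X
          using gauss_const_pos True by (simp add: ennreal_mult')
        with True show ?thesis by (simp only: e) simp
      qed simp
    qed
    finally show ?thesis .
  qed
  have 2: "(\<integral>\<^sup>+u. ?f u w \<partial>lborel) = ennreal (gauss_weight w * (exp (- v * w) - exp (- 4 * w)))" for w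
  proof (cases "w > 0")
    case True
    have "(\<integral>\<^sup>+u. ?f u w \<partial>lborel) = (\<integral>\<^sup>+u. ennreal (gauss_const * w powr (s / 2)) * (ennreal (exp (- u * w)) * indicator {v..4} u) \<partial>lborel)"
      using True gauss_const_pos by (intro nn_integral_cong) (auto simp: indicator_def simp flip: ennreal_mult)
    also have "\<dots> = ennreal (gauss_const * w powr (s / 2)) * (\<integral>\<^sup>+u. ennreal (exp (- u * w)) * indicator {v..4} u \<partial>lborel)"
      by (rule nn_integral_cmult) simp
    also have "(\<integral>\<^sup>+u. ennreal (exp (- u * w)) * indicator {v..4} u \<partial>lborel) = ennreal (- exp (- 4 * w) / w - (- exp (- v * w) / w))"
      using True v by (intro nn_integral_FTC_Icc) (auto intro!: derivative_eq_intros)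
    also have "ennreal (gauss_const * w powr (s / 2)) * \<dots> = ennreal (gauss_const * w powr (s / 2) * (- exp (- 4 * w) / w - (- exp (- v * w) / w)))"
      using True v gauss_const_pos by (intro ennreal_mult[symmetric]) (auto intro!: divide_right_mono)
    also have "gauss_const * w powr (s / 2) * (- exp (- 4 * w) / w - (- exp (- v * w) / w)) = gauss_weight w * (exp (- v * w) - exp (- 4 * w))"
    proof -
      have "w powr (s / 2) = w powr (s / 2 - 1) * w" using True by (simp add: powr_diff)
      then show ?thesis using True by (simp add: gauss_weight_def field_simps)
    qed
    finally show ?thesis .
  qed (simp add: gauss_weight_def)
  have "ennreal (\<kappa> v - \<kappa> 4) = (\<integral>\<^sup>+u. ennreal (riesz_slope s * u powr (- s / 2 - 1)) * indicator {v..4} u \<partial>lborel)"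
    using v by (rule nn_integral_riesz_slope[symmetric])
  also have "\<dots> = (\<integral>\<^sup>+u. (\<integral>\<^sup>+w. ?f u w \<partial>lborel) \<partial>lborel)"
  proof (rule nn_integral_cong_AE, rule eventually_mono[OF AE_lborel_singleton[of 0]])
    fix u :: real assume u: "u \<noteq> 0"
    show "ennreal (riesz_slope s * u powr (- s / 2 - 1)) * indicator {v..4} u = (\<integral>\<^sup>+w. ?f u w \<partial>lborel)"
    proof (cases "u > 0")
      case False
      then have "indicator {v..4} u = (0::real)" "indicator {v..4} u = (0::ennreal)" using u v by (auto simp: indicator_def)
      then show ?thesis by simp
    qed (rule 1[symmetric])
  qed
  also have "\<dots> = (\<integral>\<^sup>+w. (\<integral>\<^sup>+u. ?f u w \<partial>lborel) \<partial>lborel)"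
    by (rule lborel_pair.Fubini') measurable
  finally show ?thesis unfolding 2 ..
qed

lemma has_bochner_integral_gauss_weight:
  assumes v: "0 \<le> v" "v \<le> 4" "v = 0 \<Longrightarrow> s < 0"
  shows "has_bochner_integral lborel (\<lambda>w. gauss_weight w * (exp (- v * w) - exp (- 4 * w))) (\<kappa> v - \<kappa> 4)"
proof (rule has_bochner_integral_nn_integral)
  show "AE w in lborel. 0 \<le> gauss_weight w * (exp (- v * w) - exp (- 4 * w))"
  proof (rule AE_I2)
    fix w show "0 \<le> gauss_weight w * (exp (- v * w) - exp (- 4 * w))"
      using v mult_right_mono[of v 4 w] gauss_weight_nonneg[of w]
      by (cases "w > 0") (auto simp: gauss_weight_def)
  qed
  show "0 \<le> \<kappa> v - \<kappa> 4"
  proof (cases "v = 0")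
    case True
    then show ?thesis using v(3) by (simp add: riesz_profile_def)
  qed (use riesz_profile_antimono[of v 4] v in simp)
qed (use nn_integral_gauss_weight[OF v] in auto)

definition gauss_mean_const :: real where "gauss_mean_const = fact d * exp 1"

lemma gauss_mean_const_pos: "gauss_mean_const > 0" by (simp add: gauss_mean_const_def)

text \<open>Both restrictions on \<open>s\<close> enter: below \<open>w = 1\<close> the integrand is
  of order \<open>w powr (s / 2)\<close>, integrable for \<open>s > - 2\<close>, and above it the
  decay of \<open>gauss_mean\<close> leaves \<open>w powr (s / 2 - 1 - d / 2)\<close>, integrable
  for \<open>s < d\<close>. Finiteness of the continuous energy follows.\<close>

lemma nn_integral_gauss_weight_mean_finite:
  "(\<integral>\<^sup>+w. ennreal (gauss_weight w * (gauss_mean w - exp (- 4 * w))) \<partial>lborel) < \<infinity>"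
proof -
  let ?c = "gauss_const" and ?C = "gauss_mean_const"
  have "(\<integral>\<^sup>+w. ennreal (gauss_weight w * (gauss_mean w - exp (- 4 * w))) \<partial>lborel) \<le>
    (\<integral>\<^sup>+w. ennreal (?c * 4) * ennreal (indicator {0..1} w * w powr (s / 2)) +
       ennreal (?c * ?C) * ennreal (indicator {1..} w * w powr (s / 2 - 1 - d / 2)) \<partial>lborel)"
  proof (rule nn_integral_mono)
    fix w :: real
    show "ennreal (gauss_weight w * (gauss_mean w - exp (- 4 * w))) \<le>
      ennreal (?c * 4) * ennreal (indicator {0..1} w * w powr (s / 2)) +
       ennreal (?c * ?C) * ennreal (indicator {1..} w * w powr (s / 2 - 1 - d / 2))"
    proof (cases "w > 0")
      case w: True
      show ?thesis
      proof (cases "w \<le> 1")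
        case True
        have "gauss_mean w - exp (- 4 * w) \<le> 4 * w"
          using gauss_mean_le_1[of w] exp_ge_add_one_self[of "- 4 * w"] w by simp
        then have "?c * w powr (s / 2 - 1) * (gauss_mean w - exp (- 4 * w)) \<le> ?c * w powr (s / 2 - 1) * (4 * w)"
          using gauss_const_pos by (intro mult_left_mono) auto
        also have "\<dots> = ?c * 4 * w powr (s / 2)" using w by (simp add: powr_diff)
        finally have "ennreal (gauss_weight w * (gauss_mean w - exp (- 4 * w))) \<le>
            ennreal (?c * 4 * (indicator {0..1} w * w powr (s / 2)))"
          using w True by (intro ennreal_leI) (simp add: gauss_weight_def)
        then show ?thesis using gauss_const_pos by (simp add: ennreal_mult add_increasing2)
      next
        case False
        have "gauss_mean w - exp (- 4 * w) \<le> ?C * w powr (- real d / 2)"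
          using gauss_mean_le[OF w] exp_ge_zero[of "- 4 * w"] unfolding gauss_mean_const_def by linarith
        then have "?c * w powr (s / 2 - 1) * (gauss_mean w - exp (- 4 * w)) \<le> ?c * w powr (s / 2 - 1) * (?C * w powr (- real d / 2))"
          using gauss_const_pos by (intro mult_left_mono) auto
        also have "\<dots> = ?c * ?C * w powr (s / 2 - 1 - d / 2)"
        proof -
          have "w powr (s / 2 - 1 - d / 2) = w powr (s / 2 - 1) * w powr (- real d / 2)"
            by (simp flip: powr_add)
          then show ?thesis by simp
        qed
        finally have "ennreal (gauss_weight w * (gauss_mean w - exp (- 4 * w))) \<le>
            ennreal (?c * ?C * (indicator {1..} w * w powr (s / 2 - 1 - d / 2)))"
          using w False by (intro ennreal_leI) (simp add: gauss_weight_def)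
        then show ?thesis using gauss_const_pos gauss_mean_const_pos by (simp add: ennreal_mult add_increasing)
      qed
    qed (simp add: gauss_weight_def)
  qed
  also have "\<dots> = ennreal (?c * 4) * (\<integral>\<^sup>+w. ennreal (indicator {0..1} w * w powr (s / 2)) \<partial>lborel) +
       ennreal (?c * ?C) * (\<integral>\<^sup>+w. ennreal (indicator {1..} w * w powr (s / 2 - 1 - d / 2)) \<partial>lborel)"
    by (simp add: nn_integral_add nn_integral_cmult)
  also have "\<dots> < \<infinity>"
    using s by (simp add: nn_integral_powr_to_0 nn_integral_powr_to_infinity ennreal_mult_less_top)
  finally show ?thesis .
qed

lemma nn_integral_riesz_zonal:
  "(\<integral>\<^sup>+x. ennreal (\<kappa> ((norm (x - e))\<^sup>2) - \<kappa> 4) \<partial>sphere_prob) =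
    (\<integral>\<^sup>+w. ennreal (gauss_weight w * (gauss_mean w - exp (- 4 * w))) \<partial>lborel)"
proof -
  have "(\<integral>\<^sup>+x. ennreal (\<kappa> ((norm (x - e))\<^sup>2) - \<kappa> 4) \<partial>sphere_prob) =
    (\<integral>\<^sup>+x. (\<integral>\<^sup>+w. ennreal (gauss_weight w * (exp (- (norm (x - e))\<^sup>2 * w) - exp (- 4 * w))) \<partial>lborel) \<partial>sphere_prob)"
  proof (rule nn_integral_cong_AE, rule eventually_mono[OF eventually_conj[OF AE_sphere_prob AE_sphere_prob_neq[OF e]]])
    fix x :: 'a assume "norm x = 1 \<and> x \<noteq> e"
    then show "ennreal (\<kappa> ((norm (x - e))\<^sup>2) - \<kappa> 4) =
        (\<integral>\<^sup>+w. ennreal (gauss_weight w * (exp (- (norm (x - e))\<^sup>2 * w) - exp (- 4 * w))) \<partial>lborel)"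
      using norm_diff_sphere_le[of x e] e by (intro nn_integral_gauss_weight[symmetric]) auto
  qed
  also have "\<dots> = (\<integral>\<^sup>+w. (\<integral>\<^sup>+x. ennreal (gauss_weight w * (exp (- (norm (x - e))\<^sup>2 * w) - exp (- 4 * w))) \<partial>sphere_prob) \<partial>lborel)"
    by (rule pair_sigma_finite.Fubini') (simp_all add: pair_sigma_finite_def lborel.sigma_finite_measure_axioms
          sphere_prob.sigma_finite_measure_axioms)
  also have "\<dots> = (\<integral>\<^sup>+w. ennreal (gauss_weight w * (gauss_mean w - exp (- 4 * w))) \<partial>lborel)"
  proof (rule nn_integral_cong)
    fix w :: real
    show "(\<integral>\<^sup>+x. ennreal (gauss_weight w * (exp (- (norm (x - e))\<^sup>2 * w) - exp (- 4 * w))) \<partial>sphere_prob) =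
      ennreal (gauss_weight w * (gauss_mean w - exp (- 4 * w)))"
    proof (cases "w > 0")
      case w: True
      have i: "integrable sphere_prob (\<lambda>x. exp (- (norm (x - e))\<^sup>2 * w))"
        using integrable_gauss[of w e] w by (simp add: mult.commute)
      have "(\<integral>\<^sup>+x. ennreal (gauss_weight w * (exp (- (norm (x - e))\<^sup>2 * w) - exp (- 4 * w))) \<partial>sphere_prob) =
        ennreal (\<integral>x. gauss_weight w * (exp (- (norm (x - e))\<^sup>2 * w) - exp (- 4 * w)) \<partial>sphere_prob)"
      proof (rule nn_integral_eq_integral)
        show "AE x in sphere_prob. 0 \<le> gauss_weight w * (exp (- (norm (x - e))\<^sup>2 * w) - exp (- 4 * w))"
        proof (rule eventually_mono[OF AE_sphere_prob])
          fix x :: 'a assume "norm x = 1"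
          then have "(norm (x - e))\<^sup>2 * w \<le> 4 * w"
            using norm_diff_sphere_le[of x e] e w by (intro mult_right_mono) auto
          then show "0 \<le> gauss_weight w * (exp (- (norm (x - e))\<^sup>2 * w) - exp (- 4 * w))"
            by (intro mult_nonneg_nonneg gauss_weight_nonneg) simp
        qed
      qed (use i in simp)
      also have "(\<integral>x. gauss_weight w * (exp (- (norm (x - e))\<^sup>2 * w) - exp (- 4 * w)) \<partial>sphere_prob) =
          gauss_weight w * (gauss_mean w - exp (- 4 * w))"
        using i gauss_mean_eq[OF e, of w] by (simp add: Bochner_Integration.integral_diff mult.commute[of w])
      finally show ?thesis .
    qed (simp add: gauss_weight_def)
  qed
  finally show ?thesis .
qed

text \<open>The energy integral of the kernel, expressed as the constant value of the potential of
  the uniform measure.\<close>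

definition riesz_mean :: real where "riesz_mean = zonal_mean \<kappa>"

lemma riesz_profile_ge:
  assumes "norm (x::'a) = 1" "norm y = 1" "x \<noteq> y"
  shows "\<kappa> 4 \<le> \<kappa> ((norm (x - y))\<^sup>2)"
  using assms norm_diff_sphere_le[of x y] by (intro riesz_profile_antimono) auto

lemma integrable_riesz:
  assumes p: "norm (p::'a) = 1"
  shows "integrable sphere_prob (\<lambda>x. \<kappa> ((norm (x - p))\<^sup>2))"
proof -
  have "integrable sphere_prob (\<lambda>x. \<kappa> ((norm (x - e))\<^sup>2) - \<kappa> 4)"
  proof (rule integrableI_nonneg)
    show "AE x in sphere_prob. 0 \<le> \<kappa> ((norm (x - e))\<^sup>2) - \<kappa> 4"
      by (rule eventually_mono[OF eventually_conj[OF AE_sphere_prob AE_sphere_prob_neq[OF e]]])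
        (use riesz_profile_ge[OF _ e] in auto)
    show "(\<integral>\<^sup>+x. ennreal (\<kappa> ((norm (x - e))\<^sup>2) - \<kappa> 4) \<partial>sphere_prob) < \<infinity>"
      unfolding nn_integral_riesz_zonal by (rule nn_integral_gauss_weight_mean_finite)
  qed measurable
  then have "integrable sphere_prob (\<lambda>x. \<kappa> ((norm (x - e))\<^sup>2) - \<kappa> 4 + \<kappa> 4)"
    by (rule Bochner_Integration.integrable_add) simp
  then show ?thesis by (subst integrable_zonal_iff[OF _ p]) simp_all
qed

lemma integral_riesz:
  assumes p: "norm (p::'a) = 1"
  shows "(\<integral>x. \<kappa> ((norm (x - p))\<^sup>2) \<partial>sphere_prob) = riesz_mean"
  unfolding riesz_mean_def by (rule integral_zonal[OF _ p]) simp

lemma gauss_weight_mean_nonneg: "0 \<le> gauss_weight w * (gauss_mean w - exp (- 4 * w))"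
  using gauss_mean_ge[of w] gauss_weight_nonneg[of w]
  by (cases "w > 0") (auto simp: gauss_weight_def)

lemma has_bochner_integral_gauss_weight_mean:
  "has_bochner_integral lborel (\<lambda>w. gauss_weight w * (gauss_mean w - exp (- 4 * w))) (riesz_mean - \<kappa> 4)"
proof -
  have AE: "AE x in sphere_prob. 0 \<le> \<kappa> ((norm (x - e))\<^sup>2) - \<kappa> 4"
    by (rule eventually_mono[OF eventually_conj[OF AE_sphere_prob AE_sphere_prob_neq[OF e]]])
        (use riesz_profile_ge[OF _ e] in auto)
  have int: "(\<integral>x. \<kappa> ((norm (x - e))\<^sup>2) - \<kappa> 4 \<partial>sphere_prob) = riesz_mean - \<kappa> 4"
    using integrable_riesz[OF e] integral_riesz[OF e] by simp
  have "(\<integral>\<^sup>+x. ennreal (\<kappa> ((norm (x - e))\<^sup>2) - \<kappa> 4) \<partial>sphere_prob) = ennreal (riesz_mean - \<kappa> 4)"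
    unfolding int[symmetric] using integrable_riesz[OF e] AE by (intro nn_integral_eq_integral) auto
  moreover have "0 \<le> riesz_mean - \<kappa> 4"
    unfolding int[symmetric] using AE by (rule integral_nonneg_AE)
  ultimately show ?thesis
    using gauss_weight_mean_nonneg by (intro has_bochner_integral_nn_integral) (auto simp: nn_integral_riesz_zonal)
qed

end

section \<open>Lower bounds for the Riesz energy\<close>

lemma sum_pairs_split:
  fixes f :: "'i \<Rightarrow> 'i \<Rightarrow> real"
  assumes A: "finite A" "i \<in> A" and sym: "\<And>a b. f a b = f b a"
  shows "(\<Sum>a\<in>A. \<Sum>b\<in>A - {a}. f a b) =
    2 * (\<Sum>b\<in>A - {i}. f i b) + (\<Sum>a\<in>A - {i}. \<Sum>b\<in>A - {i} - {a}. f a b)"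
proof -
  have "(\<Sum>a\<in>A. \<Sum>b\<in>A - {a}. f a b) = (\<Sum>b\<in>A - {i}. f i b) + (\<Sum>a\<in>A - {i}. \<Sum>b\<in>A - {a}. f a b)"
    using A by (rule sum.remove)
  also have "(\<Sum>a\<in>A - {i}. \<Sum>b\<in>A - {a}. f a b) = (\<Sum>a\<in>A - {i}. f i a + (\<Sum>b\<in>A - {i} - {a}. f a b))"
  proof (rule sum.cong)
    fix a assume a: "a \<in> A - {i}"
    have "(\<Sum>b\<in>A - {a}. f a b) = f a i + (\<Sum>b\<in>A - {a} - {i}. f a b)"
      using A a by (intro sum.remove) auto
    then show "(\<Sum>b\<in>A - {a}. f a b) = f i a + (\<Sum>b\<in>A - {i} - {a}. f a b)"
      by (simp add: sym[of a i] Diff_insert[symmetric] insert_commute)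
  qed simp
  also have "\<dots> = (\<Sum>a\<in>A - {i}. f i a) + (\<Sum>a\<in>A - {i}. \<Sum>b\<in>A - {i} - {a}. f a b)"
    by (rule sum.distrib)
  finally show ?thesis by simp
qed

context sphere_riesz
begin

definition riesz_energy :: "nat set \<Rightarrow> (nat \<Rightarrow> 'a) \<Rightarrow> real" where
  "riesz_energy A x = (\<Sum>i\<in>A. \<Sum>j\<in>A - {i}. \<kappa> ((norm (x i - x j))\<^sup>2))"

text \<open>The diagonal, absent from \<open>riesz_energy\<close>, is included here: positive
  definiteness holds for the full double sum, and the diagonal alone gives the lower bound
  \<open>card A\<close>.\<close>

definition gauss_energy :: "nat set \<Rightarrow> (nat \<Rightarrow> 'a) \<Rightarrow> real \<Rightarrow> real" where
  "gauss_energy A x w = (\<Sum>i\<in>A. \<Sum>j\<in>A. exp (- w * (norm (x i - x j))\<^sup>2))"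

text \<open>Coinciding points are allowed only for \<open>s < 0\<close>: otherwise \<open>\<kappa> 0\<close> is a junk value.\<close>

definition admissible :: "nat set \<Rightarrow> (nat \<Rightarrow> 'a) \<Rightarrow> bool" where
  "admissible A x \<longleftrightarrow> finite A \<and> A \<noteq> {} \<and> (\<forall>i\<in>A. norm (x i) = 1) \<and> (s < 0 \<or> inj_on x A)"

lemma gauss_energy_ge_card: "finite A \<Longrightarrow> real (card A) \<le> gauss_energy A x w"
proof -
  assume A: "finite A"
  have "real (card A) = (\<Sum>i\<in>A. exp (- w * (norm (x i - x i))\<^sup>2))" by simp
  also have "\<dots> \<le> gauss_energy A x w"
    unfolding gauss_energy_def
    by (intro sum_mono member_le_sum[where f="\<lambda>j. exp (- w * (norm (x _ - x j))\<^sup>2)"]) (use A in auto)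
  finally show ?thesis .
qed

text \<open>The representation is summed over the \<open>n * (n - 1)\<close> ordered pairs, whereas
  \<open>n\<^sup>2\<close> copies of the mean are subtracted. The mismatch leaves
  \<open>n * \<kappa> 4\<close> on the right and, after the diagonal is restored in
  \<open>gauss_energy\<close>, the correction \<open>n * (1 - exp (- 4 * w))\<close> under the
  integral.\<close>

lemma has_bochner_integral_riesz_energy:
  assumes "admissible A x"
  defines "n \<equiv> real (card A)"
  shows "has_bochner_integral lborel
    (\<lambda>w. gauss_weight w * (gauss_energy A x w - n\<^sup>2 * gauss_mean w - n * (1 - exp (- 4 * w))))
    (riesz_energy A x - n\<^sup>2 * riesz_mean + n * \<kappa> 4)"
proof -
  have A: "finite A" and x: "\<And>i. i \<in> A \<Longrightarrow> norm (x i) = 1" and inj: "s < 0 \<or> inj_on x A"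
    using assms(1) by (auto simp: admissible_def)
  have "has_bochner_integral lborel
      (\<lambda>w. (\<Sum>i\<in>A. \<Sum>j\<in>A - {i}. gauss_weight w * (exp (- (norm (x i - x j))\<^sup>2 * w) - exp (- 4 * w)))
        - n\<^sup>2 * (gauss_weight w * (gauss_mean w - exp (- 4 * w))))
      ((\<Sum>i\<in>A. \<Sum>j\<in>A - {i}. \<kappa> ((norm (x i - x j))\<^sup>2) - \<kappa> 4) - n\<^sup>2 * (riesz_mean - \<kappa> 4))"
  proof (intro has_bochner_integral_diff has_bochner_integral_sum has_bochner_integral_mult_right
      has_bochner_integral_gauss_weight_mean has_bochner_integral_gauss_weight)
    fix i j assume ij: "i \<in> A" "j \<in> A - {i}"
    show "(norm (x i - x j))\<^sup>2 \<le> 4" using ij x by (intro norm_diff_sphere_le) auto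
    show "s < 0" if "(norm (x i - x j))\<^sup>2 = 0"
      using that ij inj by (auto dest: inj_onD)
  qed auto
  also have "(\<lambda>w. (\<Sum>i\<in>A. \<Sum>j\<in>A - {i}. gauss_weight w * (exp (- (norm (x i - x j))\<^sup>2 * w) - exp (- 4 * w)))
        - n\<^sup>2 * (gauss_weight w * (gauss_mean w - exp (- 4 * w)))) =
      (\<lambda>w. gauss_weight w * (gauss_energy A x w - n\<^sup>2 * gauss_mean w - n * (1 - exp (- 4 * w))))"
  proof
    fix w
    have "(\<Sum>j\<in>A - {i}. exp (- (norm (x i - x j))\<^sup>2 * w) - exp (- 4 * w)) =
        (\<Sum>j\<in>A. exp (- w * (norm (x i - x j))\<^sup>2)) - 1 - (n - 1) * exp (- 4 * w)" if i: "i \<in> A" for i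
    proof -
      have "(\<Sum>j\<in>A. exp (- w * (norm (x i - x j))\<^sup>2)) = 1 + (\<Sum>j\<in>A - {i}. exp (- w * (norm (x i - x j))\<^sup>2))"
        using A i by (subst sum.remove) auto
      moreover have "real (card (A - {i})) = n - 1"
        using A i card_gt_0_iff[of A] by (subst card_Diff_singleton) (auto simp: n_def of_nat_diff)
      ultimately show ?thesis by (simp add: sum_subtractf mult.commute)
    qed
    then have e1: "(\<Sum>i\<in>A. \<Sum>j\<in>A - {i}. exp (- (norm (x i - x j))\<^sup>2 * w) - exp (- 4 * w)) =
        gauss_energy A x w - n - n * (n - 1) * exp (- 4 * w)"
      by (simp add: sum_subtractf gauss_energy_def n_def)
    show "(\<Sum>i\<in>A. \<Sum>j\<in>A - {i}. gauss_weight w * (exp (- (norm (x i - x j))\<^sup>2 * w) - exp (- 4 * w)))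
        - n\<^sup>2 * (gauss_weight w * (gauss_mean w - exp (- 4 * w))) =
       gauss_weight w * (gauss_energy A x w - n\<^sup>2 * gauss_mean w - n * (1 - exp (- 4 * w)))"
      unfolding sum_distrib_left[symmetric] e1 by (simp add: algebra_simps power2_eq_square)
  qed
  also have "(\<Sum>i\<in>A. \<Sum>j\<in>A - {i}. \<kappa> ((norm (x i - x j))\<^sup>2) - \<kappa> 4) - n\<^sup>2 * (riesz_mean - \<kappa> 4) =
      riesz_energy A x - n\<^sup>2 * riesz_mean + n * \<kappa> 4"
  proof -
    have "(\<Sum>i\<in>A. \<Sum>j\<in>A - {i}. \<kappa> 4) = n * ((n - 1) * \<kappa> 4)"
    proof -
      have "real (card (A - {i})) = n - 1" if "i \<in> A" for i
        using A that card_gt_0_iff[of A] by (subst card_Diff_singleton) (auto simp: n_def of_nat_diff)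
      then show ?thesis by (simp add: n_def)
    qed
    then show ?thesis
      by (simp add: sum_subtractf riesz_energy_def algebra_simps power2_eq_square)
  qed
  finally show ?thesis .
qed

lemma admissible_gauss_energy_ge:
  assumes "admissible A x" "w > 0"
  shows "(real (card A))\<^sup>2 * gauss_mean w \<le> gauss_energy A x w"
  using assms unfolding gauss_energy_def admissible_def by (intro gauss_energy_ge) auto

lemma has_bochner_integral_powr_to_0:
  fixes a c :: real
  assumes "a > -1" "c \<ge> 0"
  shows "has_bochner_integral lborel (\<lambda>x. indicator {0..c} x * x powr a) (c powr (a + 1) / (a + 1))"
  using nn_integral_powr_to_0[OF assms] assms by (intro has_bochner_integral_nn_integral) auto

lemma has_bochner_integral_powr_to_infinity:
  fixes a c :: real
  assumes "a < -1" "c > 0"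
  shows "has_bochner_integral lborel (\<lambda>x. indicator {c..} x * x powr a) (- (c powr (a + 1)) / (a + 1))"
  using nn_integral_powr_to_infinity[OF assms] assms
  by (intro has_bochner_integral_nn_integral divide_nonpos_neg) auto

text \<open>An antiderivative of \<open>w powr (s / 2 - 1)\<close> is, up to a constant factor, the
  profile with opposite exponent. This form includes the logarithm that appears for
  \<open>s = 0\<close>.\<close>

lemma has_bochner_integral_powr_middle:
  assumes "W \<ge> 1"
  shows "has_bochner_integral lborel (\<lambda>w. indicator {1..W} w * w powr (s / 2 - 1))
    ((riesz_profile (- s) 1 - riesz_profile (- s) W) / riesz_slope s)"
proof -
  have sl: "riesz_slope (- s) = riesz_slope s" by (simp add: riesz_slope_def)
  have "has_bochner_integral lborel (\<lambda>w. w powr (s / 2 - 1) * indicator {1..W} w)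
    (- riesz_profile (- s) W / riesz_slope s - (- riesz_profile (- s) 1 / riesz_slope s))"
  proof (rule has_bochner_integral_FTC_Icc_nonneg[where F="\<lambda>w. - riesz_profile (- s) w / riesz_slope s"])
    fix w assume w: "w \<in> {1..W}"
    show "((\<lambda>w. - riesz_profile (- s) w / riesz_slope s) has_real_derivative w powr (s / 2 - 1)) (at w)"
      using w riesz_slope_pos[of s] DERIV_riesz_profile[of w "- s"]
      by (auto intro!: derivative_eq_intros simp: sl)
  qed (use assms in auto)
  then show ?thesis by (simp add: mult.commute diff_divide_distrib)
qed

text \<open>The three error terms bound the negative part of the mixture on three ranges of
  \<open>w\<close>. Up to \<open>W\<close>, positive definiteness leaves only the diagonal
  correction, at most \<open>4 * n * w\<close> for \<open>w \<le> 1\<close> and at most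
  \<open>n\<close> up to \<open>W\<close>. Beyond \<open>W\<close> the diagonal part of the energy
  pays for that correction and the loss is at most \<open>n\<^sup>2 * gauss_mean w\<close>.\<close>

lemma energy_ge_nonneg_aux:
  assumes adm: "admissible A x" and W: "W \<ge> 1"
  defines "n \<equiv> real (card A)"
  shows "n\<^sup>2 * riesz_mean - n * \<kappa> 4 - 
      (4 * n * gauss_const / (s / 2 + 1)
        + n * gauss_const * ((riesz_profile (- s) 1 - riesz_profile (- s) W) / riesz_slope s)
        + n\<^sup>2 * gauss_const * gauss_mean_const * (W powr ((s - d) / 2) / ((d - s) / 2)))
    \<le> riesz_energy A x"
proof -
  note c = gauss_const_pos and C = gauss_mean_const_pos
  have A: "finite A" using adm by (simp add: admissible_def)
  have n: "n \<ge> 0" by (simp add: n_def)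
  let ?B = "\<lambda>w. gauss_weight w * (gauss_energy A x w - n\<^sup>2 * gauss_mean w - n * (1 - exp (- 4 * w)))"
  let ?l1 = "\<lambda>w::real. indicator {0..1} w * w powr (s / 2)"
  let ?l2 = "\<lambda>w::real. indicator {1..W} w * w powr (s / 2 - 1)"
  let ?l3 = "\<lambda>w::real. indicator {W..} w * w powr (s / 2 - 1 - d / 2)"
  let ?l = "\<lambda>w. (4 * n * gauss_const) * ?l1 w + (n * gauss_const) * ?l2 w + (n\<^sup>2 * gauss_const * gauss_mean_const) * ?l3 w"
  have B: "has_bochner_integral lborel ?B (riesz_energy A x - n\<^sup>2 * riesz_mean + n * \<kappa> 4)"
    unfolding n_def by (rule has_bochner_integral_riesz_energy[OF adm])
  have L: "has_bochner_integral lborel ?l ((4 * n * gauss_const) * (1 powr (s / 2 + 1) / (s / 2 + 1))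
      + (n * gauss_const) * ((riesz_profile (- s) 1 - riesz_profile (- s) W) / riesz_slope s)
      + (n\<^sup>2 * gauss_const * gauss_mean_const) * (- (W powr (s / 2 - 1 - d / 2 + 1)) / (s / 2 - 1 - d / 2 + 1)))"
    using s W
    by (intro has_bochner_integral_add has_bochner_integral_mult_right has_bochner_integral_powr_to_0
        has_bochner_integral_powr_middle has_bochner_integral_powr_to_infinity) auto
  have l0: "?l1 w \<ge> 0" "?l2 w \<ge> 0" "?l3 w \<ge> 0" for w by auto
  have "- ?l w \<le> ?B w" for w
  proof (cases "w > 0")
    case False
    then have "?B w = 0" by (simp add: gauss_weight_def)
    moreover have "0 \<le> ?l w" using l0[of w] n c C by (intro add_nonneg_nonneg mult_nonneg_nonneg) auto
    ultimately show ?thesis by linarith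
  next
    case w: True
    define g where "g = gauss_const * w powr (s / 2 - 1)"
    have g: "gauss_weight w = g" "g \<ge> 0" using w c by (auto simp: g_def gauss_weight_def)
    have G1: "n\<^sup>2 * gauss_mean w \<le> gauss_energy A x w"
      unfolding n_def by (rule admissible_gauss_energy_ge[OF adm w])
    have G2: "n \<le> gauss_energy A x w" unfolding n_def by (rule gauss_energy_ge_card[OF A])
    have t1: "4 * n * gauss_const * ?l1 w \<ge> 0" and t2: "n * gauss_const * ?l2 w \<ge> 0"
      and t3: "n\<^sup>2 * gauss_const * gauss_mean_const * ?l3 w \<ge> 0"
      using l0[of w] n c C by (auto intro!: mult_nonneg_nonneg)
    consider "w \<le> 1" | "1 < w" "w \<le> W" | "1 < w" "W < w" by linarith
    then have "- ?B w \<le> ?l w"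
    proof cases
      case 1
      have "1 - exp (- 4 * w) \<le> 4 * w" using exp_ge_add_one_self[of "- 4 * w"] by simp
      then have "n * (1 - exp (- 4 * w)) \<le> n * (4 * w)" using n by (rule mult_left_mono)
      then have "- (gauss_energy A x w - n\<^sup>2 * gauss_mean w - n * (1 - exp (- 4 * w))) \<le> n * (4 * w)"
        using G1 by linarith
      then have "g * - (gauss_energy A x w - n\<^sup>2 * gauss_mean w - n * (1 - exp (- 4 * w))) \<le> g * (n * (4 * w))"
        using g(2) by (rule mult_left_mono)
      also have "\<dots> = 4 * n * gauss_const * ?l1 w" using w 1 by (simp add: g_def powr_diff)
      finally show ?thesis using t2 t3 unfolding g(1) by linarith
    next
      case 2
      have "n * (1 - exp (- 4 * w)) \<le> n * 1" using n by (intro mult_left_mono) auto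
      then have "- (gauss_energy A x w - n\<^sup>2 * gauss_mean w - n * (1 - exp (- 4 * w))) \<le> n"
        using G1 by linarith
      then have "g * - (gauss_energy A x w - n\<^sup>2 * gauss_mean w - n * (1 - exp (- 4 * w))) \<le> g * n"
        using g(2) by (rule mult_left_mono)
      also have "\<dots> = n * gauss_const * ?l2 w" using 2 by (simp add: g_def)
      finally show ?thesis using t1 t3 unfolding g(1) by linarith
    next
      case 3
      have "n\<^sup>2 * gauss_mean w \<le> n\<^sup>2 * (gauss_mean_const * w powr (- real d / 2))"
        using gauss_mean_le[OF w] by (intro mult_left_mono) (simp_all add: gauss_mean_const_def)
      moreover have "0 \<le> n * exp (- 4 * w)" using n by simp
      ultimately have "- (gauss_energy A x w - n\<^sup>2 * gauss_mean w - n * (1 - exp (- 4 * w)))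
          \<le> n\<^sup>2 * (gauss_mean_const * w powr (- real d / 2))"
        using G2 by (simp add: algebra_simps)
      then have "g * - (gauss_energy A x w - n\<^sup>2 * gauss_mean w - n * (1 - exp (- 4 * w)))
          \<le> g * (n\<^sup>2 * (gauss_mean_const * w powr (- real d / 2)))"
        using g(2) by (rule mult_left_mono)
      also have "\<dots> = n\<^sup>2 * gauss_const * gauss_mean_const * ?l3 w"
      proof -
        have "w powr (s / 2 - 1 - d / 2) = w powr (s / 2 - 1) * w powr (- real d / 2)"
          by (simp flip: powr_add)
        then show ?thesis using 3 by (simp add: g_def)
      qed
      finally show ?thesis using t1 t2 unfolding g(1) by linarith
    qed
    then show ?thesis by linarith
  qed
  then have "(\<integral>w. - ?l w \<partial>lborel) \<le> (\<integral>w. ?B w \<partial>lborel)"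
    by (rule integral_mono[OF integrable_minus[OF integrable.intros[OF L]] integrable.intros[OF B]])
  then have "- (\<integral>w. ?l w \<partial>lborel) \<le> riesz_energy A x - n\<^sup>2 * riesz_mean + n * \<kappa> 4"
    unfolding has_bochner_integral_integral_eq[OF B] Bochner_Integration.integral_minus .
  moreover have e3: "- (W powr (s / 2 - 1 - d / 2 + 1)) / (s / 2 - 1 - d / 2 + 1) = W powr ((s - d) / 2) / ((d - s) / 2)"
  proof -
    have 1: "s / 2 - 1 - d / 2 + 1 = (s - d) / 2" by (simp add: field_simps)
    have 2: "(s - d) / 2 = - ((d - s) / 2)" by (simp add: field_simps)
    show ?thesis unfolding 1 by (subst (2) 2) (simp only: minus_divide_divide)
  qed
  ultimately show ?thesis
    unfolding has_bochner_integral_integral_eq[OF L] e3 by (simp only: times_divide_eq_right powr_one_eq_one mult_1_right)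
qed

text \<open>The cutoff is the value of \<open>W\<close> at which \<open>n\<close> and
  \<open>n\<^sup>2 * W powr (- d / 2)\<close> agree, that is, where the two lower bounds for the
  Gaussian energy exchange roles.\<close>

lemma card_scale:
  assumes "n \<ge> 1"
  defines "W \<equiv> n powr (2 / d)"
  shows "W \<ge> 1" "W powr (s / 2) = n powr (s / d)" "n\<^sup>2 * W powr ((s - d) / 2) = n * n powr (s / d)"
proof -
  have dr: "real d > 0" using d by simp
  show "W \<ge> 1" using assms dr by (simp add: W_def ge_one_powr_ge_zero)
  show "W powr (s / 2) = n powr (s / d)" by (simp add: W_def powr_powr)
  have "2 / real d * ((s - real d) / 2) = s / d - 1" using dr by (simp add: field_simps)
  then have "W powr ((s - d) / 2) = n powr (s / d - 1)" by (simp add: W_def powr_powr)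
  also have "\<dots> = n powr (s / d) / n" using assms by (simp add: powr_diff)
  finally show "n\<^sup>2 * W powr ((s - d) / 2) = n * n powr (s / d)"
    using assms by (simp add: power2_eq_square)
qed

lemma admissible_card: "admissible A x \<Longrightarrow> real (card A) \<ge> 1"
  by (simp add: admissible_def Suc_le_eq card_gt_0_iff)

lemma energy_ge_pos:
  assumes s0: "s > 0"
  obtains b where "b > 0" and "\<And>A x. admissible A x \<Longrightarrow>
      real (card A) * (real (card A) * riesz_mean - b * real (card A) powr (s / d)) \<le> riesz_energy A x"
proof
  define b1 where "b1 = 4 * gauss_const / (s / 2 + 1)"
  define b2 where "b2 = gauss_const * (2 / s)"
  define b3 where "b3 = gauss_const * gauss_mean_const / ((d - s) / 2)"
  have b: "b1 > 0" "b2 > 0" "b3 > 0" using s0 s gauss_const_pos gauss_mean_const_pos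
    by (auto simp: b1_def b2_def b3_def intro!: mult_pos_pos divide_pos_pos)
  then show "1 + b1 + b2 + b3 > 0" by simp
  fix A x assume adm: "admissible A x"
  define n where "n = real (card A)"
  have n: "n \<ge> 1" using admissible_card[OF adm] by (simp add: n_def)
  define W where "W = n powr (2 / d)"
  define N where "N = n powr (s / d)"
  note W = card_scale[OF n, folded W_def N_def]
  have N: "N \<ge> 1" using n s0 by (simp add: N_def ge_one_powr_ge_zero)
  \<comment> \<open>The antipodal term is absorbed by the summand 1 in the constant.\<close>
  have k4: "n * \<kappa> 4 \<le> n * N"
  proof -
    have "(4::real) powr (- s / 2) \<le> 1" using s0 powr_mono[of "- s / 2" 0 4] by simp
    then have "\<kappa> 4 \<le> N" using s0 N by (simp add: riesz_profile_def)
    then show ?thesis using n by simp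
  qed
  have t1: "4 * n * gauss_const / (s / 2 + 1) \<le> n * (b1 * N)"
  proof -
    have "n * b1 * 1 \<le> n * b1 * N" using n N b by (intro mult_left_mono) auto
    then show ?thesis by (simp add: b1_def mult_ac)
  qed
  have t2: "n * gauss_const * ((riesz_profile (- s) 1 - riesz_profile (- s) W) / riesz_slope s) \<le> n * (b2 * N)"
  proof -
    have "(riesz_profile (- s) 1 - riesz_profile (- s) W) / riesz_slope s = (N - 1) * (2 / s)"
      using s0 W(2) by (simp add: riesz_profile_def riesz_slope_def)
    also have "\<dots> \<le> N * (2 / s)" using s0 by (intro mult_right_mono) auto
    finally have "n * gauss_const * ((riesz_profile (- s) 1 - riesz_profile (- s) W) / riesz_slope s) \<le> n * gauss_const * (N * (2 / s))"
      using n gauss_const_pos by (intro mult_left_mono) auto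
    then show ?thesis by (simp add: b2_def mult_ac)
  qed
  have t3: "n\<^sup>2 * gauss_const * gauss_mean_const * (W powr ((s - d) / 2) / ((d - s) / 2)) = n * (b3 * N)"
  proof -
    have "n\<^sup>2 * gauss_const * gauss_mean_const * (W powr ((s - d) / 2) / ((d - s) / 2)) =
        (n\<^sup>2 * W powr ((s - d) / 2)) * b3" by (simp add: b3_def)
    then show ?thesis unfolding W(3) by simp
  qed
  have "n * (n * riesz_mean - (1 + b1 + b2 + b3) * N) = n\<^sup>2 * riesz_mean - n * N - (n * (b1 * N) + n * (b2 * N) + n * (b3 * N))"
    by (simp add: power2_eq_square algebra_simps)
  also have "\<dots> \<le> riesz_energy A x"
    using energy_ge_nonneg_aux[OF adm W(1), folded n_def] k4 t1 t2 unfolding t3 by linarith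
  finally show "real (card A) * (real (card A) * riesz_mean - (1 + b1 + b2 + b3) * real (card A) powr (s / d)) \<le> riesz_energy A x"
    by (simp add: n_def N_def)
qed

text \<open>The middle range is the integral of \<open>1 / w\<close> from 1 to
  \<open>W = n powr (2 / d)\<close>. With \<open>gauss_const = 1 / 2\<close> it contributes exactly
  \<open>n * ln n / d\<close>, whence the coefficient \<open>1 / d\<close> of the logarithm.\<close>

lemma energy_ge_zero:
  assumes s0: "s = 0"
  obtains b where "b > 0" and "\<And>A x. admissible A x \<Longrightarrow>
      real (card A) * (real (card A) * riesz_mean - ln (real (card A)) / d - b) \<le> riesz_energy A x"
proof
  define b3 where "b3 = gauss_const * gauss_mean_const / (d / 2)"
  have b3: "b3 > 0" using d gauss_const_pos gauss_mean_const_pos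
    by (auto simp: b3_def intro!: mult_pos_pos divide_pos_pos)
  then show "2 + b3 > 0" by simp
  have gc: "gauss_const = 1 / 2" unfolding gauss_const_def riesz_slope_def using s0 by simp
  fix A x assume adm: "admissible A x"
  define n where "n = real (card A)"
  have n: "n \<ge> 1" using admissible_card[OF adm] by (simp add: n_def)
  define W where "W = n powr (2 / d)"
  note W = card_scale[OF n, folded W_def]
  have k4: "n * \<kappa> 4 \<le> 0"
    using s0 n by (simp add: riesz_profile_def mult_nonneg_nonpos)
  have t2: "n * gauss_const * ((riesz_profile (- s) 1 - riesz_profile (- s) W) / riesz_slope s) = n * (ln n / d)"
    unfolding gc using s0 n by (simp add: riesz_profile_def riesz_slope_def W_def ln_powr)
  have t3: "n\<^sup>2 * gauss_const * gauss_mean_const * (W powr ((s - d) / 2) / ((d - s) / 2)) = n * b3"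
  proof -
    have "n\<^sup>2 * gauss_const * gauss_mean_const * (W powr ((s - d) / 2) / ((d - s) / 2)) =
        (n\<^sup>2 * W powr ((s - d) / 2)) * b3" using s0 by (simp add: b3_def)
    then show ?thesis unfolding W(3) using s0 n by simp
  qed
  have "n * (n * riesz_mean - ln n / d - (2 + b3)) = n\<^sup>2 * riesz_mean - (2 * n + n * (ln n / d) + n * b3)"
    by (simp add: power2_eq_square algebra_simps)
  also have "2 * n = 4 * n * gauss_const / (s / 2 + 1)" unfolding gc using s0 by simp
  also have "n\<^sup>2 * riesz_mean - (4 * n * gauss_const / (s / 2 + 1) + n * (ln n / d) + n * b3) \<le> riesz_energy A x"
    using energy_ge_nonneg_aux[OF adm W(1), folded n_def] k4 unfolding t2 t3 by linarith
  finally show "real (card A) * (real (card A) * riesz_mean - ln (real (card A)) / d - (2 + b3)) \<le> riesz_energy A x"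
    by (simp add: n_def)
qed

text \<open>For \<open>s < 0\<close> a gain over the mean is wanted, not a bounded loss. The
  Gaussian deficit is nonnegative for all \<open>w\<close>, so only the range
  \<open>w \<ge> W\<close> is kept, where half of the diagonal survives; there the weight is
  integrable because \<open>s < 0\<close>.\<close>

lemma energy_ge_neg:
  assumes s0: "s < 0"
  obtains b where "b > 0" and "\<And>A x. admissible A x \<Longrightarrow>
      real (card A) * (real (card A) * riesz_mean + b * real (card A) powr (s / d)) \<le> riesz_energy A x"
proof
  note c = gauss_const_pos and C = gauss_mean_const_pos
  define b where "b = gauss_const / (- s) * (2 * gauss_mean_const) powr (s / d)"
  show "b > 0" unfolding b_def using s0 c C by (intro mult_pos_pos divide_pos_pos) auto
  fix A x assume adm: "admissible A x"
  define n where "n = real (card A)"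
  have n: "n \<ge> 1" using admissible_card[OF adm] by (simp add: n_def)
  have A: "finite A" using adm by (simp add: admissible_def)
  have dr: "real d > 0" using d by simp
  \<comment> \<open>Beyond this threshold \<open>n\<^sup>2 * gauss_mean w\<close> is at most
    \<open>n / 2\<close>, half of the diagonal bound.\<close>
  define W where "W = (2 * n * gauss_mean_const) powr (2 / d)"
  have W0: "W > 0" using n C by (simp add: W_def)
  have Wd: "W powr (- real d / 2) = 1 / (2 * n * gauss_mean_const)"
    using n C dr by (simp add: W_def powr_powr powr_minus_divide)
  have Ws: "W powr (s / 2) = (2 * gauss_mean_const) powr (s / d) * n powr (s / d)"
    using n C by (simp add: W_def powr_powr powr_mult[symmetric] mult_ac)
  let ?B = "\<lambda>w. gauss_weight w * (gauss_energy A x w - n\<^sup>2 * gauss_mean w)"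
  \<comment> \<open>Adding \<open>n\<close> copies of the representation at distance 0 cancels the
    correction \<open>n * (1 - exp (- 4 * w))\<close>. Since \<open>\<kappa> 0 = 0\<close>, it also
    cancels \<open>n * \<kappa> 4\<close>.\<close>
  have "has_bochner_integral lborel
      (\<lambda>w. gauss_weight w * (gauss_energy A x w - n\<^sup>2 * gauss_mean w - n * (1 - exp (- 4 * w)))
        + n * (gauss_weight w * (exp (- 0 * w) - exp (- 4 * w))))
      (riesz_energy A x - n\<^sup>2 * riesz_mean + n * \<kappa> 4 + n * (\<kappa> 0 - \<kappa> 4))"
    unfolding n_def using s0
    by (intro has_bochner_integral_add has_bochner_integral_mult_right has_bochner_integral_riesz_energy[OF adm]
        has_bochner_integral_gauss_weight) auto
  then have B: "has_bochner_integral lborel ?B (riesz_energy A x - n\<^sup>2 * riesz_mean)"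
    using s0 by (simp add: riesz_profile_def algebra_simps)
  let ?l = "\<lambda>w. gauss_const * n / 2 * (indicator {W..} w * w powr (s / 2 - 1))"
  have L: "has_bochner_integral lborel ?l (gauss_const * n / 2 * (- (W powr (s / 2 - 1 + 1)) / (s / 2 - 1 + 1)))"
    using s0 W0 by (intro has_bochner_integral_mult_right has_bochner_integral_powr_to_infinity) auto
  have "?l w \<le> ?B w" for w
  proof (cases "w > 0")
    case w: True
    have G1: "n\<^sup>2 * gauss_mean w \<le> gauss_energy A x w"
      unfolding n_def by (rule admissible_gauss_energy_ge[OF adm w])
    have G2: "n \<le> gauss_energy A x w" unfolding n_def by (rule gauss_energy_ge_card[OF A])
    show ?thesis
    proof (cases "W \<le> w")
      case True
      have "gauss_mean w \<le> gauss_mean_const * w powr (- real d / 2)"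
        using gauss_mean_le[OF w] by (simp add: gauss_mean_const_def)
      also have "\<dots> \<le> gauss_mean_const * W powr (- real d / 2)"
        using True W0 C dr by (intro mult_left_mono powr_mono2') auto
      also have "\<dots> = 1 / (2 * n)" using C n unfolding Wd by simp
      finally have "n\<^sup>2 * gauss_mean w \<le> n\<^sup>2 * (1 / (2 * n))" by (intro mult_left_mono) auto
      also have "\<dots> = n / 2" using n by (simp add: power2_eq_square)
      finally have "n / 2 \<le> gauss_energy A x w - n\<^sup>2 * gauss_mean w" using G2 by linarith
      then have "gauss_weight w * (n / 2) \<le> ?B w" by (rule mult_left_mono[OF _ gauss_weight_nonneg])
      then show ?thesis using True w by (simp add: gauss_weight_def mult_ac)
    next
      case False
      then show ?thesis using G1 gauss_weight_nonneg[of w] by simp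
    qed
  next
    case False
    then show ?thesis using W0 by (simp add: gauss_weight_def)
  qed
  then have "(\<integral>w. ?l w \<partial>lborel) \<le> (\<integral>w. ?B w \<partial>lborel)"
    by (rule integral_mono[OF integrable.intros[OF L] integrable.intros[OF B]])
  then have "gauss_const * n / 2 * (- (W powr (s / 2 - 1 + 1)) / (s / 2 - 1 + 1)) \<le> riesz_energy A x - n\<^sup>2 * riesz_mean"
    unfolding has_bochner_integral_integral_eq[OF B] has_bochner_integral_integral_eq[OF L] .
  moreover have "gauss_const * n / 2 * (- (W powr (s / 2 - 1 + 1)) / (s / 2 - 1 + 1)) = n * (b * n powr (s / d))"
  proof -
    have "s / 2 - 1 + 1 = s / 2" by simp
    then show ?thesis using s0 by (simp only: Ws b_def) (simp add: field_simps)
  qed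
  ultimately show "real (card A) * (real (card A) * riesz_mean + b * real (card A) powr (s / d)) \<le> riesz_energy A x"
    unfolding n_def[symmetric] by (simp add: power2_eq_square algebra_simps)
qed

end

section \<open>Lower bounds for the polarization\<close>

context sphere_riesz
begin

text \<open>Points are null sets of a probability measure, so finitely many cannot exhaust the
  sphere. Distinct points are needed to have any admissible configuration when
  \<open>s \<ge> 0\<close>.\<close>

lemma infinite_sphere: "infinite (sphere (0::'a) 1)"
proof
  assume fin: "finite (sphere (0::'a) 1)"
  have "AE x in sphere_prob. \<forall>p\<in>sphere (0::'a) 1. x \<noteq> p"
    using AE_sphere_prob_neq by (intro AE_finite_allI[OF fin]) auto
  then have "AE x in (sphere_prob :: 'a measure). False"
    using AE_sphere_prob by eventually_elim auto
  then show False
    by (subst (asm) AE_iff_measurable[of UNIV]) auto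
qed

lemma riesz_energy_split:
  assumes "finite A" "i \<in> A"
  shows "riesz_energy A x = 2 * (\<Sum>j\<in>A - {i}. \<kappa> ((norm (x i - x j))\<^sup>2)) + riesz_energy (A - {i}) x"
  unfolding riesz_energy_def using assms
  by (intro sum_pairs_split[where f="\<lambda>i j. \<kappa> ((norm (x i - x j))\<^sup>2)"]) (auto simp: norm_minus_commute)

text \<open>Removing a suitable point from an almost minimal configuration of \<open>N + 1\<close> points: since moving
  the point cannot decrease the energy by much, it almost minimizes the potential of the others.\<close>

lemma max_polarization_ge:
  assumes L: "\<And>x. admissible {0..N} x \<Longrightarrow> real (N + 1) * L \<le> riesz_energy {0..N} x"
  shows "ereal L \<le> max_polarization (riesz_kernel s :: 'a \<Rightarrow> 'a \<Rightarrow> ereal) N"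
proof (rule ereal_le_epsilon2)
  fix \<epsilon> :: real assume \<epsilon>: "\<epsilon> > 0"
  define E where "E = riesz_energy {0..N} ` Collect (admissible {0..N})"
  obtain x0 :: "nat \<Rightarrow> 'a" where x0: "inj x0" "range x0 \<subseteq> sphere 0 1"
    using infinite_countable_subset[OF infinite_sphere] by auto
  have "x0 j \<in> sphere 0 1" for j using x0(2) by blast
  then have "admissible {0..N} x0" using x0(1) by (auto simp: admissible_def intro: inj_on_subset)
  then have ne: "E \<noteq> {}" by (auto simp: E_def)
  have bdd: "bdd_below E" using L by (auto simp: E_def intro!: bdd_belowI2)
  \<comment> \<open>An almost minimal configuration suffices, so no compactness argument is
    required. The factor 2 matches \<open>riesz_energy\<close>, in which each pair counts twice:
    moving a point changes the energy by twice the change of its potential.\<close>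
  have "Inf E < Inf E + 2 * \<epsilon>" using \<epsilon> by simp
  from cInf_lessD[OF ne this] obtain y where y: "admissible {0..N} y" "riesz_energy {0..N} y < Inf E + 2 * \<epsilon>"
    by (auto simp: E_def)
  let ?k = "\<lambda>a b::'a. \<kappa> ((norm (a - b))\<^sup>2)"
  \<comment> \<open>The potentials of the points at one another sum to the energy, so some point
    sees at least the average.\<close>
  obtain i where i: "i \<in> {0..N}" "L \<le> (\<Sum>j\<in>{0..N} - {i}. ?k (y i) (y j))"
  proof (rule ccontr)
    assume "\<not> thesis"
    then have "\<And>i. i \<in> {0..N} \<Longrightarrow> (\<Sum>j\<in>{0..N} - {i}. ?k (y i) (y j)) < L" using that by force
    then have "riesz_energy {0..N} y < (\<Sum>i\<in>{0..N}. L)"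
      unfolding riesz_energy_def by (intro sum_strict_mono) auto
    with L[OF y(1)] show False by simp
  qed
  let ?A = "{0..N} - {i}"
  have "card {1..N} = card ?A" using i(1) by simp
  then obtain f where f: "bij_betw f {1..N} ?A" using finite_same_card_bij by blast
  define \<omega> where "\<omega> = y \<circ> f"
  have \<omega>: "\<omega> \<in> {1..N} \<rightarrow> sphere 0 1"
    using y(1) f by (auto simp: \<omega>_def admissible_def dest: bij_betwE)
  have "ereal (L - \<epsilon>) \<le> polarization (riesz_kernel s) N \<omega>"
    unfolding polarization_def
  proof (rule INF_greatest)
    fix x :: 'a assume "x \<in> sphere 0 1"
    then have x: "norm x = 1" by simp
    have "(\<Sum>j=1..N. riesz_kernel s x (\<omega> j)) = (\<Sum>j\<in>?A. riesz_kernel s x (y j))"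
      unfolding \<omega>_def o_def by (rule sum.reindex_bij_betw[OF f])
    also have "ereal (L - \<epsilon>) \<le> \<dots>"
    \<comment> \<open>Either the kernel is infinite at \<open>x\<close> and nothing is to be shown,
      or replacing \<open>y i\<close> by \<open>x\<close> keeps the configuration admissible and its
      energy can be compared with the infimum.\<close>
    proof (cases "s \<ge> 0 \<and> x \<in> y ` ?A")
      case True
      then obtain j where j: "j \<in> ?A" "x = y j" "s \<ge> 0" by blast
      have "(\<Sum>j\<in>?A. riesz_kernel s x (y j)) = \<infinity>"
        using j by (subst sum_Pinfty) (auto simp: riesz_kernel_eq)
      then show ?thesis by simp
    next
      case False
      then have k: "(\<Sum>j\<in>?A. riesz_kernel s x (y j)) = ereal (\<Sum>j\<in>?A. ?k x (y j))"
        by (subst sum_ereal[symmetric]) (rule sum.cong, auto simp: riesz_kernel_eq)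
      define z where "z = y(i := x)"
      have zA: "z j = y j" if "j \<in> ?A" for j using that by (simp add: z_def)
      have "admissible {0..N} z"
        using y(1) x False by (auto simp: admissible_def z_def inj_on_def)
      then have "Inf E \<le> riesz_energy {0..N} z"
        by (intro cInf_lower[OF _ bdd]) (auto simp: E_def)
      also have "riesz_energy {0..N} z = 2 * (\<Sum>j\<in>?A. ?k x (y j)) + riesz_energy ?A y"
        using riesz_energy_split[OF _ i(1), of z] zA by (simp add: riesz_energy_def z_def)
      finally have "Inf E \<le> 2 * (\<Sum>j\<in>?A. ?k x (y j)) + riesz_energy ?A y" .
      moreover have "riesz_energy {0..N} y = 2 * (\<Sum>j\<in>?A. ?k (y i) (y j)) + riesz_energy ?A y"
        by (rule riesz_energy_split[OF _ i(1)]) simp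
      ultimately have "L - \<epsilon> \<le> (\<Sum>j\<in>?A. ?k x (y j))" using y(2) i(2) by linarith
      then show ?thesis unfolding k by simp
    qed
    finally show "ereal (L - \<epsilon>) \<le> (\<Sum>j=1..N. riesz_kernel s x (\<omega> j))" .
  qed
  also have "\<dots> \<le> max_polarization (riesz_kernel s :: 'a \<Rightarrow> 'a \<Rightarrow> ereal) N"
    unfolding max_polarization_def using \<omega> by (rule SUP_upper)
  finally have "ereal (L - \<epsilon>) + ereal \<epsilon> \<le> max_polarization (riesz_kernel s :: 'a \<Rightarrow> 'a \<Rightarrow> ereal) N + ereal \<epsilon>"
    by (rule add_right_mono)
  then show "ereal L \<le> max_polarization (riesz_kernel s :: 'a \<Rightarrow> 'a \<Rightarrow> ereal) N + ereal \<epsilon>" by simp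
qed

lemma riesz_mean_nonneg: assumes "s > 0" shows "riesz_mean \<ge> 0"
  unfolding riesz_mean_def zonal_mean_def using assms
  by (intro integral_nonneg_AE) (simp add: riesz_profile_def)

lemma max_polarization_ge_pos:
  assumes s0: "s > 0"
  obtains b where "b > 0" and "\<And>N. N \<ge> 1 \<Longrightarrow>
    ereal (riesz_mean * real N - b * real N powr (s / d)) \<le> max_polarization (riesz_kernel s :: 'a \<Rightarrow> 'a \<Rightarrow> ereal) N"
proof -
  obtain b where b: "b > 0" "\<And>A x. admissible A x \<Longrightarrow>
      real (card A) * (real (card A) * riesz_mean - b * real (card A) powr (s / d)) \<le> riesz_energy A x"
    using energy_ge_pos[OF s0] by metis
  show thesis
  proof
    show "b * 2 powr (s / d) > 0" using b by simp
    fix N :: nat assume N: "N \<ge> 1"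
    let ?L = "real (N + 1) * riesz_mean - b * real (N + 1) powr (s / d)"
    have "real (N + 1) powr (s / d) \<le> (2 * real N) powr (s / d)"
      using N s0 by (intro powr_mono2) auto
    also have "\<dots> = 2 powr (s / d) * real N powr (s / d)" by (simp add: powr_mult)
    finally have "b * real (N + 1) powr (s / d) \<le> b * (2 powr (s / d) * real N powr (s / d))"
      using b by (intro mult_left_mono) auto
    then have "riesz_mean * real N - b * 2 powr (s / d) * real N powr (s / d) \<le> ?L"
      using riesz_mean_nonneg[OF s0] by (simp add: algebra_simps)
    also have "ereal ?L \<le> max_polarization (riesz_kernel s :: 'a \<Rightarrow> 'a \<Rightarrow> ereal) N"
      using b(2)[of "{0..N}"] by (intro max_polarization_ge) simp
    finally show "ereal (riesz_mean * real N - b * 2 powr (s / d) * real N powr (s / d)) \<le>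
        max_polarization (riesz_kernel s :: 'a \<Rightarrow> 'a \<Rightarrow> ereal) N" by simp
  qed
qed

text \<open>The additional summand \<open>riesz_mean\<close> comes from the energy bound having
  \<open>N + 1\<close> points while the polarization has \<open>N\<close>. As \<open>s < 0\<close>,
  passing from \<open>N + 1\<close> to \<open>2 * N\<close> decreases the power, and the factor
  \<open>2 powr (s / d)\<close> goes into the constant.\<close>

lemma max_polarization_ge_neg:
  assumes s0: "s < 0"
  obtains b where "b > 0" and "\<And>N. N \<ge> 1 \<Longrightarrow>
    ereal (riesz_mean * real N + (riesz_mean + b * real N powr (s / d))) \<le> max_polarization (riesz_kernel s :: 'a \<Rightarrow> 'a \<Rightarrow> ereal) N"
proof -
  obtain b where b: "b > 0" "\<And>A x. admissible A x \<Longrightarrow>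
      real (card A) * (real (card A) * riesz_mean + b * real (card A) powr (s / d)) \<le> riesz_energy A x"
    using energy_ge_neg[OF s0] by metis
  show thesis
  proof
    show "b * 2 powr (s / d) > 0" using b by simp
    fix N :: nat assume N: "N \<ge> 1"
    let ?L = "real (N + 1) * riesz_mean + b * real (N + 1) powr (s / d)"
    have "2 powr (s / d) * real N powr (s / d) = (2 * real N) powr (s / d)" by (simp add: powr_mult)
    also have "\<dots> \<le> real (N + 1) powr (s / d)"
      using N s0 d by (intro powr_mono2') (auto intro: divide_nonpos_pos)
    finally have "b * (2 powr (s / d) * real N powr (s / d)) \<le> b * real (N + 1) powr (s / d)"
      using b by (intro mult_left_mono) auto
    then have "riesz_mean * real N + (riesz_mean + b * 2 powr (s / d) * real N powr (s / d)) \<le> ?L"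
      by (simp add: algebra_simps)
    also have "ereal ?L \<le> max_polarization (riesz_kernel s :: 'a \<Rightarrow> 'a \<Rightarrow> ereal) N"
      using b(2)[of "{0..N}"] by (intro max_polarization_ge) simp
    finally show "ereal (riesz_mean * real N + (riesz_mean + b * 2 powr (s / d) * real N powr (s / d))) \<le>
        max_polarization (riesz_kernel s :: 'a \<Rightarrow> 'a \<Rightarrow> ereal) N" by simp
  qed
qed

lemma max_polarization_ge_zero:
  assumes s0: "s = 0"
  obtains b where "b > 0" and "\<And>N. N \<ge> 1 \<Longrightarrow>
    ereal (riesz_mean * real N - (ln (real N) / d + b)) \<le> max_polarization (riesz_kernel s :: 'a \<Rightarrow> 'a \<Rightarrow> ereal) N"
proof -
  obtain b where b: "b > 0" "\<And>A x. admissible A x \<Longrightarrow>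
      real (card A) * (real (card A) * riesz_mean - ln (real (card A)) / d - b) \<le> riesz_energy A x"
    using energy_ge_zero[OF s0] by metis
  show thesis
  proof
    show "b + \<bar>riesz_mean\<bar> + ln 2 / d > 0" using b by (simp add: add_pos_nonneg)
    fix N :: nat assume N: "N \<ge> 1"
    let ?L = "real (N + 1) * riesz_mean - ln (real (N + 1)) / d - b"
    have "ln (real (N + 1)) \<le> ln (2 * real N)" using N by simp
    also have "\<dots> = ln 2 + ln (real N)" using N by (simp add: ln_mult)
    finally have "ln (real (N + 1)) / d \<le> (ln 2 + ln (real N)) / d" by (rule divide_right_mono) simp
    then have "riesz_mean * real N - (ln (real N) / d + (b + \<bar>riesz_mean\<bar> + ln 2 / d)) \<le> ?L"
      by (simp add: algebra_simps add_divide_distrib)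
    also have "ereal ?L \<le> max_polarization (riesz_kernel s :: 'a \<Rightarrow> 'a \<Rightarrow> ereal) N"
      using b(2)[of "{0..N}"] by (intro max_polarization_ge) simp
    finally show "ereal (riesz_mean * real N - (ln (real N) / d + (b + \<bar>riesz_mean\<bar> + ln 2 / d))) \<le>
        max_polarization (riesz_kernel s :: 'a \<Rightarrow> 'a \<Rightarrow> ereal) N" by simp
  qed
qed

lemma continuous_energy_riesz:
  "continuous_energy (riesz_kernel s :: 'a \<Rightarrow> 'a \<Rightarrow> ereal) = riesz_mean"
proof -
  have "continuous_energy (riesz_kernel s :: 'a \<Rightarrow> 'a \<Rightarrow> ereal) =
      (\<integral>y. (\<integral>x. \<kappa> ((norm (x - y))\<^sup>2) \<partial>sphere_sigma) \<partial>(sphere_sigma :: 'a measure))"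
    unfolding continuous_energy_def real_of_ereal_riesz_kernel ..
  also have "\<dots> = (\<integral>y. (\<integral>x. \<kappa> ((norm (x - y))\<^sup>2) \<partial>sphere_prob) \<partial>(sphere_prob :: 'a measure))"
    by (subst (1 2) integral_sphere_sigma) auto
  also have "\<dots> = (\<integral>y. riesz_mean \<partial>(sphere_prob :: 'a measure))"
    by (rule integral_cong_AE) (auto intro!: eventually_mono[OF AE_sphere_prob] integral_riesz)
  finally show ?thesis by simp
qed

end

section \<open>Explicit Riesz potentials\<close>

text \<open>The differences are backward in sign, \<open>f t - f (t + h)\<close>, so that those of
  the Riesz profile are positive for every order at least 1.\<close>

fun iterated_diff :: "nat \<Rightarrow> real \<Rightarrow> (real \<Rightarrow> real) \<Rightarrow> real \<Rightarrow> real" where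
  "iterated_diff 0 h f t = f t"
| "iterated_diff (Suc k) h f t = iterated_diff k h (\<lambda>t. f t - f (t + h)) t"

lemma iterated_diff_mean_value:
  assumes h: "h > 0" and F: "\<And>n t. t \<ge> t0 \<Longrightarrow> (F n has_real_derivative F (Suc n) t) (at t)"
  shows "\<exists>\<xi>. t0 \<le> \<xi> \<and> \<xi> \<le> t0 + k * h \<and> iterated_diff k h (F 0) t0 = (- h) ^ k * F k \<xi>"
  using F
proof (induction k arbitrary: F)
  case 0
  then show ?case by auto
next
  case (Suc k)
  define G where "G n t = F n t - F n (t + h)" for n t
  have "(G n has_real_derivative G (Suc n) t) (at t)" if "t \<ge> t0" for n t
  proof -
    have "((\<lambda>t. F n (t + h)) has_real_derivative F (Suc n) (t + h)) (at t)"
      using Suc.prems[of "t + h" n] h that by (simp add: DERIV_shift)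
    with Suc.prems[OF that] show ?thesis unfolding G_def by (rule DERIV_diff)
  qed
  from Suc.IH[of G, OF this] obtain \<xi> where \<xi>: "t0 \<le> \<xi>" "\<xi> \<le> t0 + k * h"
      "iterated_diff k h (G 0) t0 = (- h) ^ k * G k \<xi>"
    by auto
  obtain \<eta> where \<eta>: "\<xi> < \<eta>" "\<eta> < \<xi> + h" "F k (\<xi> + h) - F k \<xi> = (\<xi> + h - \<xi>) * F (Suc k) \<eta>"
    using MVT2[of \<xi> "\<xi> + h" "F k" "F (Suc k)"] h Suc.prems \<xi>(1) by (metis less_add_same_cancel1 order_trans)
  have "G k \<xi> = - h * F (Suc k) \<eta>" using \<eta>(3) by (simp add: G_def)
  then have "iterated_diff (Suc k) h (F 0) t0 = (- h) ^ Suc k * F (Suc k) \<eta>"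
    using \<xi>(3) by (simp add: G_def[abs_def])
  moreover have "t0 \<le> \<eta>" "\<eta> \<le> t0 + Suc k * h" using \<xi> \<eta> by (auto simp: algebra_simps)
  ultimately show ?case by blast
qed

context sphere_riesz
begin

text \<open>For \<open>k \<ge> 1\<close> the derivative of order \<open>k\<close> of the profile is
  \<open>(-1) ^ k\<close> times this constant times \<open>v powr (- (s / 2 + k))\<close>. The
  product starts at 1 and its factors are positive because \<open>s > - 2\<close>, even where the
  profile itself changes sign.\<close>

definition riesz_deriv_const :: "nat \<Rightarrow> real" where
  "riesz_deriv_const k = riesz_slope s * (\<Prod>i\<in>{1..<k}. s / 2 + real i)"

lemma riesz_deriv_const_pos: "riesz_deriv_const k > 0"
  unfolding riesz_deriv_const_def using riesz_slope_pos s
  by (intro mult_pos_pos prod_pos) (auto simp: field_simps)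

lemma iterated_diff_riesz:
  assumes h: "h > 0" and u: "u \<ge> 0" and k: "k \<ge> 1"
  obtains \<xi> where "h + u \<le> \<xi>" "\<xi> \<le> (k + 1) * h + u"
    "iterated_diff k h (\<lambda>t. \<kappa> (t + u)) h = h ^ k * riesz_deriv_const k * \<xi> powr (- (s / 2 + k))"
proof -
  define F where "F n t = (if n = 0 then \<kappa> (t + u)
      else (-1) ^ n * riesz_deriv_const n * (t + u) powr (- (s / 2 + n)))" for n t
  have "(F n has_real_derivative F (Suc n) t) (at t)" if t: "t \<ge> h" for n t
  proof -
    have tu: "t + u > 0" using t h u by simp
    show ?thesis
    proof (cases "n = 0")
      case True
      have "((\<lambda>t. \<kappa> (t + u)) has_real_derivative - (riesz_slope s * (t + u) powr (- s / 2 - 1))) (at t)"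
        using DERIV_riesz_profile[OF tu, of s] by (simp add: DERIV_shift)
      then show ?thesis using True by (simp add: F_def[abs_def] riesz_deriv_const_def)
    next
      case False
      have "riesz_deriv_const (Suc n) = riesz_deriv_const n * (s / 2 + n)"
        using False by (simp add: riesz_deriv_const_def)
      moreover have "- (s / 2 + n) - 1 = - (s / 2 + Suc n)" by simp
      ultimately have "F (Suc n) t = (-1) ^ n * riesz_deriv_const n * (- (s / 2 + n) * (t + u) powr (- (s / 2 + n) - 1))"
        by (simp only: F_def) (simp add: algebra_simps)
      moreover have "F n = (\<lambda>t. (-1) ^ n * riesz_deriv_const n * (t + u) powr (- (s / 2 + n)))"
        using False by (simp add: F_def fun_eq_iff)
      moreover have "((\<lambda>t. (-1) ^ n * riesz_deriv_const n * (t + u) powr (- (s / 2 + n))) has_real_derivative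
          (-1) ^ n * riesz_deriv_const n * (- (s / 2 + n) * (t + u) powr (- (s / 2 + n) - 1))) (at t)"
        using tu by (auto intro!: derivative_eq_intros)
      ultimately show ?thesis by (simp only:)
    qed
  qed
  from iterated_diff_mean_value[where F=F and ?t0.0=h and k=k, OF h this] obtain \<xi> where \<xi>: "h \<le> \<xi>" "\<xi> \<le> h + k * h"
    "iterated_diff k h (F 0) h = (- h) ^ k * F k \<xi>" by blast
  have "(- h) ^ k * (- 1) ^ k = h ^ k" by (simp add: power_mult_distrib[symmetric])
  then have "(- h) ^ k * F k \<xi> = h ^ k * riesz_deriv_const k * (\<xi> + u) powr (- (s / 2 + k))"
    using k by (simp add: F_def)
  moreover have "F 0 = (\<lambda>t. \<kappa> (t + u))" by (simp add: F_def fun_eq_iff)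
  ultimately show thesis using that[of "\<xi> + u"] \<xi> by (simp add: algebra_simps)
qed

text \<open>For \<open>s \<noteq> 0\<close> this is the energy integral of \<open>norm (x - y) powr (- s)\<close>.\<close>

definition riesz_norm :: real where
  "riesz_norm = (if s = 0 then 1 else sgn s * riesz_mean)"

lemma riesz_norm_pos: "riesz_norm > 0"
proof -
  consider "s = 0" | "s > 0" | "s < 0" by linarith
  then show ?thesis
  proof cases
    case 2
    have "\<kappa> 4 > 0" using 2 by (simp add: riesz_profile_def)
    moreover have "0 \<le> riesz_mean - \<kappa> 4"
      using has_bochner_integral_integral_eq[OF has_bochner_integral_gauss_weight_mean]
        gauss_weight_mean_nonneg by (metis (no_types, lifting) integral_nonneg_AE AE_I2)
    ultimately show ?thesis using 2 by (simp add: riesz_norm_def)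
  next
    case 3
    obtain b where b: "b > 0" "\<And>A x. admissible A x \<Longrightarrow>
      real (card A) * (real (card A) * riesz_mean + b * real (card A) powr (s / d)) \<le> riesz_energy A x"
      using energy_ge_neg[OF 3] by metis
    \<comment> \<open>A single point has energy 0, so the lower bound for it reads
      \<open>riesz_mean + b \<le> 0\<close>.\<close>
    have "admissible {0} (\<lambda>_. e)" using e by (simp add: admissible_def)
    from b(2)[OF this] b(1) 3 show ?thesis by (simp add: riesz_energy_def riesz_norm_def)
  next
    case 1
    then show ?thesis unfolding riesz_norm_def by simp
  qed
qed

text \<open>A power of the conformal factor, chosen so that conformal covariance of the kernel makes the
  Riesz potential explicit.\<close>

definition conf_density :: "real \<Rightarrow> real \<Rightarrow> real" where
  "conf_density \<tau> u = sqrt (\<tau> * (\<tau> + 4)) powr (d - s) * (\<tau> + u) powr (s / 2 - d) / riesz_norm"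

lemma conf_density_measurable [measurable]: "conf_density \<tau> \<in> borel_measurable borel"
  unfolding conf_density_def[abs_def] by measurable

lemma conf_density_nonneg: "conf_density \<tau> u \<ge> 0"
  using riesz_norm_pos by (simp add: conf_density_def)

text \<open>The potential of the uniform measure at the image of \<open>x\<close> under the
  conformal map is still \<open>riesz_mean\<close>; pulling the integration variable back as well
  expresses this constant through distances before the map.\<close>

lemma conformal_change:
  assumes \<tau>: "\<tau> > 0" and p: "norm (p::'a) = 1" and x: "norm (x::'a) = 1"
  defines "D \<equiv> sqrt (\<tau> * (\<tau> + 4))"
  defines "v \<equiv> \<lambda>y. \<tau> + (norm (y - p))\<^sup>2"
  shows "integrable sphere_prob (\<lambda>y. (D / v y) ^ d * \<kappa> ((norm (x - y))\<^sup>2 * D\<^sup>2 / (v x * v y)))"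
    and "(\<integral>y. (D / v y) ^ d * \<kappa> ((norm (x - y))\<^sup>2 * D\<^sup>2 / (v x * v y)) \<partial>sphere_prob) = riesz_mean"
    and "(\<integral>y. (D / v y) ^ d \<partial>sphere_prob) = 1"
proof -
  have "\<exists>T::'a \<Rightarrow> 'a. T \<in> borel_measurable borel \<and> (\<forall>x. norm x = 1 \<longrightarrow> norm (T x) = 1) \<and>
    (\<forall>x y. norm x = 1 \<longrightarrow> norm y = 1 \<longrightarrow> (norm (T x - T y))\<^sup>2 = (norm (x - y))\<^sup>2 * (\<tau> * (\<tau> + 4)) /
        ((\<tau> + (norm (x - p))\<^sup>2) * (\<tau> + (norm (y - p))\<^sup>2))) \<and>
    distr (density sphere_prob (\<lambda>x. ennreal ((sqrt (\<tau> * (\<tau> + 4)) / (\<tau> + (norm (x - p))\<^sup>2)) ^ d))) borel T = sphere_prob"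
    by (rule sphere_conformal_map[OF dim d \<tau> p]) blast
  then obtain T :: "'a \<Rightarrow> 'a" where T: "T \<in> borel_measurable borel" "\<And>x. norm x = 1 \<Longrightarrow> norm (T x) = 1"
    "\<And>x y. norm x = 1 \<Longrightarrow> norm y = 1 \<Longrightarrow> (norm (T x - T y))\<^sup>2 = (norm (x - y))\<^sup>2 * (\<tau> * (\<tau> + 4)) /
        ((\<tau> + (norm (x - p))\<^sup>2) * (\<tau> + (norm (y - p))\<^sup>2))"
    "distr (density sphere_prob (\<lambda>x. ennreal ((sqrt (\<tau> * (\<tau> + 4)) / (\<tau> + (norm (x - p))\<^sup>2)) ^ d))) borel T = sphere_prob"
    by blast
  note [measurable] = T(1)
  have D2: "D\<^sup>2 = \<tau> * (\<tau> + 4)" using \<tau> by (simp add: D_def)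
  have D0: "D \<ge> 0" using \<tau> by (simp add: D_def)
  have v0: "v y > 0" for y using \<tau> by (simp add: v_def add_pos_nonneg)
  have [measurable]: "v \<in> borel_measurable borel" unfolding v_def by measurable
  have w0: "AE y in sphere_prob. 0 \<le> (D / v y) ^ d" using D0 v0 by (intro AE_I2 zero_le_power divide_nonneg_pos)
  have eq: "distr (density sphere_prob (\<lambda>y. ennreal ((D / v y) ^ d))) borel T = sphere_prob"
    using T(4) unfolding D_def v_def .
  have cong: "AE y in sphere_prob. (D / v y) ^ d * \<kappa> ((norm (T y - T x))\<^sup>2) =
      (D / v y) ^ d * \<kappa> ((norm (x - y))\<^sup>2 * D\<^sup>2 / (v x * v y))"
    by (rule eventually_mono[OF AE_sphere_prob]) (simp add: T(3) x D2 v_def norm_minus_commute mult.commute)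
  have 1: "integrable sphere_prob (\<lambda>y. (D / v y) ^ d * \<kappa> ((norm (T y - T x))\<^sup>2))"
  proof -
    have "integrable (distr (density sphere_prob (\<lambda>y. ennreal ((D / v y) ^ d))) borel T) (\<lambda>z. \<kappa> ((norm (z - T x))\<^sup>2))"
      unfolding eq by (rule integrable_riesz[OF T(2)[OF x]])
    then show ?thesis
      by (subst (asm) integrable_distr_eq) (use w0 in \<open>auto simp: integrable_density\<close>)
  qed
  then show "integrable sphere_prob (\<lambda>y. (D / v y) ^ d * \<kappa> ((norm (x - y))\<^sup>2 * D\<^sup>2 / (v x * v y)))"
    by (rule integrable_cong_AE_imp) (use cong in \<open>auto elim!: eventually_mono\<close>)
  have "riesz_mean = (\<integral>z. \<kappa> ((norm (z - T x))\<^sup>2) \<partial>distr (density sphere_prob (\<lambda>y. ennreal ((D / v y) ^ d))) borel T)"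
    unfolding eq by (rule integral_riesz[OF T(2)[OF x], symmetric])
  also have "\<dots> = (\<integral>y. (D / v y) ^ d * \<kappa> ((norm (T y - T x))\<^sup>2) \<partial>sphere_prob)"
    by (subst integral_distr, measurable, subst integral_density) (use w0 in auto)
  also have "\<dots> = (\<integral>y. (D / v y) ^ d * \<kappa> ((norm (x - y))\<^sup>2 * D\<^sup>2 / (v x * v y)) \<partial>sphere_prob)"
    by (rule integral_cong_AE[OF _ _ cong]) measurable
  finally show "(\<integral>y. (D / v y) ^ d * \<kappa> ((norm (x - y))\<^sup>2 * D\<^sup>2 / (v x * v y)) \<partial>sphere_prob) = riesz_mean" ..
  have "1 = (\<integral>z. (1::real) \<partial>(sphere_prob :: 'a measure))" by simp
  also have "\<dots> = (\<integral>z. (1::real) \<partial>distr (density sphere_prob (\<lambda>y. ennreal ((D / v y) ^ d))) borel T)"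
    unfolding eq ..
  also have "\<dots> = (\<integral>y. (D / v y) ^ d * 1 \<partial>sphere_prob)"
    by (subst integral_distr, measurable, subst integral_density) (use w0 in auto)
  finally show "(\<integral>y. (D / v y) ^ d \<partial>sphere_prob) = 1" by simp
qed

text \<open>A power kernel is homogeneous, so the conformal factors split off: the one at
  \<open>y\<close> combines with the Jacobian into \<open>conf_density\<close>, the one at
  \<open>x\<close> becomes the explicit potential. For the logarithm the factors split off
  additively, and the terms independent of \<open>x\<close> form the constant
  \<open>c\<close>.\<close>

lemma conf_density_potential:
  assumes \<tau>: "\<tau> > 0" and p: "norm (p::'a) = 1"
  obtains c where "\<And>x::'a. norm x = 1 \<Longrightarrow>
     (\<integral>y. \<kappa> ((norm (x - y))\<^sup>2) * conf_density \<tau> ((norm (y - p))\<^sup>2) \<partial>sphere_prob) = \<kappa> (\<tau> + (norm (x - p))\<^sup>2) + c"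
    and "s \<noteq> 0 \<Longrightarrow> c = 0"
proof -
  define D where "D = sqrt (\<tau> * (\<tau> + 4))"
  define v where "v y = \<tau> + (norm (y - p))\<^sup>2" for y :: 'a
  have D: "D > 0" using \<tau> by (simp add: D_def)
  have v0: "v y > 0" for y using \<tau> by (simp add: v_def add_pos_nonneg)
  note change = conformal_change[OF \<tau> p, folded D_def v_def]
  show thesis
  proof (cases "s = 0")
    case False
    show thesis
    proof (rule that[of 0])
      fix x :: 'a assume x: "norm x = 1"
      have "(D / v y) ^ d * \<kappa> ((norm (x - y))\<^sup>2 * D\<^sup>2 / (v x * v y)) =
          riesz_norm * v x powr (s / 2) * (\<kappa> ((norm (x - y))\<^sup>2) * conf_density \<tau> ((norm (y - p))\<^sup>2))" for y
      proof -
        have "((norm (x - y))\<^sup>2 * D\<^sup>2 / (v x * v y)) powr (- s / 2) =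
            ((norm (x - y))\<^sup>2) powr (- s / 2) * (D\<^sup>2) powr (- s / 2) / (v x powr (- s / 2) * v y powr (- s / 2))"
          using v0[of x] v0[of y] by (simp add: powr_mult powr_divide)
        also have "(D\<^sup>2) powr (- s / 2) = D powr (- s)" using D by (simp add: powr_powr flip: powr_numeral)
        also have "((norm (x - y))\<^sup>2) powr (- s / 2) * D powr (- s) / (v x powr (- s / 2) * v y powr (- s / 2)) =
            ((norm (x - y))\<^sup>2) powr (- s / 2) * D powr (- s) * v x powr (s / 2) * v y powr (s / 2)"
          by (simp add: powr_minus_divide)
        finally have 1: "((norm (x - y))\<^sup>2 * D\<^sup>2 / (v x * v y)) powr (- s / 2) = \<dots>" .
        have 2: "(D / v y) ^ d = D powr d * v y powr (- real d)"
          using D v0[of y] by (simp add: power_divide powr_minus_divide powr_realpow)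
        have "D powr d * D powr (- s) = D powr (d - s)" by (simp flip: powr_add)
        moreover have "v y powr (- real d) * v y powr (s / 2) = v y powr (s / 2 - d)" by (simp flip: powr_add)
        moreover have "(D powr d * v y powr (- real d)) * (sgn s * (X * D powr (- s) * v x powr (s / 2) * v y powr (s / 2))) =
            v x powr (s / 2) * (sgn s * X * ((D powr d * D powr (- s)) * (v y powr (- real d) * v y powr (s / 2))))" for X
          by (simp only: mult_ac)
        ultimately have 3: "(D powr d * v y powr (- real d)) * (sgn s * (X * D powr (- s) * v x powr (s / 2) * v y powr (s / 2))) =
            v x powr (s / 2) * (sgn s * X * (D powr (d - s) * v y powr (s / 2 - d)))" for X
          by (simp only:)
        have k: "\<kappa> z = sgn s * z powr (- s / 2)" for z using False by (simp add: riesz_profile_def)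
        show ?thesis unfolding k 1 2 3 conf_density_def D_def[symmetric] v_def[symmetric]
          using riesz_norm_pos by simp
      qed
      then have "riesz_norm * v x powr (s / 2) *
          (\<integral>y. \<kappa> ((norm (x - y))\<^sup>2) * conf_density \<tau> ((norm (y - p))\<^sup>2) \<partial>sphere_prob) = riesz_mean"
        using change(2)[OF x] by simp
      moreover have "riesz_mean = sgn s * riesz_norm" using False by (auto simp: riesz_norm_def sgn_if)
      ultimately have "v x powr (s / 2) *
          (\<integral>y. \<kappa> ((norm (x - y))\<^sup>2) * conf_density \<tau> ((norm (y - p))\<^sup>2) \<partial>sphere_prob) = sgn s"
        using riesz_norm_pos by (simp add: mult_ac)
      then have "(\<integral>y. \<kappa> ((norm (x - y))\<^sup>2) * conf_density \<tau> ((norm (y - p))\<^sup>2) \<partial>sphere_prob) = sgn s / v x powr (s / 2)"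
        using v0[of x] by (simp add: field_simps)
      also have "\<dots> = \<kappa> (v x)" using False by (simp add: riesz_profile_def powr_minus_divide)
      finally show "(\<integral>y. \<kappa> ((norm (x - y))\<^sup>2) * conf_density \<tau> ((norm (y - p))\<^sup>2) \<partial>sphere_prob) = \<kappa> (\<tau> + (norm (x - p))\<^sup>2) + 0"
        by (simp add: v_def)
    qed simp
  next
    case True
    have dens: "conf_density \<tau> ((norm (y - p))\<^sup>2) = (D / v y) ^ d" for y
      unfolding conf_density_def riesz_norm_def D_def[symmetric] v_def[symmetric]
      using True D v0[of y] by (simp add: power_divide powr_minus_divide powr_realpow)
    have vbd: "\<bar>ln (v y)\<bar> \<le> \<bar>ln \<tau>\<bar> + \<bar>ln (\<tau> + 4)\<bar>" if "norm y = 1" for y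
    proof -
      have "ln \<tau> \<le> ln (v y)" "ln (v y) \<le> ln (\<tau> + 4)"
        using \<tau> norm_diff_sphere_le[OF that p] v0[of y] by (auto simp: v_def)
      then show ?thesis by linarith
    qed
    have i1: "integrable sphere_prob (\<lambda>y. (D / v y) ^ d)"
      using change(3)[OF e] not_integrable_integral_eq[of sphere_prob "\<lambda>y. (D / v y) ^ d"] by fastforce
    have [measurable]: "v \<in> borel_measurable borel" unfolding v_def by measurable
    have i2: "integrable sphere_prob (\<lambda>y. (D / v y) ^ d * ln (v y))"
    proof (rule Bochner_Integration.integrable_bound[OF integrable_mult_right[OF i1, of "\<bar>ln \<tau>\<bar> + \<bar>ln (\<tau> + 4)\<bar>"]])
      show "AE y in sphere_prob. norm ((D / v y) ^ d * ln (v y)) \<le> norm ((\<bar>ln \<tau>\<bar> + \<bar>ln (\<tau> + 4)\<bar>) * (D / v y) ^ d)"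
        by (rule eventually_mono[OF AE_sphere_prob])
           (use vbd in \<open>auto simp: abs_mult mult.commute[of _ "\<bar>(D / v _) ^ d\<bar>"] intro!: mult_left_mono\<close>)
    qed measurable
    define c where "c = riesz_mean + ln D - (\<integral>y. (D / v y) ^ d * ln (v y) \<partial>sphere_prob) / 2"
    show thesis
    proof (rule that[of c])
      fix x :: 'a assume x: "norm x = 1"
      have "(\<integral>y. \<kappa> ((norm (x - y))\<^sup>2) * conf_density \<tau> ((norm (y - p))\<^sup>2) \<partial>sphere_prob) =
        (\<integral>y. (D / v y) ^ d * \<kappa> ((norm (x - y))\<^sup>2 * D\<^sup>2 / (v x * v y)) + (ln D - ln (v x) / 2) * (D / v y) ^ d
          - (D / v y) ^ d * ln (v y) / 2 \<partial>sphere_prob)"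
      proof (rule integral_cong_AE)
        show "AE y in sphere_prob. \<kappa> ((norm (x - y))\<^sup>2) * conf_density \<tau> ((norm (y - p))\<^sup>2) =
          (D / v y) ^ d * \<kappa> ((norm (x - y))\<^sup>2 * D\<^sup>2 / (v x * v y)) + (ln D - ln (v x) / 2) * (D / v y) ^ d
          - (D / v y) ^ d * ln (v y) / 2"
        \<comment> \<open>The point \<open>y = x\<close> is discarded since the product rule for
          \<open>ln\<close> fails at the default value \<open>ln 0\<close>.\<close>
        proof (rule eventually_mono[OF AE_sphere_prob_neq[OF x]])
          fix y assume "y \<noteq> x"
          then have l: "ln ((norm (x - y))\<^sup>2 * D\<^sup>2 / (v x * v y)) = ln ((norm (x - y))\<^sup>2) + 2 * ln D - ln (v x) - ln (v y)"
            using D v0[of x] v0[of y] by (simp add: ln_mult ln_div ln_realpow)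
          have k: "\<kappa> z = - ln z / 2" for z using True by (simp add: riesz_profile_def)
          have gen: "(- L / 2) * m = m * (- (L + 2 * a - b - c) / 2) + (a - b / 2) * m - m * c / 2"
            for L m a b c :: real by (simp add: field_simps)
          show "\<kappa> ((norm (x - y))\<^sup>2) * conf_density \<tau> ((norm (y - p))\<^sup>2) =
          (D / v y) ^ d * \<kappa> ((norm (x - y))\<^sup>2 * D\<^sup>2 / (v x * v y)) + (ln D - ln (v x) / 2) * (D / v y) ^ d
          - (D / v y) ^ d * ln (v y) / 2"
            unfolding dens k l by (rule gen)
        qed
      qed measurable
      also have "\<dots> = riesz_mean + (ln D - ln (v x) / 2) * 1 - (\<integral>y. (D / v y) ^ d * ln (v y) \<partial>sphere_prob) / 2"
        using change(1)[OF x] change(2)[OF x] change(3)[OF x] i1 i2 by simp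
      also have "\<dots> = \<kappa> (v x) + c" using True by (simp add: c_def riesz_profile_def)
      finally show "(\<integral>y. \<kappa> ((norm (x - y))\<^sup>2) * conf_density \<tau> ((norm (y - p))\<^sup>2) \<partial>sphere_prob) = \<kappa> (\<tau> + (norm (x - p))\<^sup>2) + c"
        by (simp add: v_def)
    qed (use True in simp)
  qed
qed

end

section \<open>Test functions\<close>

context sphere_riesz
begin

lemma pair_sigma_finite_sphere_prob: "pair_sigma_finite (sphere_prob :: 'a measure) (sphere_prob :: 'a measure)"
  by (simp add: pair_sigma_finite_def sphere_prob.sigma_finite_measure_axioms)

lemma integrable_sphere_pair:
  fixes q :: "'a \<Rightarrow> 'a \<Rightarrow> real"
  assumes [measurable]: "case_prod q \<in> borel_measurable (borel \<Otimes>\<^sub>M borel)"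
    and int: "\<And>x. norm x = 1 \<Longrightarrow> integrable sphere_prob (q x)"
    and bound: "\<And>x. norm x = 1 \<Longrightarrow> (\<integral>y. \<bar>q x y\<bar> \<partial>sphere_prob) \<le> A"
  shows "integrable (sphere_prob \<Otimes>\<^sub>M sphere_prob) (case_prod q)"
proof (rule pair_sigma_finite.Fubini_integrable[OF pair_sigma_finite_sphere_prob])
  show "integrable sphere_prob (\<lambda>x. \<integral>y. norm (case_prod q (x, y)) \<partial>sphere_prob)"
  proof (rule sphere_prob.integrable_const_bound[where B=A])
    show "AE x in sphere_prob. norm (\<integral>y. norm (case_prod q (x, y)) \<partial>sphere_prob) \<le> A"
      by (rule eventually_mono[OF AE_sphere_prob]) (use bound in \<open>simp add: abs_of_nonneg\<close>)
  qed measurable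
  show "AE x in sphere_prob. integrable sphere_prob (\<lambda>y. case_prod q (x, y))"
    by (rule eventually_mono[OF AE_sphere_prob]) (use int in simp)
qed measurable

lemma integral_sphere_swap:
  fixes q :: "'a \<Rightarrow> 'a \<Rightarrow> real"
  assumes "case_prod q \<in> borel_measurable (borel \<Otimes>\<^sub>M borel)"
    and "\<And>x. norm x = 1 \<Longrightarrow> integrable sphere_prob (q x)"
    and "\<And>x. norm x = 1 \<Longrightarrow> (\<integral>y. \<bar>q x y\<bar> \<partial>sphere_prob) \<le> A"
  shows "(\<integral>y. (\<integral>x. q x y \<partial>sphere_prob) \<partial>sphere_prob) = (\<integral>x. (\<integral>y. q x y \<partial>sphere_prob) \<partial>sphere_prob)"
  by (rule pair_sigma_finite.Fubini_integral[OF pair_sigma_finite_sphere_prob integrable_sphere_pair[OF assms]])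

lemma integral_sphere_mono:
  fixes f g :: "'a \<Rightarrow> real"
  assumes "integrable sphere_prob f" "integrable sphere_prob g" "\<And>x. norm x = 1 \<Longrightarrow> f x \<le> g x"
  shows "(\<integral>x. f x \<partial>sphere_prob) \<le> (\<integral>x. g x \<partial>sphere_prob)"
  using assms(1,2) by (rule integral_mono_AE) (rule eventually_mono[OF AE_sphere_prob assms(3)])

lemma integral_sphere_cong:
  fixes f g :: "'a \<Rightarrow> real"
  assumes "f \<in> borel_measurable borel" "g \<in> borel_measurable borel" "\<And>x. norm x = 1 \<Longrightarrow> f x = g x"
  shows "(\<integral>x. f x \<partial>sphere_prob) = (\<integral>x. g x \<partial>sphere_prob)"
  using assms(1,2) by (intro integral_cong_AE eventually_mono[OF AE_sphere_prob assms(3)]) auto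

lemma norm_diff_sphere_mem:
  "norm (x::'a) = 1 \<Longrightarrow> norm y = 1 \<Longrightarrow> (norm (x - y))\<^sup>2 \<in> {0..4}"
  using norm_diff_sphere_le[of x y] by simp

lemma integrable_zonal_bounded:
  fixes h :: "real \<Rightarrow> real" and B :: real
  assumes [measurable]: "h \<in> borel_measurable borel" and B: "\<And>u. u \<in> {0..4} \<Longrightarrow> \<bar>h u\<bar> \<le> B"
    and p: "norm (p::'a) = 1"
  shows "integrable sphere_prob (\<lambda>x. h ((norm (x - p))\<^sup>2))"
proof (rule sphere_prob.integrable_const_bound[where B=B])
  show "AE x in sphere_prob. norm (h ((norm (x - p))\<^sup>2)) \<le> B"
    by (rule eventually_mono[OF AE_sphere_prob]) (use B norm_diff_sphere_mem[OF _ p] in simp)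
qed measurable

lemma integrable_riesz_mult:
  fixes h :: "real \<Rightarrow> real" and B :: real
  assumes [measurable]: "h \<in> borel_measurable borel" and B: "\<And>u. u \<in> {0..4} \<Longrightarrow> \<bar>h u\<bar> \<le> B"
    and p: "norm (p::'a) = 1" and x: "norm (x::'a) = 1"
  shows "integrable sphere_prob (\<lambda>y. \<kappa> ((norm (x - y))\<^sup>2) * h ((norm (y - p))\<^sup>2))"
    and "(\<integral>y. \<bar>\<kappa> ((norm (x - y))\<^sup>2) * h ((norm (y - p))\<^sup>2)\<bar> \<partial>sphere_prob) \<le> B * zonal_mean (\<lambda>u. \<bar>\<kappa> u\<bar>)"
proof -
  have B0: "B \<ge> 0" using B[of 0] by simp
  have k: "integrable sphere_prob (\<lambda>y. \<kappa> ((norm (x - y))\<^sup>2))"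
    using integrable_riesz[OF x] by (simp add: norm_minus_commute)
  have le: "\<bar>\<kappa> ((norm (x - y))\<^sup>2) * h ((norm (y - p))\<^sup>2)\<bar> \<le> B * \<bar>\<kappa> ((norm (x - y))\<^sup>2)\<bar>" if "norm y = 1" for y
    using B[OF norm_diff_sphere_mem[OF that p]] by (simp add: abs_mult mult.commute[of B] mult_left_mono)
  show i: "integrable sphere_prob (\<lambda>y. \<kappa> ((norm (x - y))\<^sup>2) * h ((norm (y - p))\<^sup>2))"
  proof (rule Bochner_Integration.integrable_bound[OF integrable_mult_right[OF k, of B]])
    show "AE y in sphere_prob. norm (\<kappa> ((norm (x - y))\<^sup>2) * h ((norm (y - p))\<^sup>2)) \<le> norm (B * \<kappa> ((norm (x - y))\<^sup>2))"
      by (rule eventually_mono[OF AE_sphere_prob]) (use le B0 in \<open>simp add: abs_mult\<close>)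
  qed measurable
  have "(\<integral>y. \<bar>\<kappa> ((norm (x - y))\<^sup>2) * h ((norm (y - p))\<^sup>2)\<bar> \<partial>sphere_prob) \<le> (\<integral>y. B * \<bar>\<kappa> ((norm (x - y))\<^sup>2)\<bar> \<partial>sphere_prob)"
    using i k le by (intro integral_sphere_mono integrable_abs integrable_mult_right) auto
  also have "\<dots> = B * zonal_mean (\<lambda>u. \<bar>\<kappa> u\<bar>)"
    using integral_zonal[of "\<lambda>u. \<bar>\<kappa> u\<bar>" x] x by (simp add: norm_minus_commute)
  finally show "(\<integral>y. \<bar>\<kappa> ((norm (x - y))\<^sup>2) * h ((norm (y - p))\<^sup>2)\<bar> \<partial>sphere_prob) \<le> B * zonal_mean (\<lambda>u. \<bar>\<kappa> u\<bar>)" .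
qed

text \<open>Zonal functions \<open>g\<close> and \<open>\<phi>\<close> such that \<open>\<phi>\<close> is, up to a constant, the Riesz potential of \<open>g\<close>,
  with \<open>C\<close> bounding the \<open>L\<^sup>1\<close> norm of \<open>g\<close>. The constant is forced by integrating over the sphere.\<close>

definition test_pair :: "real \<Rightarrow> (real \<Rightarrow> real) \<Rightarrow> (real \<Rightarrow> real) \<Rightarrow> bool" where
  "test_pair C g \<phi> \<longleftrightarrow> g \<in> borel_measurable borel \<and> \<phi> \<in> borel_measurable borel \<and>
    (\<exists>B. \<forall>u\<in>{0..4}. \<bar>g u\<bar> \<le> B \<and> \<bar>\<phi> u\<bar> \<le> B) \<and> zonal_mean (\<lambda>u. \<bar>g u\<bar>) \<le> C \<and>
    (\<forall>p x. norm p = 1 \<longrightarrow> norm x = 1 \<longrightarrow>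
      (\<integral>y. \<kappa> ((norm (x - y))\<^sup>2) * g ((norm (y - p))\<^sup>2) \<partial>(sphere_prob :: 'a measure)) =
        \<phi> ((norm (x - p))\<^sup>2) - zonal_mean \<phi> + riesz_mean * zonal_mean g)"

lemma test_pair_potential:
  assumes "test_pair C g \<phi>" "norm (p::'a) = 1" "norm (x::'a) = 1"
  shows "(\<integral>y. \<kappa> ((norm (x - y))\<^sup>2) * g ((norm (y - p))\<^sup>2) \<partial>sphere_prob) =
    \<phi> ((norm (x - p))\<^sup>2) - zonal_mean \<phi> + riesz_mean * zonal_mean g"
  using assms unfolding test_pair_def by blast

lemma test_pair_combine:
  assumes "test_pair C g \<phi>" "test_pair C' g' \<phi>'"
  shows "test_pair (C + \<bar>a\<bar> * C') (\<lambda>u. g u + a * g' u) (\<lambda>u. \<phi> u + a * \<phi>' u)"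
proof -
  obtain B where B: "\<And>u. u \<in> {0..4} \<Longrightarrow> \<bar>g u\<bar> \<le> B" "\<And>u. u \<in> {0..4} \<Longrightarrow> \<bar>\<phi> u\<bar> \<le> B"
    using assms(1) unfolding test_pair_def by blast
  obtain B' where B': "\<And>u. u \<in> {0..4} \<Longrightarrow> \<bar>g' u\<bar> \<le> B'" "\<And>u. u \<in> {0..4} \<Longrightarrow> \<bar>\<phi>' u\<bar> \<le> B'"
    using assms(2) unfolding test_pair_def by blast
  have [measurable]: "g \<in> borel_measurable borel" "\<phi> \<in> borel_measurable borel"
    "g' \<in> borel_measurable borel" "\<phi>' \<in> borel_measurable borel"
    using assms by (auto simp: test_pair_def)
  have int: "integrable sphere_prob (\<lambda>x. g ((norm (x - e))\<^sup>2))"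
    "integrable sphere_prob (\<lambda>x. \<phi> ((norm (x - e))\<^sup>2))"
    "integrable sphere_prob (\<lambda>x. g' ((norm (x - e))\<^sup>2))"
    "integrable sphere_prob (\<lambda>x. \<phi>' ((norm (x - e))\<^sup>2))"
    by (rule integrable_zonal_bounded[OF _ B(1) e] integrable_zonal_bounded[OF _ B(2) e]
      integrable_zonal_bounded[OF _ B'(1) e] integrable_zonal_bounded[OF _ B'(2) e]; simp)+
  have zg: "zonal_mean (\<lambda>u. g u + a * g' u) = zonal_mean g + a * zonal_mean g'"
    unfolding zonal_mean_def using int by simp
  have z\<phi>: "zonal_mean (\<lambda>u. \<phi> u + a * \<phi>' u) = zonal_mean \<phi> + a * zonal_mean \<phi>'"
    unfolding zonal_mean_def using int by simp
  have "zonal_mean (\<lambda>u. \<bar>g u + a * g' u\<bar>) \<le> zonal_mean (\<lambda>u. \<bar>g u\<bar> + \<bar>a\<bar> * \<bar>g' u\<bar>)"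
    unfolding zonal_mean_def
  proof (rule integral_sphere_mono)
    fix x :: 'a
    show "\<bar>g ((norm (x - e))\<^sup>2) + a * g' ((norm (x - e))\<^sup>2)\<bar> \<le> \<bar>g ((norm (x - e))\<^sup>2)\<bar> + \<bar>a\<bar> * \<bar>g' ((norm (x - e))\<^sup>2)\<bar>"
      by (metis abs_mult abs_triangle_ineq)
  qed (use int in auto)
  also have "\<dots> = zonal_mean (\<lambda>u. \<bar>g u\<bar>) + \<bar>a\<bar> * zonal_mean (\<lambda>u. \<bar>g' u\<bar>)"
    unfolding zonal_mean_def using int by simp
  also have "\<dots> \<le> C + \<bar>a\<bar> * C'"
    using assms by (intro add_mono mult_left_mono) (auto simp: test_pair_def)
  finally have 1: "zonal_mean (\<lambda>u. \<bar>g u + a * g' u\<bar>) \<le> C + \<bar>a\<bar> * C'" .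
  have 2: "\<bar>g u + a * g' u\<bar> \<le> B + \<bar>a\<bar> * B' \<and> \<bar>\<phi> u + a * \<phi>' u\<bar> \<le> B + \<bar>a\<bar> * B'" if u: "u \<in> {0..4}" for u
  proof -
    have tri: "\<bar>b + a * c\<bar> \<le> B + \<bar>a\<bar> * B'" if "\<bar>b\<bar> \<le> B" "\<bar>c\<bar> \<le> B'" for b c
      using abs_triangle_ineq[of b "a * c"] that mult_left_mono[OF that(2), of "\<bar>a\<bar>"] by (simp add: abs_mult)
    show ?thesis using tri B[OF u] B'[OF u] by blast
  qed
  have 3: "(\<integral>y. \<kappa> ((norm (x - y))\<^sup>2) * (g ((norm (y - p))\<^sup>2) + a * g' ((norm (y - p))\<^sup>2)) \<partial>(sphere_prob :: 'a measure)) =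
        \<phi> ((norm (x - p))\<^sup>2) + a * \<phi>' ((norm (x - p))\<^sup>2) - (zonal_mean \<phi> + a * zonal_mean \<phi>')
        + riesz_mean * (zonal_mean g + a * zonal_mean g')" if p: "norm p = 1" and x: "norm x = 1" for p x
  proof -
    have "(\<integral>y. \<kappa> ((norm (x - y))\<^sup>2) * (g ((norm (y - p))\<^sup>2) + a * g' ((norm (y - p))\<^sup>2)) \<partial>(sphere_prob :: 'a measure)) =
      (\<integral>y. \<kappa> ((norm (x - y))\<^sup>2) * g ((norm (y - p))\<^sup>2) + a * (\<kappa> ((norm (x - y))\<^sup>2) * g' ((norm (y - p))\<^sup>2)) \<partial>sphere_prob)"
      by (rule Bochner_Integration.integral_cong) (simp_all add: algebra_simps)
    also have "\<dots> = (\<integral>y. \<kappa> ((norm (x - y))\<^sup>2) * g ((norm (y - p))\<^sup>2) \<partial>sphere_prob) +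
        a * (\<integral>y. \<kappa> ((norm (x - y))\<^sup>2) * g' ((norm (y - p))\<^sup>2) \<partial>sphere_prob)"
    proof -
      have "integrable sphere_prob (\<lambda>y. \<kappa> ((norm (x - y))\<^sup>2) * g ((norm (y - p))\<^sup>2))"
        "integrable sphere_prob (\<lambda>y. \<kappa> ((norm (x - y))\<^sup>2) * g' ((norm (y - p))\<^sup>2))"
        by (rule integrable_riesz_mult(1)[OF _ B(1) p x] integrable_riesz_mult(1)[OF _ B'(1) p x]; simp)+
      then show ?thesis by simp
    qed
    finally show ?thesis
      unfolding test_pair_potential[OF assms(1) p x] test_pair_potential[OF assms(2) p x]
      by (simp add: algebra_simps)
  qed
  show ?thesis
    unfolding test_pair_def zg z\<phi> using 1 2 3 by (intro conjI exI[of _ "B + \<bar>a\<bar> * B'"]) auto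
qed

text \<open>Potentials depend linearly on densities, and each difference at most doubles the norm
  bound. All parameters that occur lie between \<open>\<tau>\<close> and
  \<open>\<tau> + k * h\<close>.\<close>

lemma test_pair_iterated_diff:
  assumes "h > 0" and "\<And>t. \<tau> \<le> t \<Longrightarrow> t \<le> \<tau> + k * h \<Longrightarrow> test_pair C (G t) (F t)"
  shows "test_pair (2 ^ k * C) (\<lambda>u. iterated_diff k h (\<lambda>t. G t u) \<tau>) (\<lambda>u. iterated_diff k h (\<lambda>t. F t u) \<tau>)"
  using assms(2)
proof (induction k arbitrary: C G F)
  case 0
  then show ?case by simp
next
  case (Suc k)
  have "test_pair (2 * C) (\<lambda>u. G t u - G (t + h) u) (\<lambda>u. F t u - F (t + h) u)"
    if "\<tau> \<le> t" "t \<le> \<tau> + k * h" for t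
  proof -
    have "test_pair C (G t) (F t)" "test_pair C (G (t + h)) (F (t + h))"
      using that assms(1) by (auto intro!: Suc.prems simp: algebra_simps)
    from test_pair_combine[OF this, of "-1"] show ?thesis by simp
  qed
  from Suc.IH[of "2 * C" "\<lambda>t u. G t u - G (t + h) u" "\<lambda>t u. F t u - F (t + h) u", OF this]
  show ?case by (simp add: mult_ac)
qed

lemma riesz_profile_shift_bounded:
  assumes \<tau>: "\<tau> > 0"
  obtains B where "\<And>u. u \<in> {0..4} \<Longrightarrow> \<bar>\<kappa> (\<tau> + u)\<bar> \<le> B"
proof
  fix u :: real assume "u \<in> {0..4}"
  then have "\<kappa> (\<tau> + 4) \<le> \<kappa> (\<tau> + u)" "\<kappa> (\<tau> + u) \<le> \<kappa> \<tau>"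
    using \<tau> by (auto intro!: riesz_profile_antimono)
  then show "\<bar>\<kappa> (\<tau> + u)\<bar> \<le> \<bar>\<kappa> \<tau>\<bar> + \<bar>\<kappa> (\<tau> + 4)\<bar>" by linarith
qed

lemma conf_density_le:
  assumes \<tau>: "\<tau> > 0" and u: "u \<ge> 0"
  shows "\<bar>conf_density \<tau> u\<bar> \<le> conf_density \<tau> 0"
proof -
  have "(\<tau> + u) powr (s / 2 - d) \<le> \<tau> powr (s / 2 - d)"
    using \<tau> u s by (intro powr_mono2') auto
  then have "conf_density \<tau> u \<le> conf_density \<tau> 0"
    using riesz_norm_pos unfolding conf_density_def by (intro divide_right_mono mult_left_mono) auto
  then show ?thesis using conf_density_nonneg[of \<tau> u] by simp
qed

lemma conf_density_pair:
  assumes \<tau>: "\<tau> > 0"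
  shows "test_pair (zonal_mean (conf_density \<tau>)) (conf_density \<tau>) (\<lambda>u. \<kappa> (\<tau> + u))"
    and "s \<noteq> 0 \<Longrightarrow> riesz_mean * zonal_mean (conf_density \<tau>) = zonal_mean (\<lambda>u. \<kappa> (\<tau> + u))"
proof -
  let ?g = "conf_density \<tau>" and ?\<phi> = "\<lambda>u. \<kappa> (\<tau> + u)"
  obtain B where B: "\<And>u. u \<in> {0..4} \<Longrightarrow> \<bar>?\<phi> u\<bar> \<le> B" using riesz_profile_shift_bounded[OF \<tau>] by blast
  have Bg: "\<bar>?g u\<bar> \<le> ?g 0" if "u \<in> {0..4}" for u using that by (intro conf_density_le[OF \<tau>]) auto
  \<comment> \<open>Integrate the potential over \<open>x\<close> and swap: the kernel integrates to
    \<open>riesz_mean\<close> for each fixed \<open>y\<close>.\<close>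
  have key: "c = - zonal_mean ?\<phi> + riesz_mean * zonal_mean ?g"
    if p: "norm (p::'a) = 1" and c: "\<And>x::'a. norm x = 1 \<Longrightarrow>
     (\<integral>y. \<kappa> ((norm (x - y))\<^sup>2) * ?g ((norm (y - p))\<^sup>2) \<partial>sphere_prob) = \<kappa> (\<tau> + (norm (x - p))\<^sup>2) + c" for p c
  proof -
    have int: "integrable sphere_prob (\<lambda>x. ?\<phi> ((norm (x - p))\<^sup>2))"
      by (rule integrable_zonal_bounded[OF _ B p]) measurable
    have "zonal_mean ?\<phi> + c = (\<integral>x. \<kappa> (\<tau> + (norm (x - p))\<^sup>2) + c \<partial>sphere_prob)"
      using int integral_zonal[of ?\<phi> p] p by simp
    also have "\<dots> = (\<integral>x. (\<integral>y. \<kappa> ((norm (x - y))\<^sup>2) * ?g ((norm (y - p))\<^sup>2) \<partial>sphere_prob) \<partial>sphere_prob)"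
      by (rule integral_sphere_cong) (measurable, simp add: c)
    also have "\<dots> = (\<integral>y. (\<integral>x. \<kappa> ((norm (x - y))\<^sup>2) * ?g ((norm (y - p))\<^sup>2) \<partial>sphere_prob) \<partial>sphere_prob)"
    proof (rule integral_sphere_swap[symmetric])
      show "(\<lambda>(x, y). \<kappa> ((norm (x - y))\<^sup>2) * ?g ((norm (y - p))\<^sup>2)) \<in> borel_measurable (borel \<Otimes>\<^sub>M borel)"
        by measurable
    qed (rule integrable_riesz_mult[OF _ Bg p]; simp)+
    also have "\<dots> = (\<integral>y. riesz_mean * ?g ((norm (y - p))\<^sup>2) \<partial>sphere_prob)"
      by (rule integral_sphere_cong) (measurable, simp add: integral_riesz)
    also have "\<dots> = riesz_mean * zonal_mean ?g"
      using integral_zonal[of ?g p] p by simp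
    finally show ?thesis by simp
  qed
  have pot: "(\<integral>y. \<kappa> ((norm (x - y))\<^sup>2) * ?g ((norm (y - p))\<^sup>2) \<partial>(sphere_prob :: 'a measure)) =
        ?\<phi> ((norm (x - p))\<^sup>2) - zonal_mean ?\<phi> + riesz_mean * zonal_mean ?g"
    if p: "norm p = 1" and x: "norm x = 1" for p x
  proof -
    obtain c where c: "\<And>x::'a. norm x = 1 \<Longrightarrow>
     (\<integral>y. \<kappa> ((norm (x - y))\<^sup>2) * ?g ((norm (y - p))\<^sup>2) \<partial>sphere_prob) = \<kappa> (\<tau> + (norm (x - p))\<^sup>2) + c"
      using conf_density_potential[OF \<tau> p] by blast
    then show ?thesis using key[OF p c] x by simp
  qed
  show "test_pair (zonal_mean ?g) ?g ?\<phi>"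
    unfolding test_pair_def
  proof (intro conjI)
    show "\<exists>b. \<forall>u\<in>{0..4}. \<bar>?g u\<bar> \<le> b \<and> \<bar>?\<phi> u\<bar> \<le> b"
      using B Bg by (intro exI[of _ "max B (?g 0)"]) (auto simp: le_max_iff_disj)
  qed (use pot conf_density_nonneg in \<open>auto simp: abs_of_nonneg\<close>)
  show "riesz_mean * zonal_mean ?g = zonal_mean ?\<phi>" if "s \<noteq> 0"
  proof -
    obtain c where c: "\<And>x::'a. norm x = 1 \<Longrightarrow>
     (\<integral>y. \<kappa> ((norm (x - y))\<^sup>2) * ?g ((norm (y - e))\<^sup>2) \<partial>sphere_prob) = \<kappa> (\<tau> + (norm (x - e))\<^sup>2) + c" "s \<noteq> 0 \<Longrightarrow> c = 0"
      using conf_density_potential[OF \<tau> e] by blast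
    then show ?thesis using key[OF e c(1)] that by simp
  qed
qed

text \<open>Uniformity as \<open>\<tau>\<close> tends to 0 is the point. For \<open>s = 0\<close>
  the density is a probability density. Otherwise its mean is that of the explicit potential divided
  by \<open>riesz_mean\<close>: for \<open>s > 0\<close> monotonicity of the profile bounds it by 1,
  and for \<open>s < 0\<close> the potential is bounded in absolute value by its value at the
  largest argument.\<close>

lemma conf_density_mean_bounded:
  assumes T: "T > 0"
  obtains C where "C > 0" "\<And>\<tau>. 0 < \<tau> \<Longrightarrow> \<tau> \<le> T \<Longrightarrow> zonal_mean (conf_density \<tau>) \<le> C"
proof
  show "1 + (T + 4) powr (- s / 2) / riesz_norm > 0" using riesz_norm_pos by (simp add: add_pos_nonneg)
  fix \<tau> :: real assume \<tau>: "0 < \<tau>" "\<tau> \<le> T"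
  have ge0: "(T + 4) powr (- s / 2) / riesz_norm \<ge> 0" using riesz_norm_pos by simp
  consider "s = 0" | "s > 0" | "s < 0" by linarith
  then show "zonal_mean (conf_density \<tau>) \<le> 1 + (T + 4) powr (- s / 2) / riesz_norm"
  proof cases
    case 1
    have "conf_density \<tau> ((norm (y - e))\<^sup>2) = (sqrt (\<tau> * (\<tau> + 4)) / (\<tau> + (norm (y - e))\<^sup>2)) ^ d" for y
    proof -
      have "\<tau> + (norm (y - e))\<^sup>2 > 0" "sqrt (\<tau> * (\<tau> + 4)) > 0" using \<tau> by (auto simp: add_pos_nonneg)
      then show ?thesis unfolding conf_density_def riesz_norm_def using 1
        by (simp add: power_divide powr_minus_divide powr_realpow)
    qed
    then have "zonal_mean (conf_density \<tau>) = 1"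
      unfolding zonal_mean_def using conformal_change(3)[OF \<tau>(1) e e] by simp
    then show ?thesis using ge0 by simp
  next
    case 2
    obtain B where B: "\<And>u. u \<in> {0..4} \<Longrightarrow> \<bar>\<kappa> (\<tau> + u)\<bar> \<le> B" using riesz_profile_shift_bounded[OF \<tau>(1)] by blast
    have rm: "riesz_mean = riesz_norm" using 2 unfolding riesz_norm_def by simp
    have "riesz_mean * zonal_mean (conf_density \<tau>) = zonal_mean (\<lambda>u. \<kappa> (\<tau> + u))"
      using 2 by (intro conf_density_pair[OF \<tau>(1)]) auto
    also have "\<dots> \<le> riesz_mean"
      unfolding zonal_mean_def riesz_mean_def
    proof (rule integral_mono_AE)
      show "AE x in sphere_prob. \<kappa> (\<tau> + (norm (x - e))\<^sup>2) \<le> \<kappa> ((norm (x - e))\<^sup>2)"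
        by (rule eventually_mono[OF AE_sphere_prob_neq[OF e]]) (use \<tau> in \<open>auto intro!: riesz_profile_antimono\<close>)
      show "integrable sphere_prob (\<lambda>x. \<kappa> (\<tau> + (norm (x - e))\<^sup>2))"
        by (rule integrable_zonal_bounded[OF _ B e]) simp_all
    qed (rule integrable_riesz[OF e])
    finally have "zonal_mean (conf_density \<tau>) \<le> 1" using riesz_norm_pos unfolding rm by simp
    with ge0 show ?thesis by linarith
  next
    case 3
    obtain B where B: "\<And>u. u \<in> {0..4} \<Longrightarrow> \<bar>\<kappa> (\<tau> + u)\<bar> \<le> B" using riesz_profile_shift_bounded[OF \<tau>(1)] by blast
    have rm: "riesz_mean = - riesz_norm" using 3 unfolding riesz_norm_def by simp
    have "riesz_norm * zonal_mean (conf_density \<tau>) = - zonal_mean (\<lambda>u. \<kappa> (\<tau> + u))"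
      using 3 conf_density_pair(2)[OF \<tau>(1)] unfolding rm by simp
    also have "\<dots> = (\<integral>x. - \<kappa> (\<tau> + (norm (x - e))\<^sup>2) \<partial>sphere_prob)"
      unfolding zonal_mean_def by simp
    also have "\<dots> \<le> (\<integral>x. (T + 4) powr (- s / 2) \<partial>(sphere_prob :: 'a measure))"
    proof (rule integral_sphere_mono)
      fix x :: 'a assume "norm x = 1"
      then have "(\<tau> + (norm (x - e))\<^sup>2) powr (- s / 2) \<le> (T + 4) powr (- s / 2)"
        using \<tau> 3 norm_diff_sphere_le[of x e] e by (intro powr_mono2) auto
      then show "- \<kappa> (\<tau> + (norm (x - e))\<^sup>2) \<le> (T + 4) powr (- s / 2)"
        using 3 by (simp add: riesz_profile_def)
    next
      show "integrable sphere_prob (\<lambda>x. - \<kappa> (\<tau> + (norm (x - e))\<^sup>2))"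
        by (rule integrable_minus[OF integrable_zonal_bounded[OF _ B e]]) simp_all
    qed simp
    finally have "zonal_mean (conf_density \<tau>) \<le> (T + 4) powr (- s / 2) / riesz_norm"
      using riesz_norm_pos by (simp add: field_simps)
    then show ?thesis by simp
  qed
qed

end

section \<open>Concentrated bumps from iterated differences\<close>

context sphere_riesz
begin

text \<open>With this many differences the decay exponent \<open>s / 2 + d + 1\<close> in the
  squared distance exceeds \<open>d\<close> for every \<open>s > - 2\<close>, so that the inverse
  power of exponent \<open>d\<close> controls the mean.\<close>

definition bump_order :: nat where "bump_order = d + 1"
definition bump_exponent :: real where "bump_exponent = s / 2 + bump_order"

definition bump :: "real \<Rightarrow> real \<Rightarrow> real" where
  "bump \<delta> u = iterated_diff bump_order (\<delta>\<^sup>2) (\<lambda>t. \<kappa> (t + u)) (\<delta>\<^sup>2)"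

abbreviation bump_const :: real where "bump_const \<equiv> riesz_deriv_const bump_order"

lemma bump_exponent_gt: "bump_exponent > d"
  using s by (simp add: bump_exponent_def bump_order_def)

text \<open>The mean value theorem evaluates the difference at a point between
  \<open>\<delta>\<^sup>2 + u\<close> and \<open>(bump_order + 1) * \<delta>\<^sup>2 + u\<close>.
  Both bounds have the same profile up to this shift, which is what makes bumps of different scales
  comparable.\<close>

lemma bump_bounds:
  fixes \<delta> u :: real
  assumes \<delta>: "\<delta> > 0" and u: "u \<ge> 0"
  shows "bump \<delta> u \<le> bump_const * \<delta> powr (2 * bump_order) * (\<delta>\<^sup>2 + u) powr (- bump_exponent)"
    and "bump_const * \<delta> powr (2 * bump_order) * ((bump_order + 1) * \<delta>\<^sup>2 + u) powr (- bump_exponent) \<le> bump \<delta> u"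
proof -
  have \<delta>2: "\<delta>\<^sup>2 > 0" using \<delta> by simp
  have "bump_order \<ge> 1" by (simp add: bump_order_def)
  from iterated_diff_riesz[OF \<delta>2 u this] obtain \<xi> where \<xi>: "\<delta>\<^sup>2 + u \<le> \<xi>" "\<xi> \<le> (bump_order + 1) * \<delta>\<^sup>2 + u"
    "iterated_diff bump_order (\<delta>\<^sup>2) (\<lambda>t. \<kappa> (t + u)) (\<delta>\<^sup>2) = (\<delta>\<^sup>2) ^ bump_order * bump_const * \<xi> powr (- bump_exponent)"
    unfolding bump_exponent_def by blast
  have "(\<delta>\<^sup>2) ^ bump_order = \<delta> powr (2 * bump_order)"
    using powr_realpow[OF \<delta>, of "2 * bump_order"] by (simp add: power_mult)
  then have eq: "bump \<delta> u = bump_const * \<delta> powr (2 * bump_order) * \<xi> powr (- bump_exponent)"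
    using \<xi>(3) by (simp add: bump_def)
  have p1: "\<delta>\<^sup>2 + u > 0" using \<delta>2 u by linarith
  then have "\<xi> > 0" using \<xi>(1) by linarith
  note pos = p1 this
  have q: "- bump_exponent \<le> 0" using bump_exponent_gt by (smt (verit) of_nat_0_le_iff)
  have c: "bump_const * \<delta> powr (2 * bump_order) \<ge> 0" using riesz_deriv_const_pos[of bump_order] by simp
  show "bump \<delta> u \<le> bump_const * \<delta> powr (2 * bump_order) * (\<delta>\<^sup>2 + u) powr (- bump_exponent)"
    unfolding eq using pos \<xi> by (intro mult_left_mono[OF _ c] powr_mono2'[OF q]) auto
  show "bump_const * \<delta> powr (2 * bump_order) * ((bump_order + 1) * \<delta>\<^sup>2 + u) powr (- bump_exponent) \<le> bump \<delta> u"
    unfolding eq using pos \<xi> by (intro mult_left_mono[OF _ c] powr_mono2'[OF q]) auto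
qed

lemma zonal_mean_inverse_power_le:
  fixes \<delta> :: real
  assumes \<delta>: "\<delta> > 0"
  shows "zonal_mean (\<lambda>u. 1 / (\<delta>\<^sup>2 + u) ^ d) \<le> \<delta> powr (- real d)"
    and "integrable sphere_prob (\<lambda>x. 1 / (\<delta>\<^sup>2 + (norm (x - e))\<^sup>2) ^ d)"
proof -
  show int: "integrable sphere_prob (\<lambda>x. 1 / (\<delta>\<^sup>2 + (norm (x - e))\<^sup>2) ^ d)"
  proof (rule sphere_prob.integrable_const_bound[where B="1 / (\<delta>\<^sup>2) ^ d"])
    have "1 / (\<delta>\<^sup>2 + (norm (x - e))\<^sup>2) ^ d \<le> 1 / (\<delta>\<^sup>2) ^ d" for x
      using \<delta> by (intro divide_left_mono power_mono mult_pos_pos zero_less_power) (auto simp: add_pos_nonneg)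
    then show "AE x in sphere_prob. norm (1 / (\<delta>\<^sup>2 + (norm (x - e))\<^sup>2) ^ d) \<le> 1 / (\<delta>\<^sup>2) ^ d"
      by (simp add: add_nonneg_nonneg)
  qed measurable
  have "ennreal (zonal_mean (\<lambda>u. 1 / (\<delta>\<^sup>2 + u) ^ d)) = (\<integral>\<^sup>+x. ennreal (1 / (\<delta>\<^sup>2 + (norm (x - e))\<^sup>2) ^ d) \<partial>sphere_prob)"
    unfolding zonal_mean_def by (rule nn_integral_eq_integral[symmetric, OF int]) (simp add: add_nonneg_nonneg)
  also have "\<dots> \<le> ennreal (1 / (2 * \<delta>) ^ d)" by (rule nn_integral_sphere_prob_inverse_power_le[OF dim d \<delta> e])
  finally have "zonal_mean (\<lambda>u. 1 / (\<delta>\<^sup>2 + u) ^ d) \<le> 1 / (2 * \<delta>) ^ d" using \<delta> by simp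
  also have "\<dots> \<le> 1 / \<delta> ^ d" using \<delta> by (intro divide_left_mono power_mono) auto
  also have "\<dots> = \<delta> powr (- real d)" using \<delta> by (simp add: powr_minus_divide powr_realpow)
  finally show "zonal_mean (\<lambda>u. 1 / (\<delta>\<^sup>2 + u) ^ d) \<le> \<delta> powr (- real d)" .
qed

lemma bump_nonneg: "\<delta> > 0 \<Longrightarrow> u \<ge> 0 \<Longrightarrow> bump \<delta> u \<ge> 0"
  using bump_bounds(2)[of \<delta> u] riesz_deriv_const_pos[of bump_order]
  by (meson less_imp_le mult_nonneg_nonneg order_trans powr_ge_zero)

text \<open>Of the decay exponent, \<open>d\<close> is kept for the integrable inverse power and the
  positive remainder is bounded by its value at \<open>u = 0\<close>. The powers of
  \<open>\<delta>\<close> add up to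
  \<open>2 * bump_order - 2 * (bump_exponent - d) - d = d - s\<close>.\<close>

lemma bump_mean_le:
  fixes \<delta> :: real
  assumes \<delta>: "\<delta> > 0" and int: "integrable sphere_prob (\<lambda>x. bump \<delta> ((norm (x - e))\<^sup>2))"
  shows "zonal_mean (bump \<delta>) \<le> bump_const * \<delta> powr (d - s)"
proof -
  let ?q = bump_exponent and ?c = "bump_const * \<delta> powr (2 * bump_order) * (\<delta>\<^sup>2) powr (- (bump_exponent - d))"
  have c: "bump_const \<ge> 0" using riesz_deriv_const_pos[of bump_order] by simp
  have "zonal_mean (bump \<delta>) \<le> (\<integral>x. ?c * (1 / (\<delta>\<^sup>2 + (norm (x - e))\<^sup>2) ^ d) \<partial>sphere_prob)"
    unfolding zonal_mean_def
  proof (rule integral_sphere_mono[OF int])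
    fix x :: 'a
    define u where "u = (norm (x - e))\<^sup>2"
    have u: "u \<ge> 0" "\<delta>\<^sup>2 + u > 0" using \<delta> by (auto simp: u_def add_pos_nonneg)
    have "bump \<delta> u \<le> bump_const * \<delta> powr (2 * bump_order) * (\<delta>\<^sup>2 + u) powr (- ?q)"
      by (rule bump_bounds(1)[OF \<delta> u(1)])
    also have "(\<delta>\<^sup>2 + u) powr (- ?q) = (\<delta>\<^sup>2 + u) powr (- (?q - d)) * (\<delta>\<^sup>2 + u) powr (- real d)"
      by (simp flip: powr_add)
    also have "(\<delta>\<^sup>2 + u) powr (- real d) = 1 / (\<delta>\<^sup>2 + u) ^ d" using u by (simp add: powr_minus_divide powr_realpow)
    also have "bump_const * \<delta> powr (2 * bump_order) * ((\<delta>\<^sup>2 + u) powr (- (?q - d)) * (1 / (\<delta>\<^sup>2 + u) ^ d))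
       \<le> bump_const * \<delta> powr (2 * bump_order) * ((\<delta>\<^sup>2) powr (- (?q - d)) * (1 / (\<delta>\<^sup>2 + u) ^ d))"
      using c u \<delta> bump_exponent_gt by (intro mult_left_mono mult_right_mono powr_mono2') auto
    finally show "bump \<delta> ((norm (x - e))\<^sup>2) \<le> ?c * (1 / (\<delta>\<^sup>2 + (norm (x - e))\<^sup>2) ^ d)"
      unfolding u_def[symmetric] by (simp only: mult.assoc)
  qed (intro integrable_mult_right zonal_mean_inverse_power_le(2)[OF \<delta>])
  also have "\<dots> = ?c * zonal_mean (\<lambda>u. 1 / (\<delta>\<^sup>2 + u) ^ d)" unfolding zonal_mean_def by (rule integral_mult_right_zero)
  also have "\<dots> \<le> ?c * \<delta> powr (- real d)"
    using c by (intro mult_left_mono zonal_mean_inverse_power_le(1)[OF \<delta>]) auto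
  also have "\<dots> = bump_const * \<delta> powr (d - s)"
  proof -
    have "(\<delta>\<^sup>2) powr (- (?q - d)) = \<delta> powr (- 2 * (?q - d))"
      using \<delta> by (simp add: powr_powr flip: powr_numeral)
    then have "?c * \<delta> powr (- real d) = bump_const * (\<delta> powr (2 * bump_order) * \<delta> powr (- 2 * (?q - d)) * \<delta> powr (- real d))"
      by simp
    also have "\<delta> powr (2 * bump_order) * \<delta> powr (- 2 * (?q - d)) * \<delta> powr (- real d)
        = \<delta> powr (real (2 * bump_order) + - 2 * (?q - d) + - real d)" by (simp only: powr_add)
    also have "real (2 * bump_order) + - 2 * (?q - d) + - real d = d - s" by (simp add: bump_exponent_def)
    finally show ?thesis .
  qed
  finally show ?thesis .
qed

text \<open>On the cap of squared radius \<open>20 * \<delta>\<^sup>2\<close> the bump is evaluated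
  below \<open>(bump_order + 21) * \<delta>\<^sup>2\<close>; the second factor comes from the lower
  bound for the measure of that cap.\<close>

definition bump_lower :: real where
  "bump_lower = (bump_order + 21) powr (- bump_exponent) * ((1 / sqrt 5) ^ d / 2)"

lemma bump_lower_pos: "bump_lower > 0" by (simp add: bump_lower_def)

lemma bump_mean_ge:
  fixes \<delta> :: real
  assumes \<delta>: "0 < \<delta>" "\<delta> \<le> 1" and int: "integrable sphere_prob (\<lambda>x. bump \<delta> ((norm (x - e))\<^sup>2))"
  shows "bump_const * bump_lower * \<delta> powr (d - s) \<le> zonal_mean (bump \<delta>)"
proof -
  let ?q = bump_exponent and ?C = "{x::'a. norm (x - e) \<le> sqrt 20 * \<delta>}"
  define l where "l = bump_const * \<delta> powr (2 * bump_order) * ((bump_order + 21) * \<delta>\<^sup>2) powr (- ?q)"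
  have c: "bump_const \<ge> 0" using riesz_deriv_const_pos[of bump_order] by simp
  have q: "- ?q \<le> 0" using bump_exponent_gt by (smt (verit) of_nat_0_le_iff)
  have l0: "l \<ge> 0" unfolding l_def using c by simp
  have leq: "l = bump_const * (bump_order + 21) powr (- ?q) * \<delta> powr (- s)"
  proof -
    have "(\<delta>\<^sup>2) powr (- ?q) = \<delta> powr (- 2 * ?q)" using \<delta> by (simp add: powr_powr flip: powr_numeral)
    then have "l = bump_const * (bump_order + 21) powr (- ?q) * (\<delta> powr (2 * bump_order) * \<delta> powr (- 2 * ?q))"
      unfolding l_def by (subst powr_mult) auto
    also have "\<delta> powr (2 * bump_order) * \<delta> powr (- 2 * ?q) = \<delta> powr (real (2 * bump_order) + - 2 * ?q)"
      by (simp only: powr_add)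
    also have "real (2 * bump_order) + - 2 * ?q = - s" by (simp add: bump_exponent_def)
    finally show ?thesis .
  qed
  have "l * ((\<delta> / sqrt 5) ^ d / 2) \<le> l * measure sphere_prob ?C"
    by (intro mult_left_mono measure_sphere_prob_cap_ge[OF dim d \<delta> e] l0)
  also have "\<dots> = (\<integral>x. l * indicator ?C x \<partial>sphere_prob)" by simp
  also have "\<dots> \<le> zonal_mean (bump \<delta>)"
    unfolding zonal_mean_def
  proof (rule integral_sphere_mono[OF _ int])
    show "integrable sphere_prob (\<lambda>x. l * indicator ?C x)"
      by (intro integrable_mult_right integrable_real_indicator) (auto simp: sphere_prob.emeasure_eq_measure)
    fix x :: 'a
    show "l * indicator ?C x \<le> bump \<delta> ((norm (x - e))\<^sup>2)"
    proof (cases "x \<in> ?C")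
      case True
      then have "(norm (x - e))\<^sup>2 \<le> (sqrt 20 * \<delta>)\<^sup>2" by (intro power_mono) auto
      then have "(bump_order + 1) * \<delta>\<^sup>2 + (norm (x - e))\<^sup>2 \<le> (bump_order + 21) * \<delta>\<^sup>2"
        by (simp add: power_mult_distrib algebra_simps)
      then have "l \<le> bump_const * \<delta> powr (2 * bump_order) * ((bump_order + 1) * \<delta>\<^sup>2 + (norm (x - e))\<^sup>2) powr (- ?q)"
        unfolding l_def using c \<delta> by (intro mult_left_mono powr_mono2'[OF q]) (auto simp: add_pos_nonneg)
      also have "\<dots> \<le> bump \<delta> ((norm (x - e))\<^sup>2)" by (rule bump_bounds(2)[OF \<delta>(1)]) simp
      finally show ?thesis using True by simp
    qed (use bump_nonneg[OF \<delta>(1)] in simp)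
  qed
  also have "l * ((\<delta> / sqrt 5) ^ d / 2) = bump_const * bump_lower * (\<delta> powr (- s) * \<delta> ^ d)"
    unfolding leq bump_lower_def by (simp add: power_divide)
  also have "\<delta> powr (- s) * \<delta> ^ d = \<delta> powr (d - s)"
  proof -
    have "\<delta> powr (- s) * \<delta> powr d = \<delta> powr (- s + d)" by (simp only: powr_add)
    then show ?thesis using \<delta> by (simp add: powr_realpow)
  qed
  finally show ?thesis .
qed

lemma bump_pair:
  fixes \<delta> T C :: real
  assumes \<delta>: "0 < \<delta>" "\<delta>\<^sup>2 * (bump_order + 1) \<le> T"
    and C: "\<And>\<tau>. 0 < \<tau> \<Longrightarrow> \<tau> \<le> T \<Longrightarrow> zonal_mean (conf_density \<tau>) \<le> C"
  obtains g where "test_pair (2 ^ bump_order * C) g (bump \<delta>)"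
proof
  show "test_pair (2 ^ bump_order * C) (\<lambda>u. iterated_diff bump_order (\<delta>\<^sup>2) (\<lambda>t. conf_density t u) (\<delta>\<^sup>2)) (bump \<delta>)"
    unfolding bump_def[abs_def]
  proof (rule test_pair_iterated_diff)
    show "\<delta>\<^sup>2 > 0" using \<delta> by simp
    fix t assume t: "\<delta>\<^sup>2 \<le> t" "t \<le> \<delta>\<^sup>2 + bump_order * \<delta>\<^sup>2"
    have t0: "t > 0" using t(1) \<open>\<delta>\<^sup>2 > 0\<close> by linarith
    have "t \<le> T" using t(2) \<delta>(2) by (simp add: algebra_simps)
    then have "zonal_mean (conf_density t) \<le> C" by (rule C[OF t0])
    then show "test_pair C (conf_density t) (\<lambda>u. \<kappa> (t + u))"
      using conf_density_pair(1)[OF t0] unfolding test_pair_def by fastforce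
  qed
qed

lemma test_pair_integrable:
  assumes "test_pair C g \<phi>"
  shows "integrable sphere_prob (\<lambda>x. \<phi> ((norm (x - e))\<^sup>2))"
proof -
  obtain B where "\<And>u. u \<in> {0..4} \<Longrightarrow> \<bar>\<phi> u\<bar> \<le> B" "\<phi> \<in> borel_measurable borel"
    using assms unfolding test_pair_def by blast
  then show ?thesis by (intro integrable_zonal_bounded[OF _ _ e]) auto
qed

text \<open>The difference of a bump at scale \<open>\<delta>\<close> and a small multiple of a bump at a larger scale is
  negative away from the center, because both have the same decay, but has positive mean.\<close>

lemma exists_test_pair:
  obtains R C c where "R > 0" "C > 0" "c > 0"
    "\<And>\<delta>. 0 < \<delta> \<Longrightarrow> \<delta> \<le> 1 \<Longrightarrow> \<exists>g \<phi>. test_pair C g \<phi> \<and> (\<forall>u. (R * \<delta>)\<^sup>2 \<le> u \<longrightarrow> \<phi> u \<le> 0)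
        \<and> c * \<delta> powr (d - s) \<le> zonal_mean \<phi>"
proof -
  let ?q = bump_exponent and ?k = bump_order
  have c: "bump_const > 0" by (rule riesz_deriv_const_pos)
  have qd: "?q > d" by (rule bump_exponent_gt)
  \<comment> \<open>The ratio of the two scales. Since \<open>d - 2 * ?q \<le> - 1\<close>, this
    size makes the wide bump, multiplied by \<open>\<mu>\<close>, consume at most half of the mean
    of the narrow one.\<close>
  define B where "B = max 1 (2 * 2 powr ?q / bump_lower)"
  have B: "B \<ge> 1" by (simp add: B_def)
  \<comment> \<open>Equalizes the tails: the power of \<open>B\<close> undoes the larger prefactor
    of the wide bump, and \<open>2 powr ?q\<close> pays for bounding the shifted argument by
    \<open>2 * u\<close>.\<close>
  define \<mu> where "\<mu> = 2 powr ?q * B powr (- real (2 * ?k))"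
  have \<mu>: "\<mu> > 0" using B by (simp add: \<mu>_def)
  have \<mu>B: "\<mu> * B powr (d - s) \<le> bump_lower / 2"
  proof -
    have "\<mu> * B powr (d - s) = 2 powr ?q * (B powr (- real (2 * ?k)) * B powr (d - s))" by (simp add: \<mu>_def)
    also have "B powr (- real (2 * ?k)) * B powr (d - s) = B powr (- real (2 * ?k) + (d - s))" by (simp only: powr_add)
    also have "- real (2 * ?k) + (d - s) = d - 2 * ?q" by (simp add: bump_exponent_def)
    also have "2 powr ?q * B powr (d - 2 * ?q) \<le> 2 powr ?q * B powr (- 1)"
      using B qd d by (intro mult_left_mono powr_mono) auto
    also have "\<dots> = 2 powr ?q / B" using B by (simp add: powr_minus_divide)
    also have "\<dots> \<le> 2 powr ?q / (2 * 2 powr ?q / bump_lower)"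
      using B bump_lower_pos by (intro divide_left_mono) (auto simp: B_def)
    also have "\<dots> = bump_lower / 2" using bump_lower_pos by simp
    finally show ?thesis .
  qed
  \<comment> \<open>Bounds all parameters used by both bumps for \<open>\<delta> \<le> 1\<close>, so
    that \<open>C\<close> does not depend on \<open>\<delta>\<close>.\<close>
  define T where "T = B\<^sup>2 * (?k + 1)"
  have T: "T > 0" using B by (simp add: T_def)
  obtain C0 where C0: "C0 > 0" "\<And>\<tau>. 0 < \<tau> \<Longrightarrow> \<tau> \<le> T \<Longrightarrow> zonal_mean (conf_density \<tau>) \<le> C0"
    using conf_density_mean_bounded[OF T] by blast
  define C where "C = 2 ^ ?k * C0 + \<bar>- \<mu>\<bar> * (2 ^ ?k * C0)"
  \<comment> \<open>From distance \<open>R * \<delta>\<close> on, the shift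
    \<open>(?k + 1) * (B * \<delta>)\<^sup>2\<close> in the wide bump is at most
    \<open>u\<close>.\<close>
  define R where "R = B * sqrt (?k + 1)"
  have R: "R > 0" "R\<^sup>2 = B\<^sup>2 * (?k + 1)" using B by (auto simp: R_def power_mult_distrib)
  show thesis
  proof (rule that[of R C "bump_const * bump_lower / 2"])
    show "C > 0" using C0 \<mu> unfolding C_def by (intro add_pos_nonneg mult_pos_pos) auto
    show "bump_const * bump_lower / 2 > 0" using c bump_lower_pos by simp
    fix \<delta> :: real assume \<delta>: "0 < \<delta>" "\<delta> \<le> 1"
    have B\<delta>: "B * \<delta> > 0" using B \<delta> by simp
    have \<delta>1: "\<delta>\<^sup>2 \<le> 1" using \<delta> by (simp add: power_le_one)
    have "(B * \<delta>)\<^sup>2 * (?k + 1) \<le> T"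
      using \<delta>1 mult_left_mono[OF \<delta>1, of "B\<^sup>2 * (?k + 1)"] B by (simp add: T_def power_mult_distrib mult_ac)
    then obtain g2 where g2: "test_pair (2 ^ ?k * C0) g2 (bump (B * \<delta>))"
      using bump_pair[OF B\<delta> _ C0(2)] by blast
    have "\<delta>\<^sup>2 * (?k + 1) \<le> B\<^sup>2 * (?k + 1)" using \<delta>1 B by (intro mult_right_mono) (auto intro: order_trans[OF _ one_le_power])
    then obtain g1 where g1: "test_pair (2 ^ ?k * C0) g1 (bump \<delta>)"
      using bump_pair[OF \<delta>(1) _ C0(2)] unfolding T_def by blast
    let ?g = "\<lambda>u. g1 u + - \<mu> * g2 u" and ?\<phi> = "\<lambda>u. bump \<delta> u + - \<mu> * bump (B * \<delta>) u"
    have "test_pair C ?g ?\<phi>" unfolding C_def by (rule test_pair_combine[OF g1 g2])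
    moreover have "?\<phi> u \<le> 0" if u: "(R * \<delta>)\<^sup>2 \<le> u" for u
    proof -
      have Ru: "(?k + 1) * (B * \<delta>)\<^sup>2 \<le> u" using u R(2) by (simp add: power_mult_distrib mult_ac)
      have u0: "u > 0" using u R \<delta> by (meson less_le_trans mult_pos_pos zero_less_power)
      have q: "- ?q \<le> 0" using qd by (smt (verit) of_nat_0_le_iff)
      have "bump \<delta> u \<le> bump_const * \<delta> powr (2 * ?k) * (\<delta>\<^sup>2 + u) powr (- ?q)"
        using u0 by (intro bump_bounds(1) \<delta>) auto
      also have "\<dots> \<le> bump_const * \<delta> powr (2 * ?k) * u powr (- ?q)"
        using u0 c by (intro mult_left_mono powr_mono2'[OF q]) auto
      also have "\<dots> = \<mu> * (bump_const * (B * \<delta>) powr (2 * ?k) * (2 * u) powr (- ?q))"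
        using B \<delta> u0 by (simp add: \<mu>_def powr_mult powr_minus_divide)
      also have "\<dots> \<le> \<mu> * (bump_const * (B * \<delta>) powr (2 * ?k) * ((?k + 1) * (B * \<delta>)\<^sup>2 + u) powr (- ?q))"
        using u0 c \<mu> Ru B\<delta> by (intro mult_left_mono powr_mono2'[OF q]) (auto intro: add_nonneg_pos)
      also have "\<dots> \<le> \<mu> * bump (B * \<delta>) u"
        using u0 \<mu> by (intro mult_left_mono bump_bounds(2)[OF B\<delta>]) auto
      finally show ?thesis by simp
    qed
    moreover have "bump_const * bump_lower / 2 * \<delta> powr (d - s) \<le> zonal_mean ?\<phi>"
    proof -
      note int = test_pair_integrable[OF g1] test_pair_integrable[OF g2]
      have "\<mu> * zonal_mean (bump (B * \<delta>)) \<le> \<mu> * (bump_const * (B * \<delta>) powr (d - s))"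
        using \<mu> by (intro mult_left_mono bump_mean_le[OF B\<delta> int(2)]) auto
      also have "\<dots> = (\<mu> * B powr (d - s)) * (bump_const * \<delta> powr (d - s))"
        by (simp add: powr_mult)
      also have "\<dots> \<le> bump_lower / 2 * (bump_const * \<delta> powr (d - s))"
        using c by (intro mult_right_mono \<mu>B) auto
      finally have "\<mu> * zonal_mean (bump (B * \<delta>)) \<le> bump_lower / 2 * (bump_const * \<delta> powr (d - s))" .
      moreover have "zonal_mean ?\<phi> = zonal_mean (bump \<delta>) - \<mu> * zonal_mean (bump (B * \<delta>))"
        unfolding zonal_mean_def using int by simp
      ultimately show ?thesis using bump_mean_ge[OF \<delta> int(1)] by (simp add: algebra_simps)
    qed
    ultimately show "\<exists>g \<phi>. test_pair C g \<phi> \<and> (\<forall>u. (R * \<delta>)\<^sup>2 \<le> u \<longrightarrow> \<phi> u \<le> 0)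
        \<and> bump_const * bump_lower / 2 * \<delta> powr (d - s) \<le> zonal_mean \<phi>" by blast
  qed (rule R(1))
qed

end

section \<open>Upper bound for the polarization\<close>

context sphere_riesz
begin

lemma test_pair_abs_integral:
  assumes tp: "test_pair C g \<phi>" and x: "norm (x::'a) = 1"
  shows "integrable sphere_prob (\<lambda>p. g ((norm (x - p))\<^sup>2))"
    and "(\<integral>p. \<bar>g ((norm (x - p))\<^sup>2)\<bar> \<partial>sphere_prob) \<le> C"
proof -
  obtain B where B: "\<And>u. u \<in> {0..4} \<Longrightarrow> \<bar>g u\<bar> \<le> B" and [measurable]: "g \<in> borel_measurable borel"
    using tp unfolding test_pair_def by blast
  show "integrable sphere_prob (\<lambda>p. g ((norm (x - p))\<^sup>2))"
  proof -
    have "integrable sphere_prob (\<lambda>p. g ((norm (p - x))\<^sup>2))"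
      by (rule integrable_zonal_bounded[OF _ B x]) simp_all
    then show ?thesis by (simp add: norm_minus_commute)
  qed
  have "(\<integral>p. \<bar>g ((norm (x - p))\<^sup>2)\<bar> \<partial>sphere_prob) = zonal_mean (\<lambda>u. \<bar>g u\<bar>)"
    using integral_zonal[of "\<lambda>u. \<bar>g u\<bar>" x] x by (simp add: norm_minus_commute)
  also have "\<dots> \<le> C" using tp unfolding test_pair_def by blast
  finally show "(\<integral>p. \<bar>g ((norm (x - p))\<^sup>2)\<bar> \<partial>sphere_prob) \<le> C" .
qed

text \<open>Test the deviation \<open>f\<close> of the potential from its mean against the superposition \<open>h\<close> of the test
  functions centered at the points \<open>p\<close> of \<open>E\<close>, which are far from the configuration: there the test
  potential is nonpositive at every configuration point.\<close>

lemma potential_minimum_le: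
  fixes y :: "nat \<Rightarrow> 'a" and N :: nat
  assumes tp: "test_pair C g \<phi>" and C: "C > 0" and r: "r > 0" "real N * r ^ d \<le> 1 / 2"
    and neg: "\<And>u. r\<^sup>2 \<le> u \<Longrightarrow> \<phi> u \<le> 0" and mean: "zonal_mean \<phi> \<ge> 0"
    and y: "\<And>j. j \<in> {1..N} \<Longrightarrow> norm (y j) = 1"
    and min: "\<And>x. norm x = 1 \<Longrightarrow> x \<notin> y ` {1..N} \<Longrightarrow>
        riesz_mean * real N - m \<le> (\<Sum>j=1..N. \<kappa> ((norm (x - y j))\<^sup>2))"
  shows "real N * zonal_mean \<phi> \<le> 4 * C * m"
proof -
  obtain B where B: "\<And>u. u \<in> {0..4} \<Longrightarrow> \<bar>g u\<bar> \<le> B" and [measurable]: "g \<in> borel_measurable borel"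
    using tp unfolding test_pair_def by blast
  define f where "f x = (\<Sum>j=1..N. \<kappa> ((norm (x - y j))\<^sup>2)) - riesz_mean * real N" for x
  have [measurable]: "f \<in> borel_measurable borel" unfolding f_def[abs_def] by measurable
  have fi: "integrable sphere_prob f"
    unfolding f_def[abs_def] using y by (intro Bochner_Integration.integrable_diff Bochner_Integration.integrable_sum integrable_riesz) auto
  have f0: "(\<integral>x. f x \<partial>sphere_prob) = 0"
  proof -
    have "(\<integral>x. f x \<partial>sphere_prob) = (\<Sum>j=1..N. \<integral>x. \<kappa> ((norm (x - y j))\<^sup>2) \<partial>sphere_prob) - riesz_mean * real N"
      unfolding f_def[abs_def] using y integrable_riesz by (subst Bochner_Integration.integral_diff)
        (auto intro!: Bochner_Integration.integrable_sum simp: Bochner_Integration.integral_sum)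
    also have "(\<Sum>j=1..N. \<integral>x. \<kappa> ((norm (x - y j))\<^sup>2) \<partial>sphere_prob) = (\<Sum>j=1..N. riesz_mean)"
      using y by (intro sum.cong integral_riesz) auto
    finally show ?thesis by simp
  qed
  have fm: "AE x in sphere_prob. - m \<le> f x"
  proof -
    have "AE x in sphere_prob. \<forall>j\<in>{1..N}. x \<noteq> y j"
      using AE_sphere_prob_neq y by (intro AE_finite_allI) auto
    with AE_sphere_prob show ?thesis
    proof eventually_elim
      case (elim x)
      then have "x \<notin> y ` {1..N}" by auto
      from min[OF elim(1) this] show ?case by (simp add: f_def)
    qed
  qed
  have m0: "m \<ge> 0"
  proof -
    have "(\<integral>x. - m \<partial>(sphere_prob :: 'a measure)) \<le> (\<integral>x. f x \<partial>sphere_prob)"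
      using fi fm by (intro integral_mono_AE) auto
    then show ?thesis using f0 by simp
  qed
  define E where "E = {p::'a. \<forall>j\<in>{1..N}. r < norm (p - y j)}"
  have E_eq: "E = UNIV - (\<Union>j\<in>{1..N}. {p. norm (p - y j) \<le> r})" by (auto simp: E_def not_le)
  have capm: "{p. norm (p - y j) \<le> r} \<in> sets borel" for j by measurable
  have [measurable]: "E \<in> sets borel" unfolding E_eq using capm by (intro sets.Diff sets.finite_UN) auto
  \<comment> \<open>The complement is a union of \<open>N\<close> caps, each of measure at most
    \<open>r ^ d\<close>.\<close>
  have Em: "measure sphere_prob E \<ge> 1 / 2"
  proof -
    have "measure sphere_prob (\<Union>j\<in>{1..N}. {p. norm (p - y j) \<le> r}) \<le> (\<Sum>j\<in>{1..N}. measure sphere_prob {p. norm (p - y j) \<le> r})"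
      using capm by (intro sphere_prob.finite_measure_subadditive_finite) auto
    also have "\<dots> \<le> (\<Sum>j\<in>{1..N}. r ^ d)"
      using y by (intro sum_mono measure_sphere_prob_cap_le[OF dim d r(1)]) auto
    also have "\<dots> \<le> 1 / 2" using r by simp
    finally have "measure sphere_prob (\<Union>j\<in>{1..N}. {p. norm (p - y j) \<le> r}) \<le> 1 / 2" .
    moreover have "measure sphere_prob E = 1 - measure sphere_prob (\<Union>j\<in>{1..N}. {p. norm (p - y j) \<le> r})"
      unfolding E_eq using sphere_prob.finite_measure_compl[of "\<Union>j\<in>{1..N}. {p. norm (p - y j) \<le> r}"] capm
      by (simp add: sets.finite_UN)
    ultimately show ?thesis by linarith
  qed
  define q where "q p x = indicator E p * (f x * g ((norm (x - p))\<^sup>2))" for p x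
  have qm [measurable]: "case_prod q \<in> borel_measurable (borel \<Otimes>\<^sub>M borel)"
    unfolding q_def[abs_def] by measurable
  have gb: "\<bar>g ((norm (x - p))\<^sup>2)\<bar> \<le> B" if "norm x = 1" "norm p = 1" for x p :: 'a
    by (rule B[OF norm_diff_sphere_mem[OF that]])
  have B0: "B \<ge> 0" using B[of 0] by simp
  have fg: "integrable sphere_prob (\<lambda>x. f x * g ((norm (x - p))\<^sup>2))" if p: "norm p = 1" for p
  proof (rule Bochner_Integration.integrable_bound[OF integrable_mult_right[OF fi, of B]])
    show "AE x in sphere_prob. norm (f x * g ((norm (x - p))\<^sup>2)) \<le> norm (B * f x)"
      by (rule eventually_mono[OF AE_sphere_prob])
        (use gb[OF _ p] B0 in \<open>simp add: abs_mult mult.commute[of B] mult_left_mono\<close>)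
  qed measurable
  \<comment> \<open>The term \<open>riesz_mean * zonal_mean g\<close> of the test pair, occurring
    once for each point, cancels against the mean subtracted in \<open>f\<close>. For
    \<open>p\<close> in \<open>E\<close> the sum is nonpositive and at most \<open>- Q\<close>
    remains.\<close>
  have fgp: "(\<integral>x. f x * g ((norm (x - p))\<^sup>2) \<partial>sphere_prob) = (\<Sum>j=1..N. \<phi> ((norm (y j - p))\<^sup>2)) - real N * zonal_mean \<phi>"
    if p: "norm p = 1" for p
  proof -
    have i: "integrable sphere_prob (\<lambda>x. \<kappa> ((norm (x - y j))\<^sup>2) * g ((norm (x - p))\<^sup>2))" if "j \<in> {1..N}" for j
    proof -
      have "integrable sphere_prob (\<lambda>x. \<kappa> ((norm (y j - x))\<^sup>2) * g ((norm (x - p))\<^sup>2))"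
        by (rule integrable_riesz_mult(1)[OF _ B p y[OF that]]) simp_all
      then show ?thesis by (simp add: norm_minus_commute)
    qed
    have i': "integrable sphere_prob (\<lambda>x. g ((norm (x - p))\<^sup>2))"
      by (rule integrable_zonal_bounded[OF _ B p]) simp_all
    have "(\<integral>x. f x * g ((norm (x - p))\<^sup>2) \<partial>sphere_prob) =
      (\<integral>x. (\<Sum>j=1..N. \<kappa> ((norm (x - y j))\<^sup>2) * g ((norm (x - p))\<^sup>2)) - riesz_mean * real N * g ((norm (x - p))\<^sup>2) \<partial>sphere_prob)"
      unfolding f_def by (simp only: left_diff_distrib sum_distrib_right)
    also have "\<dots> = (\<integral>x. (\<Sum>j=1..N. \<kappa> ((norm (x - y j))\<^sup>2) * g ((norm (x - p))\<^sup>2)) \<partial>sphere_prob)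
        - (\<integral>x. riesz_mean * real N * g ((norm (x - p))\<^sup>2) \<partial>sphere_prob)"
      using i i' by (intro Bochner_Integration.integral_diff Bochner_Integration.integrable_sum integrable_mult_right) auto
    also have "\<dots> = (\<Sum>j=1..N. \<integral>x. \<kappa> ((norm (x - y j))\<^sup>2) * g ((norm (x - p))\<^sup>2) \<partial>sphere_prob)
        - riesz_mean * real N * zonal_mean g"
      using i integral_zonal[of g p] p by (simp add: Bochner_Integration.integral_sum)
    also have "(\<Sum>j=1..N. \<integral>x. \<kappa> ((norm (x - y j))\<^sup>2) * g ((norm (x - p))\<^sup>2) \<partial>sphere_prob) =
        (\<Sum>j=1..N. \<phi> ((norm (y j - p))\<^sup>2) - zonal_mean \<phi> + riesz_mean * zonal_mean g)"
      using test_pair_potential[OF tp p y] by (intro sum.cong) (simp_all add: norm_minus_commute)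
    finally show ?thesis by (simp add: sum.distrib sum_subtractf algebra_simps)
  qed
  define Q where "Q = real N * zonal_mean \<phi>"
  have Q0: "Q \<ge> 0" using mean by (simp add: Q_def)
  define h where "h x = (\<integral>p. indicator E p * g ((norm (x - p))\<^sup>2) \<partial>sphere_prob)" for x
  have [measurable]: "h \<in> borel_measurable borel" unfolding h_def[abs_def] by measurable
  \<comment> \<open>The superposition is bounded pointwise by the norm of \<open>g\<close> as an
    integrable function, although \<open>g\<close> itself may be large near its center; this is why
    \<open>test_pair\<close> controls only that norm quantitatively.\<close>
  have hC: "\<bar>h x\<bar> \<le> C" if x: "norm x = 1" for x
  proof -
    have "\<bar>h x\<bar> \<le> (\<integral>p. \<bar>indicator E p * g ((norm (x - p))\<^sup>2)\<bar> \<partial>sphere_prob)"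
      unfolding h_def by (rule integral_abs_bound)
    also have "\<dots> \<le> (\<integral>p. \<bar>g ((norm (x - p))\<^sup>2)\<bar> \<partial>sphere_prob)"
    proof (rule integral_sphere_mono)
      show "integrable sphere_prob (\<lambda>p. \<bar>g ((norm (x - p))\<^sup>2)\<bar>)"
        by (intro integrable_abs test_pair_abs_integral(1)[OF tp x])
      then show "integrable sphere_prob (\<lambda>p. \<bar>indicator E p * g ((norm (x - p))\<^sup>2)\<bar>)"
        by (rule Bochner_Integration.integrable_bound) (auto simp: indicator_def)
    qed (auto simp: indicator_def)
    also have "\<dots> \<le> C" by (rule test_pair_abs_integral(2)[OF tp x])
    finally show ?thesis .
  qed
  have hi: "integrable sphere_prob (\<lambda>x. h x)"
    by (rule sphere_prob.integrable_const_bound[where B=C])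
       (auto intro!: eventually_mono[OF AE_sphere_prob] hC)
  have fhi: "integrable sphere_prob (\<lambda>x. f x * h x)"
  proof (rule Bochner_Integration.integrable_bound[OF integrable_mult_right[OF fi, of C]])
    show "AE x in sphere_prob. norm (f x * h x) \<le> norm (C * f x)"
      by (rule eventually_mono[OF AE_sphere_prob])
        (use hC C in \<open>simp add: abs_mult mult.commute[of C] mult_left_mono\<close>)
  qed measurable
  have "(\<integral>x. f x * h x \<partial>sphere_prob) = (\<integral>x. (\<integral>p. q p x \<partial>sphere_prob) \<partial>sphere_prob)"
    unfolding h_def q_def by (subst integral_mult_right_zero[symmetric]) (simp only: mult.left_commute)
  also have "\<dots> = (\<integral>p. (\<integral>x. q p x \<partial>sphere_prob) \<partial>sphere_prob)"
  proof (rule integral_sphere_swap[OF qm])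
    fix p :: 'a assume p: "norm p = 1"
    show "integrable sphere_prob (q p)" unfolding q_def[abs_def] by (intro integrable_mult_right fg p)
    have "(\<integral>x. \<bar>q p x\<bar> \<partial>sphere_prob) \<le> (\<integral>x. B * \<bar>f x\<bar> \<partial>sphere_prob)"
    proof (rule integral_sphere_mono)
      show "integrable sphere_prob (\<lambda>x. \<bar>q p x\<bar>)" unfolding q_def[abs_def] by (intro integrable_abs integrable_mult_right fg p)
      show "integrable sphere_prob (\<lambda>x. B * \<bar>f x\<bar>)" by (intro integrable_mult_right integrable_abs fi)
      fix x :: 'a assume "norm x = 1"
      then show "\<bar>q p x\<bar> \<le> B * \<bar>f x\<bar>"
        using gb[OF _ p, of x] B0 by (auto simp: q_def indicator_def abs_mult mult.commute[of B] mult_left_mono)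
    qed
    then show "(\<integral>x. \<bar>q p x\<bar> \<partial>sphere_prob) \<le> B * (\<integral>x. \<bar>f x\<bar> \<partial>sphere_prob)" by simp
  qed
  also have "\<dots> \<le> (\<integral>p. - Q * indicator E p \<partial>sphere_prob)"
  proof (rule integral_sphere_mono)
    show "integrable sphere_prob (\<lambda>p. - Q * indicator E p)"
      by (intro integrable_mult_right integrable_real_indicator) (auto simp: sphere_prob.emeasure_eq_measure)
    show "integrable sphere_prob (\<lambda>p. \<integral>x. q p x \<partial>sphere_prob)"
    proof (rule sphere_prob.integrable_const_bound[where B="B * (\<integral>x. \<bar>f x\<bar> \<partial>sphere_prob)"])
      show "AE p in sphere_prob. norm (\<integral>x. q p x \<partial>sphere_prob) \<le> B * (\<integral>x. \<bar>f x\<bar> \<partial>sphere_prob)"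
      proof (rule eventually_mono[OF AE_sphere_prob])
        fix p :: 'a assume p: "norm p = 1"
        have "\<bar>\<integral>x. q p x \<partial>sphere_prob\<bar> \<le> (\<integral>x. \<bar>q p x\<bar> \<partial>sphere_prob)" by (rule integral_abs_bound)
        also have "\<dots> \<le> (\<integral>x. B * \<bar>f x\<bar> \<partial>sphere_prob)"
        proof (rule integral_sphere_mono)
          show "integrable sphere_prob (\<lambda>x. \<bar>q p x\<bar>)" unfolding q_def[abs_def] by (intro integrable_abs integrable_mult_right fg p)
          show "integrable sphere_prob (\<lambda>x. B * \<bar>f x\<bar>)" by (intro integrable_mult_right integrable_abs fi)
          fix x :: 'a assume "norm x = 1"
          then show "\<bar>q p x\<bar> \<le> B * \<bar>f x\<bar>"
            using gb[OF _ p, of x] B0 by (auto simp: q_def indicator_def abs_mult mult.commute[of B] mult_left_mono)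
        qed
        finally show "norm (\<integral>x. q p x \<partial>sphere_prob) \<le> B * (\<integral>x. \<bar>f x\<bar> \<partial>sphere_prob)" by simp
      qed
    qed measurable
    fix p :: 'a assume p: "norm p = 1"
    show "(\<integral>x. q p x \<partial>sphere_prob) \<le> - Q * indicator E p"
    proof (cases "p \<in> E")
      case True
      have "\<phi> ((norm (y j - p))\<^sup>2) \<le> 0" if "j \<in> {1..N}" for j
      proof (rule neg)
        have "r < norm (y j - p)" using True that by (auto simp: E_def norm_minus_commute)
        then show "r\<^sup>2 \<le> (norm (y j - p))\<^sup>2" using r by (intro power_mono) auto
      qed
      then have "(\<Sum>j=1..N. \<phi> ((norm (y j - p))\<^sup>2)) \<le> 0" by (intro sum_nonpos) auto
      then show ?thesis using True fgp[OF p] by (simp add: q_def Q_def)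
    qed (simp add: q_def)
  qed
  also have "\<dots> = - Q * measure sphere_prob E" by simp
  also have "\<dots> \<le> - Q / 2" using mult_left_mono[OF Em Q0] by simp
  finally have up: "(\<integral>x. f x * h x \<partial>sphere_prob) \<le> - Q / 2" .
  \<comment> \<open>Integrates \<open>(f x + m) * (h x + C) \<ge> 0\<close>. Adding \<open>C\<close>
    makes the multiplier nonnegative and costs nothing because \<open>f\<close> has mean 0.\<close>
  have "(\<integral>x. - m * (h x + C) \<partial>sphere_prob) \<le> (\<integral>x. f x * h x + C * f x \<partial>sphere_prob)"
  proof (rule integral_mono_AE)
    show "integrable sphere_prob (\<lambda>x. - m * (h x + C))" using hi by (intro integrable_mult_right Bochner_Integration.integrable_add) auto
    show "integrable sphere_prob (\<lambda>x. f x * h x + C * f x)" by (intro Bochner_Integration.integrable_add fhi integrable_mult_right fi)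
    show "AE x in sphere_prob. - m * (h x + C) \<le> f x * h x + C * f x"
      using AE_sphere_prob fm
    proof eventually_elim
      case (elim x)
      have "h x + C \<ge> 0" using hC[OF elim(1)] by linarith
      from mult_right_mono[OF elim(2) this] show ?case by (simp add: algebra_simps)
    qed
  qed
  also have "\<dots> = (\<integral>x. f x * h x \<partial>sphere_prob)" using fhi fi f0 by simp
  finally have low: "(\<integral>x. - m * (h x + C) \<partial>sphere_prob) \<le> (\<integral>x. f x * h x \<partial>sphere_prob)" .
  have "(\<integral>x. h x \<partial>sphere_prob) \<le> (\<integral>x. C \<partial>(sphere_prob :: 'a measure))"
    using hi by (rule integral_sphere_mono) (auto dest: hC)
  then have "(\<integral>x. h x + C \<partial>sphere_prob) \<le> 2 * C" using hi by simp
  then have "m * (\<integral>x. h x + C \<partial>sphere_prob) \<le> m * (2 * C)" by (rule mult_left_mono[OF _ m0])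
  then have "- (m * (2 * C)) \<le> (\<integral>x. - m * (h x + C) \<partial>sphere_prob)" by simp
  with low up have "- (m * (2 * C)) \<le> - Q / 2" by linarith
  then show ?thesis by (simp add: Q_def mult_ac)
qed

text \<open>With \<open>\<delta> = \<epsilon> * N powr (- 1 / d)\<close> the quantity
  \<open>N * \<delta> powr (d - s)\<close> is a constant times \<open>N powr (s / d)\<close>. All
  three ranges of \<open>s\<close> are covered at once; for \<open>s = 0\<close> the power is
  1.\<close>

lemma max_polarization_le:
  obtains c where "c > 0" and "\<And>N. N \<ge> 1 \<Longrightarrow>
    max_polarization (riesz_kernel s :: 'a \<Rightarrow> 'a \<Rightarrow> ereal) N \<le> ereal (riesz_mean * real N - c * real N powr (s / d))"
proof -
  obtain R C c where R: "R > 0" and C: "C > 0" and c: "c > 0"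
    and tp: "\<And>\<delta>. 0 < \<delta> \<Longrightarrow> \<delta> \<le> 1 \<Longrightarrow> \<exists>g \<phi>. test_pair C g \<phi> \<and> (\<forall>u. (R * \<delta>)\<^sup>2 \<le> u \<longrightarrow> \<phi> u \<le> 0)
        \<and> c * \<delta> powr (d - s) \<le> zonal_mean \<phi>"
    using exists_test_pair by metis
  have dr: "real d > 0" using d by simp
  \<comment> \<open>Small enough that \<open>N\<close> caps of radius \<open>R * \<delta>\<close>
    have total measure at most \<open>(R * \<epsilon>) ^ d \<le> 1 / 2\<close>.\<close>
  define \<epsilon> where "\<epsilon> = min 1 (1 / (2 * R))"
  have \<epsilon>: "\<epsilon> > 0" "\<epsilon> \<le> 1" "R * \<epsilon> \<le> 1 / 2"
  proof -
    show "\<epsilon> > 0" "\<epsilon> \<le> 1" using R by (auto simp: \<epsilon>_def)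
    have "R * \<epsilon> \<le> R * (1 / (2 * R))" using R by (intro mult_left_mono) (auto simp: \<epsilon>_def)
    then show "R * \<epsilon> \<le> 1 / 2" using R by simp
  qed
  define b where "b = c * \<epsilon> powr (d - s) / (4 * C)"
  have b: "b > 0" using c C \<epsilon> by (simp add: b_def)
  show thesis
  proof
    show "b > 0" by (fact b)
    fix N :: nat assume N: "N \<ge> 1"
    define \<delta> where "\<delta> = \<epsilon> * real N powr (- 1 / d)"
    have Np: "real N powr (- 1 / d) > 0" "real N powr (- 1 / d) \<le> 1"
      using N dr powr_mono[of "- 1 / d" 0 "real N"] by auto
    have \<delta>: "0 < \<delta>" "\<delta> \<le> 1"
      using \<epsilon> Np by (auto simp: \<delta>_def intro: mult_le_one)
    obtain g \<phi> where g: "test_pair C g \<phi>" "\<And>u. (R * \<delta>)\<^sup>2 \<le> u \<Longrightarrow> \<phi> u \<le> 0"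
      "c * \<delta> powr (d - s) \<le> zonal_mean \<phi>" using tp[OF \<delta>] by blast
    have mean0: "zonal_mean \<phi> \<ge> 0" using g(3) c by (meson less_imp_le mult_nonneg_nonneg order_trans powr_ge_zero)
    have Rd: "R * \<delta> > 0" using R \<delta> by simp
    have small: "real N * (R * \<delta>) ^ d \<le> 1 / 2"
    proof -
      have "(real N powr (- 1 / d)) ^ d = 1 / real N"
      proof -
        have "(real N powr (- 1 / d)) ^ d = real N powr (real d * (- 1 / d))"
          using N by (subst powr_power) (auto simp: mult.commute)
        also have "real d * (- 1 / d) = - 1" using dr by simp
        finally show ?thesis by (simp add: powr_minus_divide)
      qed
      then have "real N * (R * \<delta>) ^ d = (R * \<epsilon>) ^ d"
        using N by (simp add: \<delta>_def power_mult_distrib)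
      also have "\<dots> \<le> (1 / 2) ^ d" using \<epsilon> R by (intro power_mono) auto
      also have "\<dots> \<le> (1 / 2) ^ 1" using d by (intro power_decreasing) auto
      finally show ?thesis by simp
    qed
    have scale: "real N * (c * \<delta> powr (d - s)) = 4 * C * (b * real N powr (s / d))"
    proof -
      have "(real N powr (- 1 / d)) powr (d - s) = real N powr (s / d - 1)"
      proof -
        have "- 1 / d * (d - s) = s / d - 1" using dr by (simp add: field_simps)
        then show ?thesis by (simp only: powr_powr)
      qed
      then have "\<delta> powr (d - s) = \<epsilon> powr (d - s) * (real N powr (s / d) / real N)"
      proof -
        have "real N powr (s / d - 1) = real N powr (s / d) / real N" using N by (simp add: powr_diff)
        with \<open>(real N powr (- 1 / d)) powr (d - s) = _\<close> show ?thesis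
          unfolding \<delta>_def using \<epsilon> by (subst powr_mult) simp_all
      qed
      then show ?thesis using N C by (simp add: b_def)
    qed
    show "max_polarization (riesz_kernel s :: 'a \<Rightarrow> 'a \<Rightarrow> ereal) N \<le> ereal (riesz_mean * real N - b * real N powr (s / d))"
      unfolding max_polarization_def
    proof (rule SUP_least)
      fix \<omega> :: "nat \<Rightarrow> 'a" assume \<omega>: "\<omega> \<in> {1..N} \<rightarrow> sphere 0 1"
      show "polarization (riesz_kernel s) N \<omega> \<le> ereal (riesz_mean * real N - b * real N powr (s / d))"
      proof (rule ccontr)
        assume "\<not> ?thesis"
        \<comment> \<open>A real number below the polarization, which a priori could be infinite; it
          determines the real deviation \<open>m\<close>.\<close>
        then obtain t where t: "riesz_mean * real N - b * real N powr (s / d) < t" "ereal t < polarization (riesz_kernel s) N \<omega>"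
          using ereal_dense2[of "ereal (riesz_mean * real N - b * real N powr (s / d))" "polarization (riesz_kernel s) N \<omega>"]
          by (auto simp: not_le)
        define m where "m = riesz_mean * real N - t"
        have "real N * zonal_mean \<phi> \<le> 4 * C * m"
        proof (rule potential_minimum_le[OF g(1) C Rd small g(2) mean0])
          show "norm (\<omega> j) = 1" if "j \<in> {1..N}" for j using \<omega> that by auto
          fix x :: 'a assume x: "norm x = 1" "x \<notin> \<omega> ` {1..N}"
          have "ereal t \<le> (\<Sum>j=1..N. riesz_kernel s x (\<omega> j))"
            using t(2) x(1) unfolding polarization_def by (intro order_trans[OF less_imp_le INF_lower]) auto
          also have "\<dots> = ereal (\<Sum>j=1..N. \<kappa> ((norm (x - \<omega> j))\<^sup>2))"
            using x(2) by (subst sum_ereal[symmetric]) (rule sum.cong, auto simp: riesz_kernel_eq)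
          finally show "riesz_mean * real N - m \<le> (\<Sum>j=1..N. \<kappa> ((norm (x - \<omega> j))\<^sup>2))" by (simp add: m_def)
        qed
        moreover have "real N * (c * \<delta> powr (d - s)) \<le> real N * zonal_mean \<phi>"
          by (intro mult_left_mono g(3)) simp
        ultimately have "4 * C * (b * real N powr (s / d)) \<le> 4 * C * m" unfolding scale by linarith
        then have "b * real N powr (s / d) \<le> m" using C by simp
        then show False using t(1) by (simp add: m_def)
      qed
    qed
  qed
qed

end

section \<open>Polarization bounds in the three ranges of the exponent\<close>

theorem theorem2p1:
  fixes d :: nat and s :: real and K :: "'a::euclidean_space \<Rightarrow> 'a \<Rightarrow> ereal"
  assumes "d \<ge> 1" and "DIM('a) = d + 1"
    and "- 2 < s" and "s < real d"
    and "K = riesz_kernel s"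
  shows "\<exists>b c :: real. b > 0 \<and> c > 0 \<and> (\<forall>N::nat. N \<ge> 1 \<longrightarrow>
    (0 < s \<longrightarrow>
      ereal (- b * real N powr (s / real d))
        \<le> max_polarization K N - ereal (continuous_energy K * real N) \<and>
      max_polarization K N - ereal (continuous_energy K * real N)
        \<le> ereal (- c * real N powr (s / real d))) \<and>
    (s < 0 \<longrightarrow>
      ereal (continuous_energy K + b * real N powr (s / real d))
        \<le> max_polarization K N - ereal (continuous_energy K * real N) \<and>
      max_polarization K N - ereal (continuous_energy K * real N)
        \<le> ereal (- c * real N powr (s / real d))) \<and>
    (s = 0 \<longrightarrow>
      ereal (- (ln (real N) / real d) - b)
        \<le> max_polarization K N - ereal (continuous_energy K * real N) \<and>
      max_polarization K N - ereal (continuous_energy K * real N)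
        \<le> ereal (- c)))"
proof -
  obtain e :: 'a where "e \<in> Basis" using nonempty_Basis by blast
  then interpret sphere_riesz d e s
    using assms(1-4) by unfold_locales auto
  have lower: "ereal b \<le> max_polarization K N - ereal (continuous_energy K * real N)"
    if "ereal (riesz_mean * real N + b) \<le> max_polarization K N" for b N
    using that unfolding assms(5) continuous_energy_riesz
    by (cases "max_polarization (riesz_kernel s :: 'a \<Rightarrow> 'a \<Rightarrow> ereal) N") auto
  have upper: "max_polarization K N - ereal (continuous_energy K * real N) \<le> ereal b"
    if "max_polarization K N \<le> ereal (riesz_mean * real N + b)" for b N
    using that unfolding assms(5) continuous_energy_riesz
    by (cases "max_polarization (riesz_kernel s :: 'a \<Rightarrow> 'a \<Rightarrow> ereal) N") auto
  obtain c where c: "c > 0" "\<And>N. N \<ge> 1 \<Longrightarrow> max_polarization K N \<le> ereal (riesz_mean * real N + (- c * real N powr (s / d)))"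
    using max_polarization_le unfolding assms(5) by (metis diff_conv_add_uminus mult_minus_left)
  consider "s > 0" | "s < 0" | "s = 0" by linarith
  then show ?thesis
  proof cases
    case 1
    obtain b where b: "b > 0" "\<And>N. N \<ge> 1 \<Longrightarrow> ereal (riesz_mean * real N + (- b * real N powr (s / d))) \<le> max_polarization K N"
      using max_polarization_ge_pos[OF 1] unfolding assms(5) by (metis diff_conv_add_uminus mult_minus_left)
    show ?thesis
      using 1 b c by (intro exI[of _ b] exI[of _ c] conjI allI impI lower upper) auto
  next
    case 2
    obtain b where b: "b > 0" "\<And>N. N \<ge> 1 \<Longrightarrow> ereal (riesz_mean * real N + (riesz_mean + b * real N powr (s / d))) \<le> max_polarization K N"
      using max_polarization_ge_neg[OF 2] unfolding assms(5) by metis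
    then have "\<And>N. N \<ge> 1 \<Longrightarrow> ereal (riesz_mean * real N + (continuous_energy K + b * real N powr (s / d))) \<le> max_polarization K N"
      unfolding assms(5) continuous_energy_riesz by blast
    then show ?thesis
      using 2 b(1) c by (intro exI[of _ b] exI[of _ c] conjI allI impI lower upper) auto
  next
    case 3
    obtain b where b: "b > 0" "\<And>N. N \<ge> 1 \<Longrightarrow> ereal (riesz_mean * real N - (ln (real N) / d + b)) \<le> max_polarization K N"
      using max_polarization_ge_zero[OF 3] unfolding assms(5) by metis
    then have "\<And>N. N \<ge> 1 \<Longrightarrow> ereal (riesz_mean * real N + (- (ln (real N) / d) - b)) \<le> max_polarization K N"
      by (simp add: algebra_simps)
    moreover have "\<And>N. N \<ge> 1 \<Longrightarrow> max_polarization K N \<le> ereal (riesz_mean * real N + - c)"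
      using c(2) 3 by simp
    ultimately show ?thesis
      using 3 b(1) c(1) by (intro exI[of _ b] exI[of _ c] conjI allI impI lower upper) auto
  qed
qed

end
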